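(* Let $d\ge1$ and let $b_d$ be the Weyl symbol of the inverse of the harmonic oscillator $H=-\Delta+|x|^2$ on $\mathbf R^d$. For $X\in\mathbf R^{2d}\setminus\{0\}$ let $$b_{d,0}(X)=|X|^{-2},\qquad b_{d,j}(X)=\Big((-1)^j(2j-1)!!\prod_{l=1}^{j}(d-2l)\Big)|X|^{-2-4j},\quad j\ge1.$$ Then for every $N\in\mathbf N$ with $N\ge1$ and every $\alpha\in\mathbf N^{2d}$ there is a positive constant $C_{\alpha,N}$, depending only on $\alpha$, $N$ and the dimension $d$, such that $$\Big|\partial_X^\alpha\Big(b_d(X)-\sum_{j<N}b_{d,j}(X)\Big)\Big|\le C_{\alpha,N}|X|^{-2-4N-|\alpha|}$$ for all $X\in\mathbf R^{2d}\setminus\{0\}$, where the sum is over integers $0\le j<N$.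
   Context: $\mathbf N=\{0,1,2,\dots\}$. For an odd positive integer, $(2j-1)!!=1\cdot3\cdots(2j-1)$. The harmonic oscillator $H=-\Delta+|x|^2$ on $\mathbf R^d$ is strictly positive on $L^2(\mathbf R^d)$ and invertible. The Weyl symbol of $H^{-1}$ is the (unique, smooth) function $b_d$ on $\mathbf R^{2d}$, $X=(x,\xi)$, such that, in the sense of Weyl quantization (oscillatory integrals), $$H^{-1}f(x)=(2\pi)^{-d}\iint e^{i\langle x-y,\xi\rangle}\,b_d\big((x+y)/2,\xi\big)f(y)\,dy\,d\xi,\qquad f\in\mathscr S(\mathbf R^d).$$ *)

theory Defs
  imports "HOL-Analysis.Analysis"
begin

section \<open>Partial derivatives and Schwartz functions\<close>

definition partial_deriv ::
  "'a::real_normed_vector \<Rightarrow> ('a \<Rightarrow> 'b::real_normed_vector) \<Rightarrow> 'a \<Rightarrow> 'b"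
  where "partial_deriv v f x = vector_derivative (\<lambda>t. f (x + t *\<^sub>R v)) (at 0)"

definition smooth :: "('a::euclidean_space \<Rightarrow> 'b::real_normed_vector) \<Rightarrow> bool"
  where "smooth f \<longleftrightarrow>
    (\<forall>vs. set vs \<subseteq> Basis \<longrightarrow> (\<forall>x. foldr partial_deriv vs f differentiable (at x)))"

text \<open>
  A multi-index on a Euclidean space is a function \<open>\<alpha>\<close> from its standard basis to the naturals;
  the values of \<open>\<alpha>\<close> outside \<open>Basis\<close> are irrelevant. The partial derivatives are taken in an
  arbitrary but fixed order of the coordinates, which is immaterial near points where the function
  is smooth.
\<close>

definition multi_order :: "('a::euclidean_space \<Rightarrow> nat) \<Rightarrow> nat"
  where "multi_order \<alpha> = (\<Sum>v\<in>Basis. \<alpha> v)"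

definition multi_deriv ::
  "('a::euclidean_space \<Rightarrow> nat) \<Rightarrow> ('a \<Rightarrow> 'b::real_normed_vector) \<Rightarrow> 'a \<Rightarrow> 'b"
  where "multi_deriv \<alpha> f =
    foldr (\<lambda>v. partial_deriv v ^^ \<alpha> v) (SOME vs. distinct vs \<and> set vs = Basis) f"

definition schwartz :: "('a::euclidean_space \<Rightarrow> 'b::real_normed_vector) \<Rightarrow> bool"
  where "schwartz f \<longleftrightarrow> smooth f \<and>
    (\<forall>\<alpha> k. \<exists>C. \<forall>x. (1 + norm x) ^ k * norm (multi_deriv \<alpha> f x) \<le> C)"


section \<open>The harmonic oscillator\<close>

definition laplacian :: "('a::euclidean_space \<Rightarrow> 'b::real_normed_vector) \<Rightarrow> 'a \<Rightarrow> 'b"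
  where "laplacian f x = (\<Sum>v\<in>Basis. partial_deriv v (partial_deriv v f) x)"

definition harmonic_oscillator :: "('a::euclidean_space \<Rightarrow> complex) \<Rightarrow> 'a \<Rightarrow> complex"
  where "harmonic_oscillator f x = - laplacian f x + of_real ((norm x)\<^sup>2) * f x"

definition L2 :: "('a::euclidean_space \<Rightarrow> complex) \<Rightarrow> bool"
  where "L2 f \<longleftrightarrow> f \<in> borel_measurable lborel \<and> integrable lborel (\<lambda>x. (norm (f x))\<^sup>2)"

text \<open>
  The graph of the (self-adjoint) operator \<open>H = -\<Delta> + |x|\<^sup>2\<close> on \<open>L\<^sup>2\<close>: its domain consists of all
  \<open>u\<close> in \<open>L\<^sup>2\<close> for which \<open>H u\<close>, taken in the sense of tempered distributions, belongs to \<open>L\<^sup>2\<close>.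
  Elements of \<open>L\<^sup>2\<close> are represented by functions, so the graph is closed under changing either
  function on a null set. The graph of the inverse operator is the converse relation.
\<close>

definition harmonic_oscillator_L2 ::
  "('a::euclidean_space \<Rightarrow> complex) \<Rightarrow> ('a \<Rightarrow> complex) \<Rightarrow> bool"
  where "harmonic_oscillator_L2 u f \<longleftrightarrow> L2 u \<and> L2 f \<and>
    (\<forall>\<phi>. schwartz \<phi> \<longrightarrow>
      (\<integral>x. u x * harmonic_oscillator \<phi> x \<partial>lborel) = (\<integral>x. f x * \<phi> x \<partial>lborel))"


section \<open>Weyl quantization\<close>

text \<open>
  Oscillatory integrals are limits of integrals regularized by an arbitrary Schwartz cut-off
  \<open>\<theta>(\<epsilon> \<cdot>)\<close> with \<open>\<theta>(0) = 1\<close>; the limit must not depend on \<open>\<theta>\<close>.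
\<close>

definition has_oscillatory_integral ::
  "('a::euclidean_space \<Rightarrow> complex) \<Rightarrow> complex \<Rightarrow> bool"
  where "has_oscillatory_integral a I \<longleftrightarrow>
    (\<forall>\<theta>::'a \<Rightarrow> complex. schwartz \<theta> \<and> \<theta> 0 = 1 \<longrightarrow>
      (\<forall>\<epsilon>>0. integrable lborel (\<lambda>z. \<theta> (\<epsilon> *\<^sub>R z) * a z)) \<and>
      ((\<lambda>\<epsilon>. \<integral>z. \<theta> (\<epsilon> *\<^sub>R z) * a z \<partial>lborel) \<longlongrightarrow> I) (at_right 0))"

text \<open>
  The smooth functions all of whose derivatives have a common polynomial growth order: the usual
  amplitudes of oscillatory integrals.
\<close>

definition amplitude :: "('a::euclidean_space \<Rightarrow> complex) \<Rightarrow> bool"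
  where "amplitude b \<longleftrightarrow> smooth b \<and>
    (\<exists>m::nat. \<forall>\<alpha>. \<exists>C. \<forall>X. norm (multi_deriv \<alpha> b X) \<le> C * (1 + norm X) ^ m)"

definition has_weyl_value ::
  "((real ^ 'd) \<times> (real ^ 'd) \<Rightarrow> complex) \<Rightarrow> (real ^ 'd \<Rightarrow> complex) \<Rightarrow> real ^ 'd \<Rightarrow> complex \<Rightarrow> bool"
  where "has_weyl_value b f x w \<longleftrightarrow>
    (\<exists>I. has_oscillatory_integral
           (\<lambda>(y, \<xi>). exp (\<i> * of_real ((x - y) \<bullet> \<xi>)) * b ((1/2) *\<^sub>R (x + y), \<xi>) * f y) I \<and>
         w = of_real ((2 * pi) powi (- int CARD('d))) * I)"

text \<open>
  An operator on \<open>L\<^sup>2(\<real>\<^sup>d)\<close> is given by its graph: \<open>T f u\<close> means that \<open>f\<close> is in the domain and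
  \<open>u\<close> represents the image of \<open>f\<close>. The quantization formula is therefore required almost everywhere.
\<close>

definition is_weyl_symbol ::
  "((real ^ 'd \<Rightarrow> complex) \<Rightarrow> (real ^ 'd \<Rightarrow> complex) \<Rightarrow> bool) \<Rightarrow>
   ((real ^ 'd) \<times> (real ^ 'd) \<Rightarrow> complex) \<Rightarrow> bool"
  where "is_weyl_symbol T b \<longleftrightarrow> amplitude b \<and>
    (\<forall>f. schwartz f \<longrightarrow>
      (\<exists>u. T f u) \<and> (\<forall>u. T f u \<longrightarrow> (AE x in lborel. has_weyl_value b f x (u x))))"


section \<open>The terms of the expansion\<close>

definition odd_double_fact :: "nat \<Rightarrow> nat"
  where "odd_double_fact j = (\<Prod>i=1..j. 2 * i - 1)"

text \<open>For \<open>j = 0\<close> all products are empty and the term is \<open>|X|\<^sup>-\<^sup>2\<close>.\<close>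

definition expansion_term :: "nat \<Rightarrow> (real ^ 'd) \<times> (real ^ 'd) \<Rightarrow> real"
  where "expansion_term j X =
    (-1) ^ j * real (odd_double_fact j) * (\<Prod>l=1..j. real CARD('d) - 2 * real l) *
    norm X powi (-2 - 4 * int j)"

end

theory Submission
  imports Defs "HOL-Probability.Probability"
begin

text \<open>
  Since \<open>H\<^sup>-\<^sup>1 = \<integral>\<^sub>0\<^sup>\<infinity> e\<^sup>-\<^sup>t\<^sup>H dt\<close>, Mehler's formula and the substitution \<open>s = tanh t\<close> predict
  \<open>b(X) = \<integral>\<^sub>0\<^sup>1 (1 - s\<^sup>2) powr (d/2 - 1) * exp (- s |X|\<^sup>2) ds\<close>. To see that a Weyl symbol \<open>b\<close> of \<open>H\<^sup>-\<^sup>1\<close>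
  must be this function, apply \<open>H\<^sup>-\<^sup>1\<close> to Gaussians with a complex linear term, where it is given by an
  explicit integral over \<open>s\<close>, and pair the result with another such Gaussian. Repeated integration by
  parts bounds the regularized oscillatory integrals by a power of \<open>|x|\<close>, uniformly in the cut-off, so
  the limit may be taken under the pairing, and what remains is the Fourier transform of \<open>b(X) exp (- |X|\<^sup>2)\<close>
  at an arbitrary frequency. It agrees with that of the predicted symbol, hence so do the symbols.
  The expansion is then Watson's lemma: \<open>(1 - s\<^sup>2) powr (d/2 - 1)\<close> is expanded at \<open>s = 0\<close> and each power of
  \<open>s\<close> integrated over the half-line, which bounds every derivative in \<open>|X|\<^sup>2\<close> of the remainder
  by the expected power.
\<close>

section \<open>Gaussian integrals\<close>

text \<open>The test functions exp (z.x - |x|^2 / 2) with complex z = p + i q are, once normalized,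
  the generating function of the Hermite functions. Hence H acts on them as d + 2 t d/dt in a
  parameter t scaling z, and inverting H reduces to recognizing a derivative in one real variable.
  Pairing with - p + i q instead of p + i q cancels the real linear terms on phase space and leaves
  the frequency (2 q, - 2 p), so two real vectors reach every frequency. The obstacle is that the
  quantization formula is a limit for almost every x only, with an exceptional set depending on the
  test function and without a rate, while b may grow polynomially: integrals can be interchanged
  only before the limit. A Gaussian cut-off keeps that stage explicit, since its y-part merely
  widens the Gaussian already present. The estimate is claimed for all X except 0, not only for
  large X. Near the origin it rests on exp (- |X|^2 / 2) being below a constant times any negative
  power of |X|^2, at every scale.\<close>

lemma lborel_integrable_affine:
  fixes f :: "'a::euclidean_space \<Rightarrow> 'b::{banach, second_countable_topology}"
  assumes f: "integrable lborel f" and c: "c \<noteq> 0"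
  shows "integrable lborel (\<lambda>x. f (t + c *\<^sub>R x))"
proof -
  note [measurable] = f[THEN borel_measurable_integrable]
  have "integrable (density (distr lborel borel (\<lambda>x. t + c *\<^sub>R x)) (\<lambda>_. ennreal (\<bar>c\<bar>^DIM('a)))) f"
    using f lborel_affine[OF c, of t] by (simp add: ennreal_power)
  hence "integrable lborel (\<lambda>x. \<bar>c\<bar>^DIM('a) *\<^sub>R f (t + c *\<^sub>R x))"
    by (subst (asm) integrable_density) (auto simp: integrable_distr_eq)
  from integrable_scaleR_right[OF this, of "inverse (\<bar>c\<bar>^DIM('a))"] show ?thesis using c by simp
qed

lemma lborel_integral_affine:
  fixes f :: "'a::euclidean_space \<Rightarrow> 'b::{banach, second_countable_topology}"
  assumes c: "c \<noteq> 0"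
  shows "(\<integral>x. f x \<partial>lborel) = \<bar>c\<bar>^DIM('a) *\<^sub>R (\<integral>x. f (t + c *\<^sub>R x) \<partial>lborel)"
proof (cases "integrable lborel f")
  case True
  note [measurable] = True[THEN borel_measurable_integrable]
  have "(\<integral>x. f x \<partial>lborel) = (\<integral>x. f x \<partial>density (distr lborel borel (\<lambda>x. t + c *\<^sub>R x)) (\<lambda>_. ennreal (\<bar>c\<bar>^DIM('a))))"
    using lborel_affine[OF c, of t] by (simp add: ennreal_power)
  thus ?thesis by (simp add: integral_density integral_distr)
next
  case False
  have "\<not> integrable lborel (\<lambda>x. f (t + c *\<^sub>R x))"
  proof
    assume "integrable lborel (\<lambda>x. f (t + c *\<^sub>R x))"
    from lborel_integrable_affine[OF this, of "1/c" "-(1/c) *\<^sub>R t"] c False show False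
      by (simp add: algebra_simps)
  qed
  thus ?thesis using False by (simp add: not_integrable_integral_eq)
qed

lemma lborel_integrable_basis_prod:
  fixes f :: "'a::euclidean_space \<Rightarrow> real \<Rightarrow> 'b::{real_normed_field,banach,second_countable_topology}"
  assumes "\<And>v. v \<in> Basis \<Longrightarrow> integrable lborel (f v)"
  shows "integrable lborel (\<lambda>x::'a. \<Prod>v\<in>Basis. f v (x \<bullet> v))"
    and "(\<integral>x. (\<Prod>v\<in>Basis. f v (x \<bullet> v)) \<partial>lborel) = (\<Prod>v\<in>Basis. \<integral>t. f v t \<partial>lborel)"
proof -
  interpret product_sigma_finite "\<lambda>_::'a. lborel :: real measure" by standard
  have [measurable]: "f v \<in> borel_measurable borel" if "v \<in> Basis" for v
    using assms[OF that] by auto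
  have [measurable]: "(\<lambda>x::'a. \<Prod>v\<in>Basis. f v (x \<bullet> v)) \<in> borel_measurable borel"
  proof (intro borel_measurable_prod)
    fix v :: 'a assume "v \<in> Basis"
    thus "(\<lambda>x. f v (x \<bullet> v)) \<in> borel_measurable borel"
      using assms[THEN borel_measurable_integrable] by (intro measurable_compose[of "\<lambda>x. x \<bullet> v" borel borel "f v"]) auto
  qed
  have [measurable]: "(\<lambda>g. \<Sum>b\<in>Basis. g b *\<^sub>R b) \<in> borel_measurable (\<Pi>\<^sub>M b\<in>(Basis::'a set). lborel :: real measure)"
    by measurable
  have eq: "(\<Prod>v\<in>Basis. f v ((\<Sum>b\<in>Basis. g b *\<^sub>R b) \<bullet> v)) = (\<Prod>v\<in>Basis. f v (g v))" for g
    by (intro prod.cong) simp_all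
  show "integrable lborel (\<lambda>x::'a. \<Prod>v\<in>Basis. f v (x \<bullet> v))"
    unfolding lborel_eq[where 'a='a] by (subst integrable_distr_eq) (auto simp: eq intro!: product_integrable_prod assms)
  show "(\<integral>x. (\<Prod>v\<in>Basis. f v (x \<bullet> v)) \<partial>lborel) = (\<Prod>v\<in>Basis. \<integral>t. f v t \<partial>lborel)"
    unfolding lborel_eq[where 'a='a] by (subst integral_distr) (auto simp: eq intro!: product_integral_prod assms)
qed

text \<open>Serves as majorant in the frequency variable: one inverse square per coordinate
  suffices, and the product form reduces integrability to dimension one.\<close>

lemma integrable_inverse_prod: "integrable lborel (\<lambda>x::'a::euclidean_space. \<Prod>v\<in>Basis. inverse (1 + (x \<bullet> v)\<^sup>2))"
proof (rule lborel_integrable_basis_prod)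
  have "set_integrable lborel (einterval (-\<infinity>) \<infinity>) (\<lambda>x. inverse (1 + x\<^sup>2)) "
    using Sinc_Integral.integrable_inverse_1_plus_square by simp
  thus "integrable lborel (\<lambda>x::real. inverse (1 + x\<^sup>2))"
    by (simp add: set_integrable_def)
qed

text \<open>The complex vector z = p + i q in exp (z.x - s |x|^2) is carried as two real vectors, so
  that the underlying space remains a real Euclidean space.\<close>

definition gexp :: "real \<Rightarrow> 'a \<Rightarrow> 'a \<Rightarrow> 'a::euclidean_space \<Rightarrow> complex"
  where "gexp s p q x = exp (Complex (p \<bullet> x - s * (x \<bullet> x)) (q \<bullet> x))"

lemma norm_gexp: "norm (gexp s p q x) = exp (p \<bullet> x - s * (x \<bullet> x))"
  by (simp add: gexp_def)

lemma continuous_gexp [continuous_intros]: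
  assumes "continuous_on A f" "continuous_on A g" "continuous_on A h" "continuous_on A k"
  shows "continuous_on A (\<lambda>z. gexp (f z) (g z) (h z) (k z))"
  unfolding gexp_def Complex_eq by (intro continuous_intros assms)

lemma borel_measurable_gexp [measurable]:
  assumes [measurable]: "f \<in> borel_measurable M" "g \<in> borel_measurable M" "h \<in> borel_measurable M" "k \<in> borel_measurable M"
  shows "(\<lambda>z. gexp (f z) (g z) (h z) (k z)) \<in> borel_measurable M"
  unfolding gexp_def Complex_eq by measurable

section \<open>Fourier and Laplace integrals of Gaussians\<close>

lemma gauss_char_real:
  fixes s q :: real
  assumes s: "s > 0"
  shows "integrable lborel (gexp s 0 q)"
    and "(\<integral>x. gexp s 0 q x \<partial>lborel) = of_real (sqrt (pi/s) * exp (-q\<^sup>2/(4 * s)))"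
proof -
  \<comment> \<open>Rescaling by \<open>c\<close> turns exp (- s x^2) into the standard normal
    density, whose characteristic function is the wanted integral.\<close>
  define c where "c = sqrt (2 * s)"
  have c: "c > 0" "c\<^sup>2 = 2 * s" using s by (auto simp: c_def)
  have eq: "gexp s 0 q x = of_real (sqrt (2*pi)) * (std_normal_density (0 + c *\<^sub>R x) *\<^sub>R iexp ((q/c) * (0 + c *\<^sub>R x)))" for x
  proof -
    have e: "- ((0 + c *\<^sub>R x) - 0)\<^sup>2 / (2 * 1\<^sup>2) = - (s * (x * x))"
      using c by (simp add: power_mult_distrib power2_eq_square[of x])
    have "gexp s 0 q x = of_real (exp (- (s * (x * x)))) * iexp (q * x)"
      unfolding gexp_def exp_of_real[symmetric] exp_add[symmetric]
      by (rule arg_cong[where f=exp]) (simp add: complex_eq_iff)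
    thus ?thesis using c unfolding normal_density_def e by (simp add: scaleR_conv_of_real real_sqrt_mult)
  qed
  have i0: "integrable lborel (\<lambda>x. std_normal_density x *\<^sub>R iexp ((q/c) * x))"
  proof (rule Bochner_Integration.integrable_bound)
    show "integrable lborel std_normal_density" by simp
  qed (auto simp: norm_mult)
  show "integrable lborel (gexp s 0 q)"
    unfolding eq[abs_def] using lborel_integrable_affine[OF i0, of c 0] c by (intro integrable_mult_right) auto
  have "(\<integral>x. gexp s 0 q x \<partial>lborel) = of_real (sqrt (2*pi)) * (\<integral>x. std_normal_density (0 + c *\<^sub>R x) *\<^sub>R iexp ((q/c) * (0 + c *\<^sub>R x)) \<partial>lborel)"
    unfolding eq[abs_def] by (rule integral_mult_right_zero)
  also have "(\<integral>x. std_normal_density (0 + c *\<^sub>R x) *\<^sub>R iexp ((q/c) * (0 + c *\<^sub>R x)) \<partial>lborel)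
    = (1/c) *\<^sub>R (\<integral>x. std_normal_density x *\<^sub>R iexp ((q/c) * x) \<partial>lborel)"
    using c by (subst (2) lborel_integral_affine[where c=c and t=0]) auto
  also have "(\<integral>x. std_normal_density x *\<^sub>R iexp ((q/c) * x) \<partial>lborel) = char std_normal_distribution (q/c)"
    unfolding char_def by (subst integral_density) auto
  also have "\<dots> = of_real (exp (-(q/c)\<^sup>2/2))" by (simp add: char_std_normal_distribution)
  also have "of_real (sqrt (2*pi)) * ((1/c) *\<^sub>R complex_of_real (exp (-(q/c)\<^sup>2/2))) = of_real (sqrt (2*pi)/c * exp (-(q/c)\<^sup>2/2))"
    by (simp add: scaleR_conv_of_real)
  also have "sqrt (2*pi)/c = sqrt (pi/s)" using s by (simp add: c_def real_sqrt_divide[symmetric])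
  also have "-(q/c)\<^sup>2/2 = -q\<^sup>2/(4 * s)" using c by (simp add: power_divide)
  finally show "(\<integral>x. gexp s 0 q x \<partial>lborel) = of_real (sqrt (pi/s) * exp (-q\<^sup>2/(4 * s)))" .
qed

lemma gauss_char:
  fixes q :: "'a::euclidean_space"
  assumes s: "s > 0"
  shows "integrable lborel (gexp s 0 q)"
    and "(\<integral>x. gexp s 0 q x \<partial>lborel) = of_real (sqrt (pi/s) ^ DIM('a) * exp (-(q\<bullet>q)/(4 * s)))"
proof -
  have eq: "gexp s 0 q x = (\<Prod>v\<in>Basis. gexp s 0 (q \<bullet> v) (x \<bullet> v))" for x :: 'a
    unfolding gexp_def
    by (subst exp_sum[symmetric])
       (auto intro!: arg_cong[where f=exp] complex_eqI
          simp: euclidean_inner[of q x] euclidean_inner[of x x] sum_distrib_left Re_sum Im_sum sum_negf)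
  show "integrable lborel (gexp s 0 q)"
    unfolding eq[abs_def] by (intro lborel_integrable_basis_prod gauss_char_real s)
  have "(\<integral>x. gexp s 0 q x \<partial>lborel) = (\<Prod>v\<in>Basis. of_real (sqrt (pi/s) * exp (-(q\<bullet>v)\<^sup>2/(4 * s))))"
    unfolding eq[abs_def] by (subst lborel_integrable_basis_prod) (simp_all add: gauss_char_real s)
  also have "\<dots> = of_real (sqrt (pi/s) ^ DIM('a) * exp (\<Sum>v\<in>Basis. -(q\<bullet>v)\<^sup>2/(4 * s)))"
    by (simp add: prod.distrib exp_sum)
  also have "(\<Sum>v\<in>Basis. -(q\<bullet>v)\<^sup>2/(4 * s)) = -(q\<bullet>q)/(4 * s)"
    by (simp add: euclidean_inner[of q q] sum_negf sum_divide_distrib power2_eq_square)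
  finally show "(\<integral>x. gexp s 0 q x \<partial>lborel) = of_real (sqrt (pi/s) ^ DIM('a) * exp (-(q\<bullet>q)/(4 * s)))" .
qed

text \<open>Completes the square for the real linear term only. The translation stays real, and the
  oscillating term survives as a Fourier variable, to which \<open>gauss_char\<close>
  applies.\<close>

lemma gexp_shift:
  assumes "s > 0"
  shows "gexp s p q ((1/(2 * s)) *\<^sub>R p + x) = exp (Complex ((p\<bullet>p)/(4 * s)) ((p\<bullet>q)/(2 * s))) * gexp s 0 q x"
proof -
  have "Complex (p \<bullet> ((1/(2 * s)) *\<^sub>R p + x) - s * (((1/(2 * s)) *\<^sub>R p + x) \<bullet> ((1/(2 * s)) *\<^sub>R p + x))) (q \<bullet> ((1/(2 * s)) *\<^sub>R p + x))
    = Complex ((p\<bullet>p)/(4 * s)) ((p\<bullet>q)/(2 * s)) + Complex (0 - s * (x\<bullet>x)) (q\<bullet>x)"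
    using assms by (intro complex_eqI) (simp_all add: inner_add_left inner_add_right inner_commute field_simps)
  thus ?thesis by (simp add: gexp_def exp_add[symmetric] del: complex_add)
qed

lemma gauss_integral:
  fixes p q :: "'a::euclidean_space"
  assumes s: "s > 0"
  shows "integrable lborel (gexp s p q)"
    and "(\<integral>x. gexp s p q x \<partial>lborel)
       = of_real (sqrt (pi/s) ^ DIM('a)) * exp (Complex ((p\<bullet>p - q\<bullet>q)/(4 * s)) ((p\<bullet>q)/(2 * s)))"
proof -
  define t where "t = (1/(2 * s)) *\<^sub>R p"
  have eq: "gexp s p q (t + 1 *\<^sub>R x) = exp (Complex ((p\<bullet>p)/(4 * s)) ((p\<bullet>q)/(2 * s))) * gexp s 0 q x" for x
    using gexp_shift[OF s, of p q x] by (simp add: t_def)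
  have "integrable lborel (\<lambda>x. gexp s p q (t + 1 *\<^sub>R x))"
    unfolding eq by (intro integrable_mult_right gauss_char s)
  from lborel_integrable_affine[OF this, of 1 "-t"] show "integrable lborel (gexp s p q)" by simp
  have "(\<integral>x. gexp s p q x \<partial>lborel) = (\<integral>x. gexp s p q (t + 1 *\<^sub>R x) \<partial>lborel)"
    by (subst lborel_integral_affine[where c=1 and t=t]) auto
  also have "\<dots> = exp (Complex ((p\<bullet>p)/(4 * s)) ((p\<bullet>q)/(2 * s))) * of_real (sqrt (pi/s) ^ DIM('a) * exp (-(q\<bullet>q)/(4 * s)))"
    unfolding eq by (subst integral_mult_right_zero, subst gauss_char) (simp_all add: s)
  also have "\<dots> = of_real (sqrt (pi/s) ^ DIM('a)) * (exp (Complex ((p\<bullet>p)/(4 * s)) ((p\<bullet>q)/(2 * s))) * exp (of_real (-(q\<bullet>q)/(4 * s))))"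
    by (simp add: exp_of_real[symmetric])
  also have "exp (Complex ((p\<bullet>p)/(4 * s)) ((p\<bullet>q)/(2 * s))) * exp (of_real (-(q\<bullet>q)/(4 * s)))
      = exp (Complex ((p\<bullet>p - q\<bullet>q)/(4 * s)) ((p\<bullet>q)/(2 * s)))"
    unfolding exp_add[symmetric] by (rule arg_cong[where f=exp]) (simp add: complex_eq_iff diff_divide_distrib)
  finally show "(\<integral>x. gexp s p q x \<partial>lborel)
       = of_real (sqrt (pi/s) ^ DIM('a)) * exp (Complex ((p\<bullet>p - q\<bullet>q)/(4 * s)) ((p\<bullet>q)/(2 * s)))" .
qed

lemma poly_gauss_bound:
  assumes s: "s > 0"
  shows "\<exists>C>0. \<forall>x\<ge>0. (1 + x) ^ k * exp (c * x - s * x\<^sup>2) \<le> C * exp (- (s/2) * x\<^sup>2 :: real)"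
\<comment> \<open>From (1 + x)^k \<le> exp (k x), the exponent is at most (k + c) x - s x^2; half of
  the quadratic term pays for the linear one by completing the square, which yields this
  constant.\<close>
proof (intro exI[of _ "exp ((real k + c)\<^sup>2/(2 * s))"] conjI allI impI)
  fix x :: real assume x: "x \<ge> 0"
  have "(1 + x) ^ k \<le> exp x ^ k" using x by (intro power_mono) (auto simp: exp_ge_add_one_self)
  also have "\<dots> = exp (real k * x)" by (simp add: exp_of_nat_mult)
  finally have "(1 + x) ^ k * exp (c * x - s * x\<^sup>2) \<le> exp (real k * x) * exp (c * x - s * x\<^sup>2)"
    by (intro mult_right_mono) auto
  also have "\<dots> = exp ((real k + c) * x - s * x\<^sup>2)" by (simp add: exp_add[symmetric] algebra_simps)
  also have "\<dots> \<le> exp ((real k + c)\<^sup>2/(2 * s) + - (s/2) * x\<^sup>2)"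
  proof -
    have "0 \<le> ((real k + c) - s * x)\<^sup>2" by simp
    hence "(real k + c) * x * (2 * s) \<le> (real k + c)\<^sup>2 + s\<^sup>2 * x\<^sup>2"
      by (simp add: power2_eq_square algebra_simps)
    hence "(real k + c) * x \<le> ((real k + c)\<^sup>2 + s\<^sup>2 * x\<^sup>2) / (2 * s)"
      using s by (simp add: pos_le_divide_eq)
    also have "\<dots> = (real k + c)\<^sup>2/(2 * s) + s/2*x\<^sup>2" using s by (simp add: add_divide_distrib power2_eq_square)
    finally show ?thesis by simp
  qed
  finally show "(1 + x) ^ k * exp (c * x - s * x\<^sup>2) \<le> exp ((real k + c)\<^sup>2/(2 * s)) * exp (- (s/2) * x\<^sup>2)"
    by (simp only: exp_add)
qed simp

abbreviation gauss_bd :: "real \<Rightarrow> real \<Rightarrow> 'a::real_normed_vector \<Rightarrow> real" where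
  "gauss_bd c s x \<equiv> exp (c * norm x - s * (norm x)\<^sup>2)"

lemma integrable_exp_norm:
  assumes s: "s > 0"
  shows "integrable lborel (\<lambda>x::'a::euclidean_space. (1 + norm x) ^ k * gauss_bd c s x)"
proof -
  obtain C where C: "C > 0" "\<And>x. x \<ge> 0 \<Longrightarrow> (1 + x) ^ k * exp (c * x - s * x\<^sup>2) \<le> C * exp (- (s/2) * x\<^sup>2)"
    using poly_gauss_bound[OF s, of k c] by blast
  have "integrable lborel (\<lambda>x::'a. C * norm (gexp (s/2) 0 0 x))"
    using s by (intro integrable_mult_right integrable_norm gauss_char) auto
  thus ?thesis
    by (rule Bochner_Integration.integrable_bound)
       (use C(2)[OF norm_ge_zero] C(1) in \<open>auto simp: norm_gexp power2_norm_eq_inner[symmetric] abs_mult\<close>)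
qed

lemma norm_gexp_le:
  assumes "s' \<le> s" "norm p \<le> c"
  shows "norm (gexp s p q x) \<le> gauss_bd c s' x"
proof -
  have "p \<bullet> x \<le> norm p * norm x" by (rule norm_cauchy_schwarz)
  also have "\<dots> \<le> c * norm x" using assms by (intro mult_right_mono) auto
  finally show ?thesis using assms mult_right_mono[OF assms(1), of "(norm x)\<^sup>2"]
    by (simp add: norm_gexp power2_norm_eq_inner)
qed

section \<open>Directional derivatives and Schwartz functions\<close>

definition dderiv :: "'a::real_normed_vector \<Rightarrow> ('a \<Rightarrow> 'b::real_normed_vector) \<Rightarrow> ('a \<Rightarrow> 'b) \<Rightarrow> bool"
  where "dderiv v f f' \<longleftrightarrow> (\<forall>x. ((\<lambda>t. f (x + t *\<^sub>R v)) has_vector_derivative f' x) (at 0))"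

lemma has_derivative_imp_line:
  assumes "(f has_derivative D) (at x)"
  shows "((\<lambda>t. f (x + t *\<^sub>R v)) has_vector_derivative D v) (at 0)"
proof -
  have "((\<lambda>t. x + t *\<^sub>R v) has_derivative (\<lambda>t. t *\<^sub>R v)) (at 0)"
    by (auto intro!: derivative_eq_intros)
  moreover have "(f has_derivative D) (at (x + 0 *\<^sub>R v))" using assms by simp
  ultimately have "((\<lambda>t. f (x + t *\<^sub>R v)) has_derivative (\<lambda>t. D (t *\<^sub>R v))) (at 0)"
    by (rule has_derivative_compose)
  moreover have "linear D" using assms has_derivative_linear by blast
  ultimately show ?thesis by (simp add: has_vector_derivative_def linear_scale)
qed

text \<open>\<open>partial_deriv\<close> has a value even where no derivative exists;
  differentiability upgrades it to the relation \<open>dderiv\<close>, which includes existence and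
  can be used in the fundamental theorem.\<close>

lemma dderiv_partial:
  assumes "\<And>x. f differentiable (at x)"
  shows "dderiv v f (partial_deriv v f)"
  unfolding dderiv_def partial_deriv_def
proof
  fix x
  obtain D where "(f has_derivative D) (at x)" using assms unfolding differentiable_def by blast
  from has_derivative_imp_line[OF this, of v]
  have "((\<lambda>t. f (x + t *\<^sub>R v)) has_vector_derivative D v) (at 0)" .
  thus "((\<lambda>t. f (x + t *\<^sub>R v)) has_vector_derivative vector_derivative (\<lambda>t. f (x + t *\<^sub>R v)) (at 0)) (at 0)"
    by (simp add: vector_derivative_at)
qed

lemma dderiv_imp_partial: "dderiv v f f' \<Longrightarrow> partial_deriv v f = f'"
  unfolding dderiv_def partial_deriv_def by (auto simp: vector_derivative_at)

lemma dderiv_line: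
  assumes "dderiv v f f'"
  shows "((\<lambda>t. f (x + t *\<^sub>R v)) has_vector_derivative f' (x + t *\<^sub>R v)) (at t)"
proof -
  have "((\<lambda>r. f ((x + t *\<^sub>R v) + r *\<^sub>R v)) has_vector_derivative f' (x + t *\<^sub>R v)) (at 0)"
    using assms unfolding dderiv_def by blast
  hence 1: "((\<lambda>r. f ((x + t *\<^sub>R v) + r *\<^sub>R v)) has_vector_derivative f' (x + t *\<^sub>R v)) (at (t - t))"
    by simp
  have "((\<lambda>r. r - t) has_vector_derivative 1) (at t)"
    by (auto intro!: derivative_eq_intros)
  from vector_diff_chain_at[OF this 1] show ?thesis by (simp add: o_def algebra_simps)
qed

lemma dderiv_add: "dderiv v f f' \<Longrightarrow> dderiv v g g' \<Longrightarrow> dderiv v (\<lambda>x. f x + g x) (\<lambda>x. f' x + g' x)"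
  unfolding dderiv_def by (auto intro!: derivative_intros)

lemma dderiv_diff: "dderiv v f f' \<Longrightarrow> dderiv v g g' \<Longrightarrow> dderiv v (\<lambda>x. f x - g x) (\<lambda>x. f' x - g' x)"
  unfolding dderiv_def by (auto intro!: derivative_intros)

lemma dderiv_const: "dderiv v (\<lambda>x. c) (\<lambda>x. 0)"
  unfolding dderiv_def by (auto intro!: derivative_intros)

lemma dderiv_mult:
  fixes f g :: "'a::real_normed_vector \<Rightarrow> 'b::real_normed_algebra"
  assumes "dderiv v f f'" "dderiv v g g'"
  shows "dderiv v (\<lambda>x. f x * g x) (\<lambda>x. f x * g' x + f' x * g x)"
  unfolding dderiv_def
proof
  fix x
  show "((\<lambda>t. f (x + t *\<^sub>R v) * g (x + t *\<^sub>R v)) has_vector_derivative f x * g' x + f' x * g x) (at 0)"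
    using has_vector_derivative_mult[of "\<lambda>t. f (x + t *\<^sub>R v)" "f' x" 0 UNIV "\<lambda>t. g (x + t *\<^sub>R v)" "g' x"] assms
    by (simp add: dderiv_def)
qed

text \<open>Integrating G' over the segment from y to y + v gives G (y + v) - G y, whose integral
  over y vanishes by translation invariance. Exchanging the two integrals gives the integral of G'.
  Integrability of G and G' thus takes the place of decay at infinity.\<close>

lemma integral_dderiv_eq_0:
  fixes G :: "'a::euclidean_space \<Rightarrow> 'b::euclidean_space"
  assumes d: "dderiv v G G'" and c: "continuous_on UNIV G'"
    and G: "integrable lborel G" and G': "integrable lborel G'"
  shows "(\<integral>x. G' x \<partial>lborel) = 0"
proof -
  let ?f = "\<lambda>(t::real) (y::'a). indicator {0..1} t *\<^sub>R G' (y + t *\<^sub>R v)"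
  have [measurable]: "G' \<in> borel_measurable borel" using c by (rule borel_measurable_continuous_onI)
  have shift: "integrable lborel (\<lambda>y. g (y + t *\<^sub>R v))" if "integrable lborel g" for g :: "'a \<Rightarrow> 'b" and t
    using lborel_integrable_affine[OF that, of 1 "t *\<^sub>R v"] by (simp add: add.commute)
  have shift_eq: "(\<integral>y. g (y + t *\<^sub>R v) \<partial>lborel) = (\<integral>y. g y \<partial>lborel)"
    for g :: "'a \<Rightarrow> 'c::{banach,second_countable_topology}" and t
    by (subst (2) lborel_integral_affine[where c=1 and t="t *\<^sub>R v"]) (simp_all add: add.commute)
  have int: "integrable (lborel \<Otimes>\<^sub>M lborel) (case_prod ?f)"
  proof (rule lborel_pair.Fubini_integrable)
    show "(case_prod ?f) \<in> borel_measurable (lborel \<Otimes>\<^sub>M lborel)" by measurable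
    have "(\<integral>y. norm (case_prod ?f (t, y)) \<partial>lborel) = indicator {0..1} t *\<^sub>R (\<integral>y. norm (G' y) \<partial>lborel)" for t
      using shift_eq[of "\<lambda>y. norm (G' y)" t] by (simp add: indicator_def)
    thus "integrable lborel (\<lambda>t. \<integral>y. norm (case_prod ?f (t, y)) \<partial>lborel)"
      by (simp only:) (intro integrable_scaleR_left integrable_real_indicator, auto)
  qed (use shift[OF G'] in simp)
  have "(\<integral>y. (\<integral>t. ?f t y \<partial>lborel) \<partial>lborel) = (\<integral>t. (\<integral>y. ?f t y \<partial>lborel) \<partial>lborel)"
    using lborel_pair.Fubini_integral[OF int] by simp
  moreover have "(\<integral>t. ?f t y \<partial>lborel) = G (y + 1 *\<^sub>R v) - G (y + 0 *\<^sub>R v)" for y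
    by (rule integral_FTC_Icc[of _ _ "\<lambda>t. G (y + t *\<^sub>R v)"])
       (auto intro!: has_vector_derivative_at_within[OF dderiv_line[OF d]] continuous_on_compose2[OF c] continuous_intros)
  moreover have "(\<integral>y. G (y + 1 *\<^sub>R v) - G (y + 0 *\<^sub>R v) \<partial>lborel) = 0"
    using shift_eq[of G 1] shift_eq[of G 0] by (subst Bochner_Integration.integral_diff) (use shift[OF G, of 1] G in auto)
  moreover have "(\<integral>t. (\<integral>y. ?f t y \<partial>lborel) \<partial>lborel) = (\<integral>y. G' y \<partial>lborel)"
    using shift_eq[of G'] by simp
  ultimately show ?thesis by simp
qed

section \<open>Polynomials and the Schwartz property of Gaussians\<close>

inductive cpoly :: "('a::euclidean_space \<Rightarrow> complex) \<Rightarrow> bool" where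
  cpoly_const: "cpoly (\<lambda>x. c)"
| cpoly_inner: "cpoly (\<lambda>x. of_real (x \<bullet> v))"
| cpoly_add: "cpoly f \<Longrightarrow> cpoly g \<Longrightarrow> cpoly (\<lambda>x. f x + g x)"
| cpoly_mult: "cpoly f \<Longrightarrow> cpoly g \<Longrightarrow> cpoly (\<lambda>x. f x * g x)"

lemma cpoly_differentiable: "cpoly P \<Longrightarrow> P differentiable (at x)"
proof (induction rule: cpoly.induct)
  case (cpoly_inner v)
  have "((\<lambda>x. complex_of_real (x \<bullet> v)) has_derivative (\<lambda>x. of_real (x \<bullet> v))) (at x)"
    by (auto intro!: derivative_eq_intros)
  thus ?case unfolding differentiable_def by blast
qed (auto intro!: derivative_intros)

lemma cpoly_dderiv: "cpoly P \<Longrightarrow> \<exists>P'. cpoly P' \<and> dderiv v P P'"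
proof (induction rule: cpoly.induct)
  case (cpoly_const c)
  show ?case using dderiv_const cpoly.cpoly_const by blast
next
  case (cpoly_inner u)
  have "dderiv v (\<lambda>x. complex_of_real (x \<bullet> u)) (\<lambda>x. of_real (v \<bullet> u))"
    unfolding dderiv_def by (auto intro!: derivative_eq_intros simp: inner_add_left)
  thus ?case using cpoly.cpoly_const by blast
next
  case (cpoly_add f g)
  then show ?case using dderiv_add cpoly.cpoly_add by blast
next
  case (cpoly_mult f g)
  then obtain f' g' where "cpoly f'" "dderiv v f f'" "cpoly g'" "dderiv v g g'" by blast
  with cpoly_mult show ?case
    by (intro exI[of _ "\<lambda>x. f x * g' x + f' x * g x"]) (auto intro!: dderiv_mult cpoly.intros)
qed

lemma cpoly_bound: "cpoly P \<Longrightarrow> \<exists>C k. \<forall>x. norm (P x) \<le> C * (1 + norm x) ^ k"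
proof (induction rule: cpoly.induct)
  case (cpoly_const c)
  show ?case by (intro exI[of _ "norm c"] exI[of _ 0]) auto
next
  case (cpoly_inner v)
  have "\<bar>x \<bullet> v\<bar> \<le> norm v * (1 + norm x)" for x :: 'a
    using order_trans[OF Cauchy_Schwarz_ineq2[of x v], of "norm v * (1 + norm x)"] by (simp add: algebra_simps)
  thus ?case by (intro exI[of _ "norm v"] exI[of _ 1]) auto
next
  case (cpoly_add f g)
  then obtain C k C' k' where h: "\<And>x::'a. norm (f x) \<le> C * (1 + norm x) ^ k" "\<And>x. norm (g x) \<le> C' * (1 + norm x) ^ k'" by blast
  show ?case
  proof (intro exI[of _ "\<bar>C\<bar> + \<bar>C'\<bar>"] exI[of _ "k + k'"] allI)
    fix x :: 'a
    have "C * (1 + norm x) ^ k \<le> \<bar>C\<bar> * (1 + norm x) ^ (k+k')"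
      by (intro mult_mono power_increasing) auto
    moreover have "C' * (1 + norm x) ^ k' \<le> \<bar>C'\<bar> * (1 + norm x) ^ (k+k')"
      by (intro mult_mono power_increasing) auto
    ultimately show "norm (f x + g x) \<le> (\<bar>C\<bar> + \<bar>C'\<bar>) * (1 + norm x) ^ (k+k')"
      using h[of x] norm_triangle_ineq[of "f x" "g x"] by (simp add: distrib_right)
  qed
next
  case (cpoly_mult f g)
  then obtain C k C' k' where h: "\<And>x::'a. norm (f x) \<le> C * (1 + norm x) ^ k" "\<And>x. norm (g x) \<le> C' * (1 + norm x) ^ k'" by blast
  show ?case
  proof (intro exI[of _ "C * C'"] exI[of _ "k + k'"] allI)
    fix x :: 'a
    have "norm (f x) * norm (g x) \<le> (C * (1 + norm x) ^ k) * (C' * (1 + norm x) ^ k')"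
      by (intro mult_mono h order_trans[OF norm_ge_zero h(1)]) auto
    thus "norm (f x * g x) \<le> C * C' * (1 + norm x) ^ (k+k')"
      by (simp add: norm_mult power_add algebra_simps)
  qed
qed

lemma gexp_has_derivative:
  "(gexp s p q has_derivative (\<lambda>h. gexp s p q x * Complex (p \<bullet> h - 2 * s * (x \<bullet> h)) (q \<bullet> h))) (at x)"
proof -
  have "((\<lambda>x. Complex (p \<bullet> x - s * (x \<bullet> x)) (q \<bullet> x)) has_derivative (\<lambda>h. Complex (p \<bullet> h - 2 * s * (x \<bullet> h)) (q \<bullet> h))) (at x)"
    unfolding Complex_eq
    by (auto intro!: derivative_eq_intros simp: inner_commute algebra_simps)
  from has_derivative_compose[OF this DERIV_exp[unfolded has_field_derivative_def]]
  show ?thesis unfolding gexp_def[abs_def] .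
qed

lemma dderiv_gexp: "dderiv v (gexp s p q) (\<lambda>x. gexp s p q x * Complex (p \<bullet> v - 2 * s * (x \<bullet> v)) (q \<bullet> v))"
  unfolding dderiv_def using has_derivative_imp_line[OF gexp_has_derivative] by blast

lemma foldr_partial_funpow:
  "foldr (\<lambda>v. partial_deriv v ^^ \<alpha> v) vs f = foldr partial_deriv (concat (map (\<lambda>v. replicate (\<alpha> v) v) vs)) f"
proof (induction vs)
  case (Cons v vs)
  have "foldr partial_deriv (replicate n v) g = (partial_deriv v ^^ n) g" for n and g :: "'a \<Rightarrow> 'b"
    by (induction n) auto
  thus ?case using Cons by simp
qed simp

lemma basis_list:
  defines "vs \<equiv> (SOME vs. distinct vs \<and> set vs = (Basis :: 'a::euclidean_space set))"
  shows "distinct vs" "set vs = (Basis :: 'a set)"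
proof -
  have "\<exists>vs. distinct vs \<and> set vs = (Basis :: 'a set)" using finite_distinct_list[OF finite_Basis] by blast
  from someI_ex[OF this] show "distinct vs" "set vs = (Basis :: 'a set)" by (auto simp: vs_def)
qed

text \<open>Turns multi-indices into lists of basis vectors, on which derivatives can be treated by
  induction. The list is the same for every function, so constants obtained from it can be chosen
  before the function.\<close>

lemma multi_deriv_list:
  fixes \<alpha> :: "'a::euclidean_space \<Rightarrow> nat"
  shows "\<exists>vs. set vs \<subseteq> Basis \<and> length vs = multi_order \<alpha> \<and>
    (\<forall>f :: 'a \<Rightarrow> 'b::real_normed_vector. multi_deriv \<alpha> f = foldr partial_deriv vs f)"
proof -
  define us where "us = (SOME vs. distinct vs \<and> set vs = (Basis :: 'a set))"
  have us: "distinct us" "set us = (Basis :: 'a set)" unfolding us_def by (rule basis_list)+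
  have "length (concat (map (\<lambda>v. replicate (\<alpha> v) v) us)) = (\<Sum>v\<leftarrow>us. \<alpha> v)"
    by (simp add: length_concat o_def)
  also have "\<dots> = multi_order \<alpha>" unfolding multi_order_def us(2)[symmetric] using us(1)
    by (rule sum_list_distinct_conv_sum_set)
  finally have "length (concat (map (\<lambda>v. replicate (\<alpha> v) v) us)) = multi_order \<alpha>" .
  moreover have "set (concat (map (\<lambda>v. replicate (\<alpha> v) v) us)) \<subseteq> Basis"
    by (auto simp: set_replicate_conv_if us(2) split: if_splits)
  moreover have "multi_deriv \<alpha> f = foldr partial_deriv (concat (map (\<lambda>v. replicate (\<alpha> v) v) us)) f"
    for f :: "'a \<Rightarrow> 'b"
    unfolding multi_deriv_def us_def[symmetric] by (rule foldr_partial_funpow)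
  ultimately show ?thesis by blast
qed

text \<open>Extracts iterated derivatives in one coordinate direction from bounds stated for
  multi-indices; integration by parts in one direction at a time only meets these.\<close>

lemma multi_deriv_single:
  assumes v: "v \<in> Basis"
  shows "multi_deriv (\<lambda>u. if u = v then n else 0) f = (partial_deriv v ^^ n) f"
proof -
  define us where "us = (SOME vs. distinct vs \<and> set vs = (Basis :: 'a set))"
  have us: "distinct us" "set us = (Basis :: 'a set)" unfolding us_def by (rule basis_list)+
  have 0: "foldr (\<lambda>u. partial_deriv u ^^ (if u = v then n else 0)) ws f = f" if "v \<notin> set ws" for ws
    using that by (induction ws) auto
  have "foldr (\<lambda>u. partial_deriv u ^^ (if u = v then n else 0)) ws f = (partial_deriv v ^^ n) f"
    if "distinct ws" "v \<in> set ws" for ws using that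
  proof (induction ws)
    case (Cons w ws)
    show ?case
    proof (cases "w = v")
      case True thus ?thesis using Cons 0[of ws] by simp
    next
      case False thus ?thesis using Cons by simp
    qed
  qed simp
  thus ?thesis using us v by (simp add: multi_deriv_def us_def[symmetric])
qed

text \<open>For a class stable under partial derivatives, the seminorm conditions on all derivatives
  follow from weighted sup bounds on the members.\<close>

lemma schwartz_classI:
  assumes f: "S f"
    and diff: "\<And>g x. S g \<Longrightarrow> g differentiable (at x)"
    and closed: "\<And>g v. S g \<Longrightarrow> v \<in> Basis \<Longrightarrow> S (partial_deriv v g)"
    and bound: "\<And>g k. S g \<Longrightarrow> \<exists>C. \<forall>x. (1 + norm x) ^ k * norm (g x) \<le> C"
  shows "schwartz f"
proof -
  have S: "S (foldr partial_deriv vs f)" if "set vs \<subseteq> Basis" for vs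
    using that by (induction vs) (auto intro: f closed)
  show ?thesis unfolding schwartz_def smooth_def
  proof (intro conjI allI impI)
    fix \<alpha> :: "'a \<Rightarrow> nat" and k
    obtain vs where vs: "set vs \<subseteq> (Basis::'a set)" "multi_deriv \<alpha> f = foldr partial_deriv vs f"
      using multi_deriv_list[of \<alpha>] by metis
    show "\<exists>C. \<forall>x. (1 + norm x) ^ k * norm (multi_deriv \<alpha> f x) \<le> C"
      unfolding vs(2) by (intro bound S vs)
  qed (use S diff in blast)
qed

lemma schwartz_gexp:
  assumes s: "s > 0"
  shows "schwartz (\<lambda>x. c * gexp s p q x)"
proof (rule schwartz_classI[where S="\<lambda>f. \<exists>P. cpoly P \<and> f = (\<lambda>x. P x * gexp s p q x)"])
  show "\<exists>P. cpoly P \<and> (\<lambda>x. c * gexp s p q x) = (\<lambda>x. P x * gexp s p q x)"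
    by (intro exI[of _ "\<lambda>x. c"]) (auto intro: cpoly.intros)
next
  fix g x assume "\<exists>P. cpoly P \<and> g = (\<lambda>x. P x * gexp s p q x)"
  then obtain P where P: "cpoly P" "g = (\<lambda>x. P x * gexp s p q x)" by blast
  show "g differentiable (at x)" unfolding P(2)
    by (intro differentiable_mult cpoly_differentiable P(1) differentiableI[OF gexp_has_derivative])
next
  fix g and v :: 'a assume "\<exists>P. cpoly P \<and> g = (\<lambda>x. P x * gexp s p q x)"
  then obtain P where P: "cpoly P" "g = (\<lambda>x. P x * gexp s p q x)" by blast
  obtain P' where P': "cpoly P'" "dderiv v P P'" using cpoly_dderiv[OF P(1)] by blast
  have "partial_deriv v g = (\<lambda>x. P x * (gexp s p q x * Complex (p \<bullet> v - 2 * s * (x \<bullet> v)) (q \<bullet> v)) + P' x * gexp s p q x)"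
    unfolding P(2) by (rule dderiv_imp_partial[OF dderiv_mult[OF P'(2) dderiv_gexp]])
  also have "\<dots> = (\<lambda>x. (P x * (Complex (p \<bullet> v) (q \<bullet> v) + of_real (-2 * s) * of_real (x \<bullet> v)) + P' x) * gexp s p q x)"
    by (auto simp: complex_eq_iff algebra_simps intro!: ext)
  finally show "\<exists>P. cpoly P \<and> partial_deriv v g = (\<lambda>x. P x * gexp s p q x)"
    by (intro exI[of _ "\<lambda>x. P x * (Complex (p \<bullet> v) (q \<bullet> v) + of_real (-2 * s) * of_real (x \<bullet> v)) + P' x"])
       (intro conjI cpoly.intros P P')
next
  fix g k assume "\<exists>P. cpoly P \<and> g = (\<lambda>x. P x * gexp s p q x)"
  then obtain P where P: "cpoly P" "g = (\<lambda>x. P x * gexp s p q x)" by blast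
  obtain C l where C: "\<And>x. norm (P x) \<le> C * (1 + norm x) ^ l" using cpoly_bound[OF P(1)] by blast
  obtain C' where C': "C' > 0" "\<And>x. x \<ge> 0 \<Longrightarrow> (1 + x) ^ (k+l) * exp (norm p * x - s * x\<^sup>2) \<le> C' * exp (- (s/2) * x\<^sup>2)"
    using poly_gauss_bound[OF s, of "k+l" "norm p"] by blast
  have C0: "C \<ge> 0" using order_trans[OF norm_ge_zero C[of 0]] by simp
  show "\<exists>C. \<forall>x. (1 + norm x) ^ k * norm (g x) \<le> C"
  proof (intro exI[of _ "C * C'"] allI)
    fix x
    have "(1 + norm x) ^ k * norm (g x) \<le> (1 + norm x) ^ k * ((C * (1 + norm x) ^ l) * gauss_bd (norm p) s x)"
      unfolding P(2) norm_mult using norm_gexp_le[of s s p "norm p" q x]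
      by (intro mult_left_mono mult_mono C) (auto simp: C0)
    also have "\<dots> = C * ((1 + norm x) ^ (k+l) * gauss_bd (norm p) s x)" by (simp add: power_add algebra_simps)
    also have "\<dots> \<le> C * (C' * exp (- (s/2) * (norm x)\<^sup>2))" using C0 C'(2)[of "norm x"] by (intro mult_left_mono) auto
    also have "\<dots> \<le> C * (C' * 1)" using s C0 C'(1) by (intro mult_left_mono) auto
    finally show "(1 + norm x) ^ k * norm (g x) \<le> C * C'" by simp
  qed
qed

section \<open>The harmonic oscillator on Gaussians\<close>

lemma smooth_funpow:
  assumes "smooth f" "v \<in> Basis"
  shows "(partial_deriv v ^^ n) f differentiable (at x)"
    and "continuous_on A ((partial_deriv v ^^ n) f)"
    and "dderiv v ((partial_deriv v ^^ n) f) ((partial_deriv v ^^ Suc n) f)"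
proof -
  have eq: "(partial_deriv v ^^ n) f = foldr partial_deriv (replicate n v) f"
    by (induction n) auto
  have "set (replicate n v) \<subseteq> Basis" using assms by auto
  hence *: "(partial_deriv v ^^ n) f differentiable (at x)" for x
    using assms unfolding smooth_def eq by blast
  show "(partial_deriv v ^^ n) f differentiable (at x)" by (rule *)
  show "continuous_on A ((partial_deriv v ^^ n) f)"
    by (meson * continuous_at_imp_continuous_on differentiable_imp_continuous_within)
  show "dderiv v ((partial_deriv v ^^ n) f) ((partial_deriv v ^^ Suc n) f)"
    using dderiv_partial[OF *] by simp
qed

lemma schwartz_funpow_bounded:
  assumes "schwartz f" "v \<in> Basis"
  shows "\<exists>C. \<forall>x. norm ((partial_deriv v ^^ n) f x) \<le> C"
proof -
  obtain C where "\<And>x. (1 + norm x) ^ 0 * norm (multi_deriv (\<lambda>u. if u = v then n else 0) f x) \<le> C"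
    using assms(1) unfolding schwartz_def by blast
  thus ?thesis using multi_deriv_single[OF assms(2), of n f] by auto
qed

lemma integrable_gexp_poly:
  fixes Q :: "'a::euclidean_space \<Rightarrow> complex"
  assumes s: "s > 0" and Q: "continuous_on UNIV Q" "\<And>x. norm (Q x) \<le> C * (1 + norm x) ^ k"
  shows "integrable lborel (\<lambda>x. gexp s p q x * Q x)"
proof (rule Bochner_Integration.integrable_bound)
  show "integrable lborel (\<lambda>x::'a. C * ((1 + norm x) ^ k * gauss_bd (norm p) s x))"
    by (intro integrable_mult_right integrable_exp_norm s)
  have [measurable]: "Q \<in> borel_measurable borel" using Q(1) by (rule borel_measurable_continuous_onI)
  show "(\<lambda>x. gexp s p q x * Q x) \<in> borel_measurable lborel" by measurable
  show "AE x in lborel. norm (gexp s p q x * Q x) \<le> norm (C * ((1 + norm x) ^ k * gauss_bd (norm p) s x))"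
  proof (intro AE_I2)
    fix x
    have "norm (gexp s p q x * Q x) \<le> gauss_bd (norm p) s x * (C * (1 + norm x) ^ k)"
      unfolding norm_mult by (intro mult_mono norm_gexp_le Q order.refl) auto
    also have "\<dots> = C * ((1 + norm x) ^ k * gauss_bd (norm p) s x)"
      by (simp only: mult_ac)
    also have "\<dots> \<le> norm (C * ((1 + norm x) ^ k * gauss_bd (norm p) s x))"
      by (simp only: real_norm_def abs_ge_self)
    finally show "norm (gexp s p q x * Q x) \<le> norm (C * ((1 + norm x) ^ k * gauss_bd (norm p) s x))" .
  qed
qed

text \<open>The square z.z of z = p + i q for the complex bilinear form, not the Hermitian
  one.\<close>

definition csq :: "'a::euclidean_space \<Rightarrow> 'a \<Rightarrow> complex" where
  "csq p q = Complex (p \<bullet> p - q \<bullet> q) (2 * (p \<bullet> q))"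

text \<open>The factor by which the differential expression H multiplies exp (z.x - |x|^2 / 2): the
  Laplacian contributes the sum of (z_v - x_v)^2 - 1 over the coordinates, and its |x|^2 cancels the
  potential.\<close>

definition hpoly :: "'a::euclidean_space \<Rightarrow> 'a \<Rightarrow> 'a \<Rightarrow> complex" where
  "hpoly p q x = of_nat DIM('a) + 2 * Complex (p \<bullet> x) (q \<bullet> x) - csq p q"

lemma norm_Complex_inner_le: "norm (Complex (p \<bullet> x) (q \<bullet> x)) \<le> (norm p + norm q) * (1 + norm x)"
proof -
  have "norm (Complex (p \<bullet> x) (q \<bullet> x)) \<le> \<bar>p \<bullet> x\<bar> + \<bar>q \<bullet> x\<bar>"
    using cmod_le[of "Complex (p \<bullet> x) (q \<bullet> x)"] by simp
  also have "\<dots> \<le> norm p * norm x + norm q * norm x" by (intro add_mono Cauchy_Schwarz_ineq2)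
  also have "\<dots> \<le> (norm p + norm q) * (1 + norm x)" by (simp add: algebra_simps)
  finally show ?thesis .
qed

text \<open>Both integrations by parts are done in one step. With g' = g L along v, the function g L
  \<phi> - g \<phi>' has derivative g (L^2 - 1) \<phi> - g \<phi>'', because the two terms g L
  \<phi>' cancel; the integral of that derivative is zero.\<close>

lemma gexp_self_adjoint_term:
  fixes \<phi> :: "'a::euclidean_space \<Rightarrow> complex"
  assumes \<phi>: "schwartz \<phi>" and v: "v \<in> Basis"
  shows "integrable lborel (\<lambda>x. gexp (1/2) p q x * (partial_deriv v (partial_deriv v \<phi>)) x)"
    and "integrable lborel (\<lambda>x. gexp (1/2) p q x * (((Complex ((p - x) \<bullet> v) (q \<bullet> v))\<^sup>2 - 1) * \<phi> x))"
    and "(\<integral>x. gexp (1/2) p q x * (partial_deriv v (partial_deriv v \<phi>)) x \<partial>lborel)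
       = (\<integral>x. gexp (1/2) p q x * (((Complex ((p - x) \<bullet> v) (q \<bullet> v))\<^sup>2 - 1) * \<phi> x) \<partial>lborel)"
proof -
  have sm: "smooth \<phi>" using \<phi> by (simp add: schwartz_def)
  define g where "g = gexp (1/2) p q"
  define L where "L = (\<lambda>x. Complex ((p - x) \<bullet> v) (q \<bullet> v))"
  define \<phi>1 where "\<phi>1 = partial_deriv v \<phi>"
  define \<phi>2 where "\<phi>2 = partial_deriv v \<phi>1"
  have c: "continuous_on UNIV \<phi>" "continuous_on UNIV \<phi>1" "continuous_on UNIV \<phi>2"
    using smooth_funpow(2)[OF sm v, of UNIV 0] smooth_funpow(2)[OF sm v, of UNIV 1] smooth_funpow(2)[OF sm v, of UNIV 2]
    by (simp_all add: \<phi>1_def \<phi>2_def numeral_2_eq_2)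
  have d\<phi>: "dderiv v \<phi> \<phi>1" "dderiv v \<phi>1 \<phi>2"
    using smooth_funpow(3)[OF sm v, of 0] smooth_funpow(3)[OF sm v, of 1] by (simp_all add: \<phi>1_def \<phi>2_def)
  obtain C0 C1 C2 where b: "\<And>x. norm (\<phi> x) \<le> C0" "\<And>x. norm (\<phi>1 x) \<le> C1" "\<And>x. norm (\<phi>2 x) \<le> C2"
    using schwartz_funpow_bounded[OF \<phi> v, of 0] schwartz_funpow_bounded[OF \<phi> v, of 1] schwartz_funpow_bounded[OF \<phi> v, of 2]
    by (auto simp add: \<phi>1_def \<phi>2_def numeral_2_eq_2)
  have dg: "dderiv v g (\<lambda>x. g x * L x)"
    using dderiv_gexp[of v "1/2" p q] by (simp add: g_def L_def inner_diff_left)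
  have dL: "dderiv v L (\<lambda>x. - 1)"
    unfolding dderiv_def
  proof
    fix x
    have "((\<lambda>t. of_real ((p - x) \<bullet> v - t) + \<i> * of_real (q \<bullet> v)) has_vector_derivative (-1::complex)) (at 0)"
      by (auto intro!: derivative_eq_intros)
    moreover have "L (x + t *\<^sub>R v) = of_real ((p - x) \<bullet> v - t) + \<i> * of_real (q \<bullet> v)" for t
      using v by (simp add: L_def Complex_eq inner_diff_left inner_add_left)
    ultimately show "((\<lambda>t. L (x + t *\<^sub>R v)) has_vector_derivative - 1) (at 0)" by simp
  qed
  have Lc: "continuous_on UNIV L" unfolding L_def Complex_eq by (intro continuous_intros)
  define K where "K = norm p + norm q + 1"
  have K: "K \<ge> 0" by (simp add: K_def)
  have Lb: "norm (L x) \<le> K * (1 + norm x)" for x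
  proof -
    have "norm (L x) \<le> \<bar>(p - x) \<bullet> v\<bar> + \<bar>q \<bullet> v\<bar>"
      using cmod_le[of "L x"] by (simp add: L_def)
    also have "\<dots> \<le> norm (p - x) + norm q" using v by (intro add_mono Basis_le_norm)
    also have "\<dots> \<le> norm p + norm x + norm q" using norm_triangle_ineq4[of p x] by simp
    also have "\<dots> \<le> K * (1 + norm x)" by (simp add: K_def algebra_simps)
    finally show ?thesis .
  qed
  have Lb2: "norm ((L x)\<^sup>2 - 1) \<le> (K\<^sup>2 + 1) * (1 + norm x)\<^sup>2" for x
  proof -
    have "norm ((L x)\<^sup>2 - 1) \<le> (norm (L x))\<^sup>2 + 1" using norm_triangle_ineq4[of "(L x)\<^sup>2" 1] by (simp add: norm_power)
    also have "\<dots> \<le> (K * (1 + norm x))\<^sup>2 + (1 + norm x)\<^sup>2" using Lb by (intro add_mono power_mono) (auto simp: power2_eq_square algebra_simps)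
    finally show ?thesis by (simp only: power_mult_distrib distrib_right mult_1)
  qed
  note i = integrable_gexp_poly[of "1/2", where p=p and q=q, folded g_def, OF half_gt_zero[OF zero_less_one]]
  have C0: "C0 \<ge> 0" "C1 \<ge> 0" "C2 \<ge> 0" using order_trans[OF norm_ge_zero b(1)] order_trans[OF norm_ge_zero b(2)] order_trans[OF norm_ge_zero b(3)] by auto
  have I0: "integrable lborel (\<lambda>x. g x * \<phi>2 x)"
    by (rule i[OF c(3), of C2 0]) (use b in auto)
  have I1: "integrable lborel (\<lambda>x. g x * \<phi>1 x)"
    by (rule i[OF c(2), of C1 0]) (use b in auto)
  have I2: "integrable lborel (\<lambda>x. g x * (((L x)\<^sup>2 - 1) * \<phi> x))"
  proof (rule i)
    show "continuous_on UNIV (\<lambda>x. ((L x)\<^sup>2 - 1) * \<phi> x)" by (intro continuous_intros c Lc)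
    show "norm (((L x)\<^sup>2 - 1) * \<phi> x) \<le> ((K\<^sup>2 + 1) * C0) * (1 + norm x) ^ 2" for x
      using mult_mono[OF Lb2[of x] b(1)[of x]] C0 K by (simp add: norm_mult mult_ac)
  qed
  have I3: "integrable lborel (\<lambda>x. g x * (L x * \<phi> x))"
  proof (rule i)
    show "continuous_on UNIV (\<lambda>x. L x * \<phi> x)" by (intro continuous_intros c Lc)
    show "norm (L x * \<phi> x) \<le> (K * C0) * (1 + norm x) ^ 1" for x
      using mult_mono[OF Lb[of x] b(1)[of x]] C0 K by (simp add: norm_mult algebra_simps)
  qed
  have d: "dderiv v (\<lambda>x. g x * L x * \<phi> x - g x * \<phi>1 x)
     (\<lambda>x. ((g x * L x) * \<phi>1 x + (g x * -1 + (g x * L x) * L x) * \<phi> x) - (g x * \<phi>2 x + (g x * L x) * \<phi>1 x))"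
    by (intro dderiv_diff dderiv_mult dg dL d\<phi>)
  have d': "dderiv v (\<lambda>x. g x * L x * \<phi> x - g x * \<phi>1 x) (\<lambda>x. g x * (((L x)\<^sup>2 - 1) * \<phi> x) - g x * \<phi>2 x)"
    by (rule back_subst[of "\<lambda>f. dderiv v _ f", OF d]) (auto simp: power2_eq_square algebra_simps intro!: ext)
  have gc: "continuous_on UNIV g" unfolding g_def by (intro continuous_intros)
  have "(\<integral>x. g x * (((L x)\<^sup>2 - 1) * \<phi> x) - g x * \<phi>2 x \<partial>lborel) = 0"
    using I0 I1 I2 I3
    by (intro integral_dderiv_eq_0[OF d'] continuous_intros gc Lc c) (auto simp: mult.assoc)
  hence "(\<integral>x. g x * \<phi>2 x \<partial>lborel) = (\<integral>x. g x * (((L x)\<^sup>2 - 1) * \<phi> x) \<partial>lborel)"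
    using I0 I2 by simp
  with I0 I2 show "integrable lborel (\<lambda>x. gexp (1/2) p q x * (partial_deriv v (partial_deriv v \<phi>)) x)"
    "integrable lborel (\<lambda>x. gexp (1/2) p q x * (((Complex ((p - x) \<bullet> v) (q \<bullet> v))\<^sup>2 - 1) * \<phi> x))"
    "(\<integral>x. gexp (1/2) p q x * (partial_deriv v (partial_deriv v \<phi>)) x \<partial>lborel)
       = (\<integral>x. gexp (1/2) p q x * (((Complex ((p - x) \<bullet> v) (q \<bullet> v))\<^sup>2 - 1) * \<phi> x) \<partial>lborel)"
    unfolding g_def L_def \<phi>2_def \<phi>1_def by auto
qed

lemma sum_Basis_square:
  "(\<Sum>v\<in>Basis. (Complex ((p - x) \<bullet> v) (q \<bullet> v))\<^sup>2 - 1) = of_real ((norm x)\<^sup>2) - hpoly p q (x::'a::euclidean_space)"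
proof -
  have "(\<Sum>v\<in>Basis. (Complex ((p - x) \<bullet> v) (q \<bullet> v))\<^sup>2) = Complex ((p - x) \<bullet> (p - x) - q \<bullet> q) (2 * ((p - x) \<bullet> q))"
    by (rule complex_eqI)
       (simp_all add: Re_sum Im_sum Re_power2 Im_power2 sum_subtractf euclidean_inner[of "p-x" "p-x"] euclidean_inner[of q q]
          euclidean_inner[of "p-x" q] power2_eq_square sum_distrib_left mult_ac)
  thus ?thesis
    by (simp add: sum_subtractf hpoly_def csq_def complex_eq_iff power2_norm_eq_inner inner_diff_left inner_diff_right inner_commute)
qed

lemma gexp_self_adjoint:
  fixes \<phi> :: "'a::euclidean_space \<Rightarrow> complex"
  assumes \<phi>: "schwartz \<phi>"
  shows "integrable lborel (\<lambda>x. gexp (1/2) p q x * harmonic_oscillator \<phi> x)"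
    and "(\<integral>x. gexp (1/2) p q x * harmonic_oscillator \<phi> x \<partial>lborel) = (\<integral>x. gexp (1/2) p q x * (hpoly p q x * \<phi> x) \<partial>lborel)"
proof -
  let ?g = "gexp (1/2) p q"
  have sm: "smooth \<phi>" using \<phi> by (simp add: schwartz_def)
  obtain v0 :: 'a where v0: "v0 \<in> Basis" using nonempty_Basis by blast
  have c: "continuous_on UNIV \<phi>" using smooth_funpow(2)[OF sm v0, of UNIV 0] by simp
  obtain C0 where b: "\<And>x. norm (\<phi> x) \<le> C0" using schwartz_funpow_bounded[OF \<phi> v0, of 0] by auto
  have I3: "integrable lborel (\<lambda>x. ?g x * (of_real ((norm x)\<^sup>2) * \<phi> x))"
  proof (rule integrable_gexp_poly)
    show "continuous_on UNIV (\<lambda>x. complex_of_real ((norm x)\<^sup>2) * \<phi> x)" by (intro continuous_intros c)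
    show "norm (complex_of_real ((norm x)\<^sup>2) * \<phi> x) \<le> C0 * (1 + norm x) ^ 2" for x
    proof -
      have "(norm x)\<^sup>2 * norm (\<phi> x) \<le> (1 + norm x)\<^sup>2 * C0"
        using b by (intro mult_mono power_mono) auto
      thus ?thesis by (simp add: norm_mult mult.commute del: of_real_power)
    qed
  qed simp
  have e1: "?g x * harmonic_oscillator \<phi> x = ?g x * (of_real ((norm x)\<^sup>2) * \<phi> x) - (\<Sum>v\<in>Basis. ?g x * partial_deriv v (partial_deriv v \<phi>) x)" for x
    by (simp add: harmonic_oscillator_def laplacian_def sum_distrib_left[symmetric] sum_distrib_right[symmetric] algebra_simps)
  have e2: "?g x * (hpoly p q x * \<phi> x) = ?g x * (of_real ((norm x)\<^sup>2) * \<phi> x) -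
      (\<Sum>v\<in>Basis. ?g x * (((Complex ((p - x) \<bullet> v) (q \<bullet> v))\<^sup>2 - 1) * \<phi> x))" for x
    unfolding sum_distrib_left[symmetric] sum_distrib_right[symmetric] sum_Basis_square
    by (simp add: algebra_simps)
  show "integrable lborel (\<lambda>x. ?g x * harmonic_oscillator \<phi> x)"
    unfolding e1 by (intro Bochner_Integration.integrable_diff I3 Bochner_Integration.integrable_sum gexp_self_adjoint_term \<phi>)
  show "(\<integral>x. ?g x * harmonic_oscillator \<phi> x \<partial>lborel) = (\<integral>x. ?g x * (hpoly p q x * \<phi> x) \<partial>lborel)"
    unfolding e1 e2
    by (simp add: I3 gexp_self_adjoint_term \<phi> Bochner_Integration.integral_diff Bochner_Integration.integral_sum Bochner_Integration.integrable_sum del: of_real_power)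
qed

section \<open>Mehler's formula\<close>

text \<open>Meant for a primitive that is continuous up to the endpoints while its derivative may
  blow up there, as happens at s = 1 in dimension one.\<close>

lemma integral_FTC_open:
  fixes F :: "real \<Rightarrow> 'b::euclidean_space"
  assumes "a \<le> b" "continuous_on {a..b} F"
    and "\<And>x. x \<in> {a<..<b} \<Longrightarrow> (F has_vector_derivative f x) (at x)"
    and i: "integrable lborel (\<lambda>x. indicator {a<..<b} x *\<^sub>R f x)"
  shows "(\<integral>x. indicator {a<..<b} x *\<^sub>R f x \<partial>lborel) = F b - F a"
proof -
  have "(f has_integral (F b - F a)) {a..b}"
    using assms(1-3) by (rule fundamental_theorem_of_calculus_interior)
  hence "(f has_integral (F b - F a)) {a<..<b}" by (simp add: has_integral_Icc_iff_Ioo)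
  hence "((\<lambda>x. if x \<in> {a<..<b} then f x else 0) has_integral (F b - F a)) UNIV"
    by (simp only: has_integral_restrict_UNIV)
  moreover have "(\<lambda>x. if x \<in> {a<..<b} then f x else 0) = (\<lambda>x. indicator {a<..<b} x *\<^sub>R f x)"
    by (auto simp: indicator_def)
  ultimately show ?thesis using has_integral_integral_lborel[OF i] has_integral_unique by metis
qed

text \<open>
  Weight of the representation of \<open>b\<close>; integrable but unbounded at \<open>1\<close> when \<open>d = 1\<close>.
\<close>

definition symbol_weight :: "nat \<Rightarrow> real \<Rightarrow> real" where
  "symbol_weight d s = indicator {0<..<1} s * (1 - s\<^sup>2) powr (real d / 2 - 1)"

definition symbol_measure :: "nat \<Rightarrow> real measure" where
  "symbol_measure d = density lborel (\<lambda>s. ennreal (symbol_weight d s))"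

section \<open>The weight as a finite measure on the unit interval\<close>

lemma symbol_weight_nonneg: "0 \<le> symbol_weight d s"
  by (simp add: symbol_weight_def)

lemma symbol_weight_measurable [measurable]: "symbol_weight d \<in> borel_measurable borel"
  unfolding symbol_weight_def by measurable

lemma sets_symbol_measure [measurable_cong, simp]: "sets (symbol_measure d) = sets borel"
  by (simp add: symbol_measure_def)

lemma space_symbol_measure [simp]: "space (symbol_measure d) = UNIV"
  by (simp add: symbol_measure_def)

lemma has_integral_powr_1_minus:
  assumes d: "d \<ge> 1"
  shows "((\<lambda>s. indicator {0<..<1} s * (1 - s) powr (real d / 2 - 1)) has_integral (2 / real d)) UNIV"
proof -
  let ?F = "\<lambda>s. - (2 / real d) * (1 - s) powr (real d / 2)"
  have "((\<lambda>s. (1 - s) powr (real d / 2 - 1)) has_integral (?F 1 - ?F 0)) {0..1}"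
  proof (rule fundamental_theorem_of_calculus_interior)
    show "continuous_on {0..1} ?F" using d by (intro continuous_intros continuous_on_powr') auto
    fix s :: real assume s: "s \<in> {0<..<1}"
    have "((\<lambda>s. (1 - s) powr (real d / 2)) has_real_derivative (real d / 2 * (1 - s) powr (real d / 2 - 1)) * (-1)) (at s)"
      using s by (intro DERIV_chain2[OF has_real_derivative_powr]) (auto intro!: derivative_eq_intros)
    from DERIV_cmult[OF this, of "- (2 / real d)"]
    have "(?F has_real_derivative (1 - s) powr (real d / 2 - 1)) (at s)"
      using d by simp
    thus "(?F has_vector_derivative (1 - s) powr (real d / 2 - 1)) (at s)"
      by (simp only: has_real_derivative_iff_has_vector_derivative)
  qed simp
  hence "((\<lambda>s. (1 - s) powr (real d / 2 - 1)) has_integral (2 / real d)) {0<..<1}"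
    using d by (simp add: has_integral_Icc_iff_Ioo)
  hence "((\<lambda>s. if s \<in> {0<..<1} then (1 - s) powr (real d / 2 - 1) else 0) has_integral (2 / real d)) UNIV"
    by (simp only: has_integral_restrict_UNIV)
  moreover have "(\<lambda>s. if s \<in> {0<..<1} then (1 - s) powr (real d / 2 - 1) else 0) = (\<lambda>s. indicator {0<..<1} s * (1 - s) powr (real d / 2 - 1))"
    by (auto simp: indicator_def)
  ultimately show ?thesis by simp
qed

lemma finite_symbol_measure:
  assumes d: "d \<ge> 1"
  shows "finite_measure (symbol_measure d)"
proof
  let ?f = "\<lambda>s. indicator {0<..<1} s * (1 - s) powr (real d / 2 - 1)"
  \<comment> \<open>Split 1 - s^2 = (1 + s)(1 - s). The first factor lies between 1 and 2, so its
    power is at most 2^(d/2); the second has an explicit primitive even when the exponent is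
    -1/2.\<close>
  have le: "symbol_weight d s \<le> 2 powr (real d / 2) * ?f s" for s
  proof (cases "s \<in> {0<..<1}")
    case True
    have "(1 - s\<^sup>2) powr (real d / 2 - 1) = (1 + s) powr (real d / 2 - 1) * (1 - s) powr (real d / 2 - 1)"
      using True by (subst powr_mult[symmetric]) (auto simp: power2_eq_square algebra_simps)
    also have "\<dots> \<le> 2 powr (real d / 2) * (1 - s) powr (real d / 2 - 1)"
      using True d by (intro mult_right_mono order_trans[OF powr_mono[of "real d/2 - 1" "real d/2" "1+s"] powr_mono2]) auto
    finally show ?thesis using True by (simp add: symbol_weight_def)
  qed (simp add: symbol_weight_def)
  have "emeasure (symbol_measure d) (space (symbol_measure d)) = (\<integral>\<^sup>+s. ennreal (symbol_weight d s) \<partial>lborel)"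
    by (simp add: symbol_measure_def emeasure_density)
  also have "\<dots> \<le> (\<integral>\<^sup>+s. ennreal (2 powr (real d / 2)) * ennreal (?f s) \<partial>lborel)"
    by (intro nn_integral_mono) (simp add: ennreal_mult'[symmetric] ennreal_leI le)
  also have "\<dots> = ennreal (2 powr (real d / 2)) * (\<integral>\<^sup>+s. ennreal (?f s) \<partial>lborel)"
    by (intro nn_integral_cmult) measurable
  also have "(\<integral>\<^sup>+s. ennreal (?f s) \<partial>lborel) = ennreal (2 / real d)"
    by (rule nn_integral_has_integral_lborel[OF _ _ has_integral_powr_1_minus[OF d]]) auto
  also have "ennreal (2 powr (real d / 2)) * ennreal (2 / real d) < \<infinity>"
    by (simp add: ennreal_mult_less_top)
  finally show "emeasure (symbol_measure d) (space (symbol_measure d)) \<noteq> \<infinity>" by simp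
qed

lemma AE_symbol_measure: "AE s in symbol_measure d. 0 < s \<and> s < 1"
  unfolding symbol_measure_def by (subst AE_density) (auto simp: symbol_weight_def indicator_def)

lemma integral_symbol_measure:
  fixes f :: "real \<Rightarrow> 'b::{banach, second_countable_topology}"
  assumes "f \<in> borel_measurable borel"
  shows "integral\<^sup>L (symbol_measure d) f = (\<integral>s. symbol_weight d s *\<^sub>R f s \<partial>lborel)"
    and "integrable (symbol_measure d) f \<longleftrightarrow> integrable lborel (\<lambda>s. symbol_weight d s *\<^sub>R f s)"
  unfolding symbol_measure_def using assms
  by (subst integral_density integrable_density; simp add: symbol_weight_nonneg)+

text \<open>A majorant in x uniform in s is enough, since the total mass in s is finite. This covers
  all exchanges of the s-integral with a Lebesgue integral.\<close>

lemma integrable_finite_pair: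
  fixes f :: "'s \<times> 'a::euclidean_space \<Rightarrow> 'b::{banach, second_countable_topology}"
  assumes M: "finite_measure M" and f [measurable]: "f \<in> borel_measurable (M \<Otimes>\<^sub>M lborel)"
    and le: "AE s in M. \<forall>x. norm (f (s, x)) \<le> g x" and g: "integrable lborel g"
  shows "integrable (M \<Otimes>\<^sub>M lborel) f"
proof -
  interpret M: finite_measure M by fact
  interpret MP: pair_sigma_finite M "lborel :: 'a measure" ..
  have *: "AE s in M. integrable lborel (\<lambda>x. f (s, x))"
    using le AE_space
  proof eventually_elim
    case (elim s)
    hence [measurable]: "(\<lambda>x. f (s, x)) \<in> borel_measurable lborel" by simp
    show ?case using elim by (intro Bochner_Integration.integrable_bound[OF g]) (auto intro: order_trans[OF _ abs_ge_self])
  qed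
  show ?thesis
  proof (rule MP.Fubini_integrable)
    show "integrable M (\<lambda>x. \<integral>y. norm (f (x, y)) \<partial>lborel)"
    proof (rule M.integrable_const_bound)
      show "AE x in M. norm (\<integral>y. norm (f (x, y)) \<partial>lborel) \<le> (\<integral>y. g y \<partial>lborel)"
        using le * by eventually_elim (auto intro!: integral_mono g)
    qed measurable
  qed (use * f in auto)
qed

text \<open>With z = p + i q this is exp (t z.x - t^2 z.z / 4 - |x|^2 / 2), the generating function
  of the Hermite functions. The coefficient of t^n belongs to the eigenvalue 2 n + d, so H acts as d
  + 2 t d/dt and the semigroup rescales t.\<close>

definition mehler :: "real \<Rightarrow> 'a::euclidean_space \<Rightarrow> 'a \<Rightarrow> 'a \<Rightarrow> complex" where
  "mehler t p q x = exp (- of_real (t\<^sup>2/4) * csq p q) * gexp (1/2) (t *\<^sub>R p) (t *\<^sub>R q) x"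

text \<open>
  With \<open>s = tanh t\<close> one has \<open>tau s = exp (- 2 * t)\<close>, the factor by which \<open>e\<^sup>-\<^sup>t\<^sup>H\<close> contracts the linear term
  of a Gaussian; \<open>symbol_weight d s / (1 + s) ^ d ds\<close> is \<open>exp (- t * d) dt\<close>.
\<close>

definition tau :: "real \<Rightarrow> real" where "tau s = (1 - s) / (1 + s)"

lemma tau_bounds: "0 < s \<Longrightarrow> s < 1 \<Longrightarrow> 0 < tau s \<and> tau s < 1"
  by (simp add: tau_def field_simps)

lemma borel_measurable_mehler [measurable]:
  assumes [measurable]: "f \<in> borel_measurable M" "g \<in> borel_measurable M"
  shows "(\<lambda>z. mehler (f z) p q (g z)) \<in> borel_measurable M"
  unfolding mehler_def by measurable

lemma tau_measurable [measurable]: "tau \<in> borel_measurable borel"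
  unfolding tau_def by measurable

lemma norm_mehler_le:
  assumes "0 \<le> t" "t \<le> 1"
  shows "norm (mehler t p q x) \<le> exp ((norm q)\<^sup>2/4) * gauss_bd (norm p) (1/2) x"
proof -
  have t2: "t\<^sup>2 \<le> 1" using assms by (simp add: power_le_one)
  have "- (t\<^sup>2/4 * (p \<bullet> p - q \<bullet> q)) \<le> t\<^sup>2/4 * (q \<bullet> q)" by (simp add: right_diff_distrib)
  also have "\<dots> \<le> 1/4 * (q \<bullet> q)" using t2 by (intro mult_right_mono) auto
  finally have "norm (exp (- of_real (t\<^sup>2/4) * csq p q)) \<le> exp ((norm q)\<^sup>2/4)"
    by (simp add: csq_def power2_norm_eq_inner)
  moreover have "norm (gexp (1/2) (t *\<^sub>R p) (t *\<^sub>R q) x) \<le> gauss_bd (norm p) (1/2) x"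
    using assms by (intro norm_gexp_le) (auto simp: mult_left_le_one_le)
  ultimately show ?thesis unfolding mehler_def norm_mult by (intro mult_mono) auto
qed

lemma csq_scaleR: "csq (t *\<^sub>R p) (t *\<^sub>R q) = of_real (t\<^sup>2) * csq p q"
  by (simp add: csq_def complex_eq_iff power2_eq_square algebra_simps)

lemma mehler_deriv:
  "((\<lambda>t. mehler t p q x) has_vector_derivative
     (Complex (p \<bullet> x) (q \<bullet> x) - of_real (t/2) * csq p q) * mehler t p q x) (at t)"
proof -
  let ?A = "Complex (p \<bullet> x) (q \<bullet> x)"
  have eq: "mehler t p q x = exp (of_real t * ?A - of_real (t\<^sup>2/4) * csq p q - of_real ((x \<bullet> x) / 2))" for t
    unfolding mehler_def gexp_def exp_add[symmetric]
    by (rule arg_cong[where f=exp]) (simp add: complex_eq_iff)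
  have "((\<lambda>t::real. t\<^sup>2/4) has_real_derivative t/2) (at t)"
    by (auto intro!: derivative_eq_intros)
  hence "((\<lambda>t. complex_of_real (t\<^sup>2/4)) has_vector_derivative of_real (t/2)) (at t)"
    by (intro has_vector_derivative_of_real) (simp add: has_real_derivative_iff_has_vector_derivative)
  from has_vector_derivative_mult_left[OF this, of "csq p q"]
  have d1: "((\<lambda>t. of_real (t\<^sup>2/4) * csq p q) has_vector_derivative of_real (t/2) * csq p q) (at t)" .
  have d2: "((\<lambda>t. of_real t * ?A) has_vector_derivative ?A) (at t)"
    by (auto intro!: derivative_eq_intros)
  have "((\<lambda>t. of_real t * ?A - of_real (t\<^sup>2/4) * csq p q - of_real ((x \<bullet> x) / 2)) has_vector_derivative
      (?A - of_real (t/2) * csq p q - 0)) (at t)"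
    by (intro has_vector_derivative_diff d1 d2 has_vector_derivative_const)
  hence "((\<lambda>t. of_real t * ?A - of_real (t\<^sup>2/4) * csq p q - of_real ((x \<bullet> x) / 2)) has_vector_derivative
      (?A - of_real (t/2) * csq p q)) (at t)" by simp
  from field_vector_diff_chain_at[OF this DERIV_exp]
  show ?thesis unfolding eq o_def .
qed

lemma symbol_weight_tau:
  assumes "0 < s" "s < 1"
  shows "symbol_weight d s / (1 + s) ^ d * (1 - s\<^sup>2) = tau s powr (real d / 2)"
proof -
  have pos: "1 - s\<^sup>2 > 0" using assms by (simp add: power_less_one_iff abs_square_less_1)
  have "symbol_weight d s * (1 - s\<^sup>2) = (1 - s\<^sup>2) powr (real d / 2 - 1) * (1 - s\<^sup>2) powr 1"
    using assms pos by (simp add: symbol_weight_def)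
  also have "\<dots> = (1 - s\<^sup>2) powr (real d / 2)" by (subst powr_add[symmetric]) simp
  also have "\<dots> = (tau s * (1 + s)\<^sup>2) powr (real d / 2)"
  proof -
    have "1 - s\<^sup>2 = tau s * (1 + s)\<^sup>2" using assms by (simp add: tau_def power2_eq_square field_simps)
    thus ?thesis by simp
  qed
  also have "\<dots> = tau s powr (real d / 2) * ((1 + s)\<^sup>2) powr (real d / 2)"
    using assms tau_bounds[of s] by (intro powr_mult)
  also have "((1 + s)\<^sup>2) powr (real d / 2) = (1 + s) ^ d"
    using assms by (subst powr_realpow[symmetric], simp, subst powr_powr) (simp add: powr_realpow)
  finally show ?thesis using assms by (simp add: field_simps)
qed

lemma tau_deriv: "0 < s \<Longrightarrow> (tau has_real_derivative (- 2 / (1 + s)\<^sup>2)) (at s)"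
  unfolding tau_def[abs_def] by (auto intro!: derivative_eq_intros simp: field_simps power2_eq_square)

text \<open>The integrand is a total derivative. Since H acts on \<open>mehler t\<close> as d + 2 t
  d/dt and \<open>tau\<close> has derivative - 2 tau / (1 - s^2), it is the s-derivative of -
  tau^(d/2) times \<open>mehler (tau s)\<close>. At s = 1 this vanishes because
  \<open>tau 1 = 0\<close>; at s = 0 it is minus \<open>mehler 1\<close>.\<close>

lemma mehler_integral:
  fixes p q x :: "'a::euclidean_space"
  shows "(\<integral>s. of_real (1 / (1 + s) ^ DIM('a)) * (hpoly (tau s *\<^sub>R p) (tau s *\<^sub>R q) x * mehler (tau s) p q x) \<partial>symbol_measure DIM('a))
     = mehler 1 p q x"
proof -
  let ?d = "DIM('a)"
  interpret finite_measure "symbol_measure ?d" by (rule finite_symbol_measure) simp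
  let ?A = "Complex (p \<bullet> x) (q \<bullet> x)"
  define \<kappa> where "\<kappa> = (\<lambda>s. symbol_weight ?d s / (1 + s) ^ ?d)"
  define f where "f = (\<lambda>s. of_real (1 / (1 + s) ^ ?d) * (hpoly (tau s *\<^sub>R p) (tau s *\<^sub>R q) x * mehler (tau s) p q x))"
  have hp: "hpoly (t *\<^sub>R p) (t *\<^sub>R q) x = of_nat ?d + of_real (2 * t) * ?A - of_real (t\<^sup>2) * csq p q" for t
    unfolding hpoly_def csq_scaleR by (simp add: complex_eq_iff)
  have [measurable]: "f \<in> borel_measurable borel"
    unfolding f_def hp by measurable
  have int_f: "integrable (symbol_measure ?d) f"
  proof (rule integrable_const_bound)
    show "AE s in symbol_measure ?d. norm (f s) \<le> 1 * ((real ?d + 2 * norm ?A + norm (csq p q)) * (exp ((norm q)\<^sup>2/4) * gauss_bd (norm p) (1/2) x))"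
      using AE_symbol_measure
    proof eventually_elim
      case (elim s)
      have t: "0 < tau s" "tau s < 1" using tau_bounds elim by auto
      have "norm (hpoly (tau s *\<^sub>R p) (tau s *\<^sub>R q) x) \<le> real ?d + norm (of_real (2 * tau s) * ?A) + norm (of_real ((tau s)\<^sup>2) * csq p q)"
        unfolding hp by (rule order_trans[OF norm_triangle_ineq4 add_right_mono[OF order_trans[OF norm_triangle_ineq]]]) simp
      also have "\<dots> \<le> real ?d + 2 * norm ?A + norm (csq p q)"
        using t mult_right_mono[of "tau s" 1 "norm ?A"] mult_right_mono[of "(tau s)\<^sup>2" 1 "norm (csq p q)"]
        by (intro add_mono) (auto simp: norm_mult norm_power power_le_one simp del: of_real_power)
      finally have h: "norm (hpoly (tau s *\<^sub>R p) (tau s *\<^sub>R q) x) \<le> real ?d + 2 * norm ?A + norm (csq p q)" .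
      have o: "norm (complex_of_real (1 / (1 + s) ^ ?d)) \<le> 1"
        using elim one_le_power[of "1 + s" ?d] unfolding norm_of_real by simp
      show ?case unfolding f_def norm_mult using t
        by (intro mult_mono o h norm_mehler_le) auto
    qed
  qed measurable
  define G where "G = (\<lambda>s. - (of_real (tau s powr (real ?d / 2)) * mehler (tau s) p q x))"
  have "(\<integral>s. f s \<partial>symbol_measure ?d) = (\<integral>s. symbol_weight ?d s *\<^sub>R f s \<partial>lborel)" by (rule integral_symbol_measure) measurable
  also have "\<dots> = (\<integral>s. indicator {0<..<1} s *\<^sub>R (symbol_weight ?d s *\<^sub>R f s) \<partial>lborel)"
    by (intro Bochner_Integration.integral_cong) (auto simp: symbol_weight_def indicator_def)
  also have "\<dots> = G 1 - G 0"
  proof (rule integral_FTC_open)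
    have "integrable lborel (\<lambda>s. symbol_weight ?d s *\<^sub>R f s)" using int_f by (subst integral_symbol_measure(2)[symmetric]) auto
    thus "integrable lborel (\<lambda>s. indicator {0<..<1} s *\<^sub>R (symbol_weight ?d s *\<^sub>R f s))"
      by (rule back_subst[of "integrable lborel"]) (auto simp: symbol_weight_def indicator_def)
    have ct: "continuous_on {0..1} tau" unfolding tau_def by (intro continuous_intros) auto
    have t0: "\<forall>s\<in>{0..1}. tau s \<ge> 0" by (auto simp: tau_def)
    show "continuous_on {0..1} G" unfolding G_def mehler_def
      using t0 by (intro continuous_intros continuous_on_powr' ct) auto
    fix s :: real assume "s \<in> {0<..<1}"
    hence s: "0 < s" "s < 1" by auto
    have pos: "1 - s\<^sup>2 > 0" using s by (simp add: power_less_one_iff abs_square_less_1)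
    define V where "V = tau s powr (real ?d / 2)"
    have dtau: "(tau has_vector_derivative (- 2 / (1 + s)\<^sup>2)) (at s)"
      using tau_deriv[OF s(1)] by (simp add: has_real_derivative_iff_has_vector_derivative)
    have "((\<lambda>s. tau s powr (real ?d / 2)) has_real_derivative (real ?d / 2 * tau s powr (real ?d / 2 - 1)) * (- 2 / (1 + s)\<^sup>2)) (at s)"
      using tau_bounds[OF s] by (intro DERIV_chain2[OF has_real_derivative_powr] tau_deriv s) auto
    moreover have "(real ?d / 2 * tau s powr (real ?d / 2 - 1)) * (- 2 / (1 + s)\<^sup>2) = - real ?d * V / (1 - s\<^sup>2)"
    proof -
      have "tau s powr (real ?d / 2 - 1) = V / tau s" using tau_bounds[OF s] by (simp add: V_def powr_diff)
      moreover have "1 - s\<^sup>2 = tau s * (1 + s)\<^sup>2" using s by (simp add: tau_def power2_eq_square field_simps)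
      ultimately show ?thesis by (simp add: divide_simps)
    qed
    ultimately have dV: "((\<lambda>s. complex_of_real (tau s powr (real ?d / 2))) has_vector_derivative of_real (- real ?d * V / (1 - s\<^sup>2))) (at s)"
      by (intro has_vector_derivative_of_real) (simp add: has_real_derivative_iff_has_vector_derivative)
    have dM: "((\<lambda>s. mehler (tau s) p q x) has_vector_derivative
        (- 2 / (1 + s)\<^sup>2) *\<^sub>R ((?A - of_real (tau s/2) * csq p q) * mehler (tau s) p q x)) (at s)"
      using vector_diff_chain_at[OF dtau mehler_deriv] by (simp add: o_def)
    have "symbol_weight ?d s * (1 / (1 + s) ^ ?d) = V / (1 - s\<^sup>2)"
      using symbol_weight_tau[OF s, of ?d] pos by (simp add: V_def eq_divide_eq)
    hence k: "symbol_weight ?d s *\<^sub>R (of_real (1 / (1 + s) ^ ?d) * z) = of_real (V / (1 - s\<^sup>2)) * z" for z :: complex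
      by (simp only: scaleR_conv_of_real mult.assoc[symmetric] of_real_mult[symmetric])
    \<comment> \<open>Rewriting the derivative of \<open>tau\<close> over 1 - s^2 gives both parts
      of the product rule the same denominator, in which they combine to
      \<open>hpoly\<close>.\<close>
    have e: "- 2 / (1 + s)\<^sup>2 = - 2 * tau s / (1 - s\<^sup>2)"
    proof -
      have "1 - s\<^sup>2 = tau s * (1 + s)\<^sup>2" using s by (simp add: tau_def power2_eq_square field_simps)
      thus ?thesis using tau_bounds[OF s] by simp
    qed
    have "- (of_real V * ((- 2 * tau s / (1 - s\<^sup>2)) *\<^sub>R ((?A - of_real (tau s/2) * csq p q) * M)) + of_real (- real ?d * V / (1 - s\<^sup>2)) * M)
        = of_real (V / (1 - s\<^sup>2)) * (hpoly (tau s *\<^sub>R p) (tau s *\<^sub>R q) x * M)" for M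
    proof -
      define r where "r = 1 / (1 - s\<^sup>2)"
      have r: "y / (1 - s\<^sup>2) = y * r" for y by (simp add: r_def)
      show ?thesis unfolding hp scaleR_conv_of_real r by (simp add: field_simps power2_eq_square[of "of_real (tau s)"])
    qed
    from this[of "mehler (tau s) p q x", folded e k]
    show "(G has_vector_derivative symbol_weight ?d s *\<^sub>R f s) (at s)"
      using has_vector_derivative_minus[OF has_vector_derivative_mult[OF dV dM]]
      unfolding G_def f_def V_def by simp
  qed simp
  also have "\<dots> = mehler 1 p q x" by (simp add: G_def tau_def)
  finally show ?thesis unfolding f_def .
qed

section \<open>The weak solution for a Gaussian right-hand side\<close>

lemma harmonic_oscillator_schwartz:
  fixes \<phi> :: "'a::euclidean_space \<Rightarrow> complex"
  assumes \<phi>: "schwartz \<phi>"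
  shows "continuous_on UNIV \<phi>" "continuous_on UNIV (harmonic_oscillator \<phi>)"
    and "\<exists>C\<ge>0. \<forall>x. norm (\<phi> x) \<le> C \<and> norm (harmonic_oscillator \<phi> x) \<le> C * (1 + norm x)\<^sup>2"
proof -
  have sm: "smooth \<phi>" using \<phi> by (simp add: schwartz_def)
  obtain v0 :: 'a where v0: "v0 \<in> Basis" using nonempty_Basis by blast
  show c: "continuous_on UNIV \<phi>" using smooth_funpow(2)[OF sm v0, of UNIV 0] by simp
  have c2: "continuous_on UNIV (partial_deriv v (partial_deriv v \<phi>))" if "v \<in> Basis" for v
    using smooth_funpow(2)[OF sm that, of UNIV 2] by (simp add: numeral_2_eq_2)
  show "continuous_on UNIV (harmonic_oscillator \<phi>)"
    unfolding harmonic_oscillator_def laplacian_def by (intro continuous_intros c c2)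
  obtain C0 where b: "\<And>x. norm (\<phi> x) \<le> C0" using schwartz_funpow_bounded[OF \<phi> v0, of 0] by auto
  have "\<forall>v\<in>Basis. \<exists>C. \<forall>x. norm (partial_deriv v (partial_deriv v \<phi>) x) \<le> C"
    using schwartz_funpow_bounded[OF \<phi>, of _ 2] by (auto simp: numeral_2_eq_2)
  then obtain B where B: "\<And>v x. v \<in> Basis \<Longrightarrow> norm (partial_deriv v (partial_deriv v \<phi>) x) \<le> B v" by metis
  define S where "S = (\<Sum>v\<in>(Basis::'a set). B v)"
  have C0: "C0 \<ge> 0" using order_trans[OF norm_ge_zero b] .
  have S0: "S \<ge> 0" unfolding S_def using order_trans[OF norm_ge_zero B] by (intro sum_nonneg) auto
  show "\<exists>C\<ge>0. \<forall>x. norm (\<phi> x) \<le> C \<and> norm (harmonic_oscillator \<phi> x) \<le> C * (1 + norm x)\<^sup>2"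
  proof (intro exI[of _ "S + C0"] conjI allI)
    fix x
    show "norm (\<phi> x) \<le> S + C0" using b[of x] S0 by simp
    have l: "norm (laplacian \<phi> x) \<le> S" unfolding laplacian_def S_def by (intro sum_norm_le B)
    have "norm (harmonic_oscillator \<phi> x) \<le> norm (laplacian \<phi> x) + (norm x)\<^sup>2 * norm (\<phi> x)"
      using norm_triangle_ineq[of "- laplacian \<phi> x" "of_real ((norm x)\<^sup>2) * \<phi> x"]
      by (simp add: harmonic_oscillator_def norm_mult norm_power)
    also have "\<dots> \<le> S * (1 + norm x)\<^sup>2 + (1 + norm x)\<^sup>2 * C0"
    proof (intro add_mono mult_mono power_mono b)
      have "S * 1 \<le> S * (1 + norm x)\<^sup>2" using S0 by (intro mult_left_mono) (auto simp: one_le_power)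
      thus "norm (laplacian \<phi> x) \<le> S * (1 + norm x)\<^sup>2" using l by simp
    qed auto
    finally show "norm (harmonic_oscillator \<phi> x) \<le> (S + C0) * (1 + norm x)\<^sup>2" by (simp add: algebra_simps)
  qed (use S0 C0 in simp)
qed

text \<open>
  \<open>H\<^sup>-\<^sup>1\<close> applied to \<open>mehler 1 p q\<close>.
\<close>

definition mehler_solution :: "'a::euclidean_space \<Rightarrow> 'a \<Rightarrow> 'a \<Rightarrow> complex" where
  "mehler_solution p q x = (\<integral>s. of_real (1 / (1 + s) ^ DIM('a)) * mehler (tau s) p q x \<partial>symbol_measure DIM('a))"

lemma mehler_solution_integrand_le:
  assumes "0 < s" "s < 1"
  shows "norm (complex_of_real (1 / (1 + s) ^ d) * mehler (tau s) p q x)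
    \<le> exp ((norm q)\<^sup>2/4) * gauss_bd (norm p) (1/2) x"
proof -
  have "norm (complex_of_real (1 / (1 + s) ^ d)) \<le> 1"
    using assms one_le_power[of "1 + s" d] unfolding norm_of_real by simp
  moreover have "norm (mehler (tau s) p q x) \<le> exp ((norm q)\<^sup>2/4) * gauss_bd (norm p) (1/2) x"
    using tau_bounds[OF assms] by (intro norm_mehler_le) auto
  ultimately have "norm (complex_of_real (1 / (1 + s) ^ d)) * norm (mehler (tau s) p q x)
    \<le> 1 * (exp ((norm q)\<^sup>2/4) * gauss_bd (norm p) (1/2) x)"
    by (intro mult_mono) auto
  thus ?thesis by (simp only: norm_mult mult_1)
qed

lemma mehler_solution_measurable [measurable]: "mehler_solution p q \<in> borel_measurable borel"
proof -
  interpret finite_measure "symbol_measure DIM('a)" by (rule finite_symbol_measure) simp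
  show ?thesis unfolding mehler_solution_def by measurable
qed

lemma mehler_solution_le:
  fixes p q :: "'a::euclidean_space"
  shows "\<exists>C\<ge>0. \<forall>x. norm (mehler_solution p q x) \<le> C * gauss_bd (norm p) (1/2) x"
proof -
  interpret finite_measure "symbol_measure DIM('a)" by (rule finite_symbol_measure) simp
  let ?C = "measure (symbol_measure DIM('a)) UNIV * exp ((norm q)\<^sup>2/4)"
  show ?thesis
  proof (intro exI[of _ ?C] conjI allI)
    fix x :: 'a
    let ?B = "exp ((norm q)\<^sup>2/4) * gauss_bd (norm p) (1/2) x"
    have ae: "AE s in symbol_measure DIM('a). norm (of_real (1 / (1 + s) ^ DIM('a)) * mehler (tau s) p q x) \<le> ?B"
      using AE_symbol_measure by eventually_elim (intro mehler_solution_integrand_le, auto)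
    have "norm (mehler_solution p q x) \<le> (\<integral>s. norm (of_real (1 / (1 + s) ^ DIM('a)) * mehler (tau s) p q x) \<partial>symbol_measure DIM('a))"
      unfolding mehler_solution_def by (rule integral_norm_bound)
    also have "\<dots> \<le> (\<integral>s. ?B \<partial>symbol_measure DIM('a))"
      by (intro integral_mono_AE integrable_norm integrable_const_bound[OF ae] ae integrable_const) measurable
    finally show "norm (mehler_solution p q x) \<le> ?C * gauss_bd (norm p) (1/2) x" by simp
  qed simp
qed

lemma L2I:
  fixes f :: "'a::euclidean_space \<Rightarrow> complex"
  assumes [measurable]: "f \<in> borel_measurable borel" and "\<And>x. norm (f x) \<le> C * gauss_bd c (1/2) x"
  shows "L2 f"
  unfolding L2_def
proof
  show "integrable lborel (\<lambda>x. (norm (f x))\<^sup>2)"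
  proof (rule Bochner_Integration.integrable_bound)
    show "integrable lborel (\<lambda>x::'a. C\<^sup>2 * ((1 + norm x) ^ 0 * gauss_bd (2 * c) 1 x))"
      by (intro integrable_mult_right integrable_exp_norm) simp
    have "(norm (f x))\<^sup>2 \<le> C\<^sup>2 * ((1 + norm x) ^ 0 * gauss_bd (2 * c) 1 x)" for x
    proof -
      have "(norm (f x))\<^sup>2 \<le> (C * gauss_bd c (1/2) x)\<^sup>2"
        using assms(2) by (intro power_mono) auto
      also have "\<dots> = C\<^sup>2 * (gauss_bd c (1/2) x)\<^sup>2" by (rule power_mult_distrib)
      also have "(gauss_bd c (1/2) x)\<^sup>2 = gauss_bd (2 * c) 1 x"
        by (simp add: exp_double[symmetric] algebra_simps)
      finally show ?thesis by simp
    qed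
    thus "AE x in lborel. norm ((norm (f x))\<^sup>2) \<le> norm (C\<^sup>2 * ((1 + norm x) ^ 0 * gauss_bd (2 * c) 1 x))"
      by simp
  qed measurable
qed simp

text \<open>For each fixed s, H is moved from the test function onto the Gaussian, where it becomes
  multiplication by \<open>hpoly\<close>. Fubini before and after this step recombines the
  s-integral into the one evaluated by \<open>mehler_integral\<close>.\<close>

lemma mehler_solution_solves:
  fixes p q :: "'a::euclidean_space"
  shows "harmonic_oscillator_L2 (mehler_solution p q) (mehler 1 p q)"
  unfolding harmonic_oscillator_L2_def
proof (intro conjI allI impI)
  obtain C where "\<forall>x. norm (mehler_solution p q x) \<le> C * gauss_bd (norm p) (1/2) x" using mehler_solution_le by blast
  thus "L2 (mehler_solution p q)" by (intro L2I[where c="norm p" and C=C]) (auto simp: mehler_solution_measurable)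
  show "L2 (mehler 1 p q)"
  proof (rule L2I)
    show "norm (mehler 1 p q x) \<le> exp ((norm q)\<^sup>2/4) * gauss_bd (norm p) (1/2) x" for x
      by (rule norm_mehler_le) auto
  qed measurable
  fix \<phi> :: "'a \<Rightarrow> complex" assume \<phi>: "schwartz \<phi>"
  let ?d = "DIM('a)" and ?H = "harmonic_oscillator \<phi>"
  interpret finite_measure "symbol_measure ?d" by (rule finite_symbol_measure) simp
  interpret P: pair_sigma_finite "symbol_measure ?d" "lborel :: 'a measure" ..
  note h = harmonic_oscillator_schwartz[OF \<phi>]
  have [measurable]: "\<phi> \<in> borel_measurable borel" "?H \<in> borel_measurable borel"
    using h(1,2) by (auto intro: borel_measurable_continuous_onI)
  obtain C where C: "C \<ge> 0" "\<And>x. norm (\<phi> x) \<le> C" "\<And>x. norm (?H x) \<le> C * (1 + norm x)\<^sup>2" using h(3) by blast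
  define c where "c = (\<lambda>s. complex_of_real (1 / (1 + s) ^ ?d))"
  define e where "e = (\<lambda>s. exp (- complex_of_real ((tau s)\<^sup>2/4) * csq p q))"
  have [measurable]: "c \<in> borel_measurable borel" unfolding c_def by measurable
  let ?E = "exp ((norm q)\<^sup>2/4)"
  have I1: "integrable (symbol_measure ?d \<Otimes>\<^sub>M lborel) (\<lambda>(s, x). c s * mehler (tau s) p q x * ?H x)"
  proof (rule integrable_finite_pair[OF finite_symbol_measure])
    show "AE s in symbol_measure ?d. \<forall>x. norm (case (s, x) of (s, x) \<Rightarrow> c s * mehler (tau s) p q x * ?H x)
        \<le> ?E * (C * ((1 + norm x) ^ 2 * gauss_bd (norm p) (1/2) x))"
      using AE_symbol_measure
    proof (eventually_elim, intro allI)
      fix s :: real and x :: 'a assume s: "0 < s \<and> s < 1"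
      have "norm (c s * mehler (tau s) p q x * ?H x) \<le> (?E * gauss_bd (norm p) (1/2) x) * (C * (1 + norm x)\<^sup>2)"
        unfolding norm_mult[of _ "?H x"] c_def using s
        by (intro mult_mono mehler_solution_integrand_le C) (auto simp: C)
      thus "norm (case (s, x) of (s, x) \<Rightarrow> c s * mehler (tau s) p q x * ?H x) \<le> ?E * (C * ((1 + norm x) ^ 2 * gauss_bd (norm p) (1/2) x))"
        by (simp add: mult_ac)
    qed
    show "integrable lborel (\<lambda>x::'a. ?E * (C * ((1 + norm x) ^ 2 * gauss_bd (norm p) (1/2) x)))"
      by (intro integrable_mult_right integrable_exp_norm) simp
  qed (simp, measurable)
  define K where "K = real ?d + 2 * (norm p + norm q) + norm (csq p q)"
  have K: "K \<ge> 0" by (simp add: K_def)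
  have hb: "norm (hpoly (tau s *\<^sub>R p) (tau s *\<^sub>R q) x) \<le> K * (1 + norm x)" if s: "0 < s" "s < 1" for s and x :: 'a
  proof -
    have t: "0 < tau s" "tau s < 1" using tau_bounds[OF s] by auto
    have "norm (hpoly (tau s *\<^sub>R p) (tau s *\<^sub>R q) x) \<le> real ?d + norm (2 * Complex ((tau s *\<^sub>R p) \<bullet> x) ((tau s *\<^sub>R q) \<bullet> x))
        + norm (of_real ((tau s)\<^sup>2) * csq p q)"
      unfolding hpoly_def csq_scaleR
      by (rule order_trans[OF norm_triangle_ineq4 add_right_mono[OF order_trans[OF norm_triangle_ineq]]]) simp
    also have "\<dots> \<le> real ?d * (1 + norm x) + (2 * (norm p + norm q)) * (1 + norm x) + norm (csq p q) * (1 + norm x)"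
    proof (intro add_mono)
      have "norm (2 * Complex ((tau s *\<^sub>R p) \<bullet> x) ((tau s *\<^sub>R q) \<bullet> x)) \<le> 2 * ((norm (tau s *\<^sub>R p) + norm (tau s *\<^sub>R q)) * (1 + norm x))"
        unfolding norm_mult norm_numeral by (intro mult_left_mono norm_Complex_inner_le) simp
      also have "\<dots> \<le> 2 * ((norm p + norm q) * (1 + norm x))"
        using t by (intro mult_left_mono mult_right_mono add_mono) (auto simp: mult_left_le_one_le)
      finally show "norm (2 * Complex ((tau s *\<^sub>R p) \<bullet> x) ((tau s *\<^sub>R q) \<bullet> x)) \<le> (2 * (norm p + norm q)) * (1 + norm x)" by (simp only: mult.assoc)
      have "norm (of_real ((tau s)\<^sup>2) * csq p q) \<le> 1 * norm (csq p q)"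
        using t unfolding norm_mult norm_of_real by (intro mult_right_mono) (auto simp: power_le_one)
      also have "\<dots> \<le> norm (csq p q) * (1 + norm x)" by (simp add: algebra_simps)
      finally show "norm (of_real ((tau s)\<^sup>2) * csq p q) \<le> norm (csq p q) * (1 + norm x)" .
    qed (simp add: algebra_simps)
    finally show ?thesis by (simp add: K_def algebra_simps)
  qed
  have [measurable]: "(\<lambda>z. hpoly (tau (fst z) *\<^sub>R p) (tau (fst z) *\<^sub>R q) (snd z)) \<in> borel_measurable (symbol_measure ?d \<Otimes>\<^sub>M lborel)"
    unfolding hpoly_def csq_scaleR Complex_eq by measurable
  have I2: "integrable (symbol_measure ?d \<Otimes>\<^sub>M lborel) (\<lambda>(s, x). c s * mehler (tau s) p q x * (hpoly (tau s *\<^sub>R p) (tau s *\<^sub>R q) x * \<phi> x))"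
  proof (rule integrable_finite_pair[OF finite_symbol_measure])
    show "AE s in symbol_measure ?d. \<forall>x. norm (case (s, x) of (s, x) \<Rightarrow> c s * mehler (tau s) p q x * (hpoly (tau s *\<^sub>R p) (tau s *\<^sub>R q) x * \<phi> x))
        \<le> ?E * (K * (C * ((1 + norm x) ^ 1 * gauss_bd (norm p) (1/2) x)))"
      using AE_symbol_measure
    proof (eventually_elim, intro allI)
      fix s :: real and x :: 'a assume s: "0 < s \<and> s < 1"
      have "norm (c s * mehler (tau s) p q x * (hpoly (tau s *\<^sub>R p) (tau s *\<^sub>R q) x * \<phi> x))
        \<le> (?E * gauss_bd (norm p) (1/2) x) * ((K * (1 + norm x)) * C)"
        unfolding norm_mult[of "c s * mehler (tau s) p q x"] norm_mult[of _ "\<phi> x"] unfolding c_def using s K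
        by (intro mult_mono mehler_solution_integrand_le C hb) (auto simp: C)
      thus "norm (case (s, x) of (s, x) \<Rightarrow> c s * mehler (tau s) p q x * (hpoly (tau s *\<^sub>R p) (tau s *\<^sub>R q) x * \<phi> x))
        \<le> ?E * (K * (C * ((1 + norm x) ^ 1 * gauss_bd (norm p) (1/2) x)))"
        by (simp add: mult_ac)
    qed
    show "integrable lborel (\<lambda>x::'a. ?E * (K * (C * ((1 + norm x) ^ 1 * gauss_bd (norm p) (1/2) x))))"
      by (intro integrable_mult_right integrable_exp_norm) simp
  qed (simp, measurable)
  have "(\<integral>x. mehler_solution p q x * ?H x \<partial>lborel) = (\<integral>x. (\<integral>s. c s * mehler (tau s) p q x * ?H x \<partial>symbol_measure ?d) \<partial>lborel)"
    unfolding mehler_solution_def c_def by (simp only: integral_mult_left_zero)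
  also have "\<dots> = (\<integral>s. (\<integral>x. c s * mehler (tau s) p q x * ?H x \<partial>lborel) \<partial>symbol_measure ?d)"
    by (rule P.Fubini_integral[OF I1])
  also have "\<dots> = (\<integral>s. (\<integral>x. c s * mehler (tau s) p q x * (hpoly (tau s *\<^sub>R p) (tau s *\<^sub>R q) x * \<phi> x) \<partial>lborel) \<partial>symbol_measure ?d)"
  proof (rule Bochner_Integration.integral_cong[OF refl])
    fix s :: real
    have "(\<integral>x. c s * mehler (tau s) p q x * ?H x \<partial>lborel) = c s * e s * (\<integral>x. gexp (1/2) (tau s *\<^sub>R p) (tau s *\<^sub>R q) x * ?H x \<partial>lborel)"
      unfolding mehler_def e_def by (subst integral_mult_right_zero[symmetric]) (simp only: mult.assoc)
    also have "\<dots> = (\<integral>x. c s * mehler (tau s) p q x * (hpoly (tau s *\<^sub>R p) (tau s *\<^sub>R q) x * \<phi> x) \<partial>lborel)"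
      unfolding gexp_self_adjoint(2)[OF \<phi>] mehler_def e_def by (subst integral_mult_right_zero[symmetric]) (simp only: mult.assoc)
    finally show "(\<integral>x. c s * mehler (tau s) p q x * ?H x \<partial>lborel) = \<dots>" .
  qed
  also have "\<dots> = (\<integral>x. (\<integral>s. c s * mehler (tau s) p q x * (hpoly (tau s *\<^sub>R p) (tau s *\<^sub>R q) x * \<phi> x) \<partial>symbol_measure ?d) \<partial>lborel)"
    by (rule P.Fubini_integral[OF I2, symmetric])
  also have "\<dots> = (\<integral>x. mehler 1 p q x * \<phi> x \<partial>lborel)"
  proof (rule Bochner_Integration.integral_cong[OF refl])
    fix x :: 'a
    have "(\<integral>s. c s * mehler (tau s) p q x * (hpoly (tau s *\<^sub>R p) (tau s *\<^sub>R q) x * \<phi> x) \<partial>symbol_measure ?d)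
      = (\<integral>s. of_real (1 / (1 + s) ^ ?d) * (hpoly (tau s *\<^sub>R p) (tau s *\<^sub>R q) x * mehler (tau s) p q x) * \<phi> x \<partial>symbol_measure ?d)"
      unfolding c_def by (simp only: mult_ac)
    also have "\<dots> = mehler 1 p q x * \<phi> x" by (subst integral_mult_left_zero) (simp only: mehler_integral)
    finally show "(\<integral>s. c s * mehler (tau s) p q x * (hpoly (tau s *\<^sub>R p) (tau s *\<^sub>R q) x * \<phi> x) \<partial>symbol_measure ?d) = \<dots>" .
  qed
  finally show "(\<integral>x. mehler_solution p q x * ?H x \<partial>lborel) = (\<integral>x. mehler 1 p q x * \<phi> x \<partial>lborel)" .
qed

lemma schwartz_mehler: "schwartz (mehler t p q)"
  unfolding mehler_def[abs_def] by (rule schwartz_gexp) simp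

text \<open>The symbol is constrained by every u related to f through the graph, so exhibiting one
  explicit u gives information. The exceptional null set may depend on p and q.\<close>

lemma weyl_symbol_mehler_solution:
  assumes "is_weyl_symbol (harmonic_oscillator_L2\<inverse>\<inverse>) b"
  shows "AE x in lborel. has_weyl_value b (mehler 1 p q) x (mehler_solution p q x)"
  using assms schwartz_mehler mehler_solution_solves unfolding is_weyl_symbol_def by (metis conversep_iff)

section \<open>Bounds for the regularized oscillatory integrals\<close>

text \<open>
  The inner integrands together with all their derivatives in the direction \<open>v\<close>. The width \<open>\<sigma> = 1/2 + \<epsilon>\<^sup>2\<close>
  absorbs the cut-off in \<open>y\<close>, so estimates uniform in \<open>\<sigma>\<close> are uniform in \<open>\<epsilon>\<close>.
\<close>

inductive amp_comb :: "('a::euclidean_space \<times> 'a \<Rightarrow> complex) \<Rightarrow> 'a \<Rightarrow> 'a \<Rightarrow> 'a \<Rightarrow>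
    (real \<Rightarrow> 'a \<Rightarrow> 'a \<Rightarrow> 'a \<Rightarrow> complex) \<Rightarrow> bool" for b p q v where
  base: "amp_comb b p q v (\<lambda>\<sigma> x \<xi> y. c * of_real \<sigma> ^ j * of_real (y \<bullet> v) ^ l *
     (partial_deriv (v, 0) ^^ k) b ((1/2) *\<^sub>R (x + y), \<xi>) * gexp \<sigma> p q y)"
| add: "amp_comb b p q v A \<Longrightarrow> amp_comb b p q v B \<Longrightarrow> amp_comb b p q v (\<lambda>\<sigma> x \<xi> y. A \<sigma> x \<xi> y + B \<sigma> x \<xi> y)"

text \<open>The order m precedes k: differentiating does not raise the growth. Repeated integration
  by parts can therefore outrun the growth of b in \<xi>.\<close>

lemma amplitude_bound:
  assumes "amplitude b"
  shows "\<exists>m. \<forall>v\<in>Basis. \<forall>k. \<exists>C\<ge>0. \<forall>X. norm ((partial_deriv v ^^ k) b X) \<le> C * (1 + norm X) ^ m"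
proof -
  obtain m where m: "\<And>\<alpha>. \<exists>C. \<forall>X. norm (multi_deriv \<alpha> b X) \<le> C * (1 + norm X) ^ m"
    using assms unfolding amplitude_def by blast
  have "\<exists>C\<ge>0. \<forall>X. norm ((partial_deriv v ^^ k) b X) \<le> C * (1 + norm X) ^ m" if v: "v \<in> Basis" for v k
  proof -
    obtain C where C: "\<And>X. norm (multi_deriv (\<lambda>u. if u = v then k else 0) b X) \<le> C * (1 + norm X) ^ m"
      using m by blast
    show ?thesis using C[unfolded multi_deriv_single[OF v]] order_trans[OF norm_ge_zero C[of 0]]
      by (intro exI[of _ C]) auto
  qed
  thus ?thesis by blast
qed

abbreviation phase :: "'a::euclidean_space \<Rightarrow> 'a \<Rightarrow> complex" where
  "phase \<xi> y \<equiv> exp (- \<i> * of_real (y \<bullet> \<xi>))"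

text \<open>Separates the growth of b at the midpoint into independent factors: that of y is
  absorbed by the Gaussian, that of \<xi> by integration by parts, and that of x stays in the
  bound.\<close>

lemma one_plus_norm_pair_le:
  "1 + norm ((1/2) *\<^sub>R (x + y), \<xi>) \<le> (1 + norm x) * (1 + norm \<xi>) * (1 + norm (y::'a::euclidean_space))"
proof -
  have "norm ((1/2) *\<^sub>R (x + y), \<xi>) \<le> norm ((1/2) *\<^sub>R (x + y)) + norm \<xi>" by (rule norm_Pair_le)
  also have "norm ((1/2) *\<^sub>R (x + y)) \<le> norm x + norm y"
    using norm_triangle_ineq[of x y] norm_ge_zero[of x] norm_ge_zero[of y] unfolding norm_scaleR by linarith
  finally have "1 + norm ((1/2) *\<^sub>R (x + y), \<xi>) \<le> 1 + (norm x + norm y + norm \<xi>)" by simp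
  also have "\<dots> \<le> (1 + norm x) * (1 + norm \<xi>) * (1 + norm y)" by (simp add: algebra_simps)
  finally show ?thesis .
qed

context
  fixes b :: "'a::euclidean_space \<times> 'a \<Rightarrow> complex" and v :: 'a and m :: nat
  assumes sm: "smooth b" and v: "v \<in> Basis"
    and growth: "\<And>k. \<exists>C\<ge>0. \<forall>X. norm ((partial_deriv (v, 0) ^^ k) b X) \<le> C * (1 + norm X) ^ m"
begin

lemma basis_fst: "(v, 0) \<in> (Basis :: ('a \<times> 'a) set)"
  using v by (simp add: Basis_prod_def)

lemma amp_comb_continuous: "amp_comb b p q v A \<Longrightarrow> continuous_on UNIV (A \<sigma> x \<xi>)"
proof (induction rule: amp_comb.induct)
  case (base c j l k)
  show ?case
    by (intro continuous_intros continuous_on_compose2[OF smooth_funpow(2)[OF sm basis_fst, of UNIV]]) auto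
qed (auto intro: continuous_intros)

lemma dderiv_half:
  "dderiv v (\<lambda>y. (partial_deriv (v, 0) ^^ k) b ((1/2) *\<^sub>R (x + y), \<xi>))
     (\<lambda>y. (1/2) *\<^sub>R (partial_deriv (v, 0) ^^ Suc k) b ((1/2) *\<^sub>R (x + y), \<xi>))"
  unfolding dderiv_def
proof
  fix y
  let ?D = "(partial_deriv (v, 0) ^^ k) b" and ?D' = "(partial_deriv (v, 0) ^^ Suc k) b"
  let ?X = "((1/2) *\<^sub>R (x + y), \<xi>)"
  have 1: "((\<lambda>t. ?D (?X + t *\<^sub>R (v, 0))) has_vector_derivative ?D' ?X) (at ((1/2) * 0))"
    using smooth_funpow(3)[OF sm basis_fst, of k] by (simp add: dderiv_def)
  have 2: "((\<lambda>t. (1/2) * t) has_vector_derivative (1/2)) (at (0::real))"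
    by (auto intro!: derivative_eq_intros)
  have "((1/2) *\<^sub>R (x + (y + t *\<^sub>R v)), \<xi>) = ?X + ((1/2) * t) *\<^sub>R (v, 0)" for t
    by (simp add: algebra_simps)
  thus "((\<lambda>t. ?D ((1/2) *\<^sub>R (x + (y + t *\<^sub>R v)), \<xi>)) has_vector_derivative (1/2) *\<^sub>R ?D' ?X) (at 0)"
    using vector_diff_chain_at[OF 2 1] by (simp only: o_def)
qed

lemma amp_comb_dderiv:
  "amp_comb b p q v A \<Longrightarrow> \<exists>A'. amp_comb b p q v A' \<and> (\<forall>\<sigma> x \<xi>. dderiv v (A \<sigma> x \<xi>) (A' \<sigma> x \<xi>))"
proof (induction rule: amp_comb.induct)
  case (base c j l k)
  let ?D = "\<lambda>k x \<xi> y. (partial_deriv (v, 0) ^^ k) b ((1/2) *\<^sub>R (x + y), \<xi>)"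
  let ?t = "\<lambda>c j l k \<sigma> x \<xi> y. c * of_real \<sigma> ^ j * of_real (y \<bullet> v) ^ l * ?D k x \<xi> y * gexp \<sigma> p q y"
  have dl: "dderiv v (\<lambda>y. complex_of_real (y \<bullet> v) ^ l) (\<lambda>y. of_nat l * of_real (y \<bullet> v) ^ (l - 1))"
    unfolding dderiv_def
  proof
    fix y
    have "((\<lambda>t. ((y \<bullet> v) + t) ^ l) has_real_derivative (real l * (y \<bullet> v) ^ (l - 1))) (at 0)"
      by (auto intro!: derivative_eq_intros)
    hence "((\<lambda>t. complex_of_real (((y \<bullet> v) + t) ^ l)) has_vector_derivative of_real (real l * (y \<bullet> v) ^ (l - 1))) (at 0)"
      by (intro has_vector_derivative_of_real) (simp add: has_real_derivative_iff_has_vector_derivative)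
    thus "((\<lambda>t. complex_of_real ((y + t *\<^sub>R v) \<bullet> v) ^ l) has_vector_derivative of_nat l * of_real (y \<bullet> v) ^ (l - 1)) (at 0)"
      using v by (simp add: inner_add_left)
  qed
  have d: "dderiv v (?t c j l k \<sigma> x \<xi>)
     (\<lambda>y. (c * of_real \<sigma> ^ j * of_real (y \<bullet> v) ^ l * ?D k x \<xi> y) * (gexp \<sigma> p q y * Complex (p \<bullet> v - 2 * \<sigma> * (y \<bullet> v)) (q \<bullet> v))
       + ((c * of_real \<sigma> ^ j * of_real (y \<bullet> v) ^ l) * ((1/2) *\<^sub>R ?D (Suc k) x \<xi> y)
          + (c * of_real \<sigma> ^ j * (of_nat l * of_real (y \<bullet> v) ^ (l - 1)) + 0 * of_real (y \<bullet> v) ^ l) * ?D k x \<xi> y) * gexp \<sigma> p q y)" for \<sigma> x \<xi>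
    by (intro dderiv_mult dderiv_gexp dderiv_half dl dderiv_const)
  \<comment> \<open>Four contributions: the linear term of the Gaussian, its quadratic term (one
    more \<sigma> and one more power of y), the derivative of b with the factor 1/2 of the midpoint,
    and the power of y. For l = 0 the coefficient of the last one vanishes, so the truncated l - 1
    is harmless.\<close>
  define A' where "A' = (\<lambda>\<sigma> x \<xi> y. ((?t (c * Complex (p \<bullet> v) (q \<bullet> v)) j l k \<sigma> x \<xi> y + ?t (- 2 * c) (Suc j) (Suc l) k \<sigma> x \<xi> y)
      + ?t (c * (1/2)) j l (Suc k) \<sigma> x \<xi> y) + ?t (c * of_nat l) j (l - 1) k \<sigma> x \<xi> y)"
  have "amp_comb b p q v A'" unfolding A'_def by (intro amp_comb.add amp_comb.base)
  moreover have "dderiv v (?t c j l k \<sigma> x \<xi>) (A' \<sigma> x \<xi>)" for \<sigma> x \<xi>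
  proof (rule back_subst[of "dderiv v _", OF d])
    have C: "Complex (p \<bullet> v - 2 * \<sigma> * r) (q \<bullet> v) = Complex (p \<bullet> v) (q \<bullet> v) - 2 * of_real \<sigma> * of_real r" for r
      by (simp add: complex_eq_iff)
    show "(\<lambda>y. (c * of_real \<sigma> ^ j * of_real (y \<bullet> v) ^ l * ?D k x \<xi> y) * (gexp \<sigma> p q y * Complex (p \<bullet> v - 2 * \<sigma> * (y \<bullet> v)) (q \<bullet> v))
       + ((c * of_real \<sigma> ^ j * of_real (y \<bullet> v) ^ l) * ((1/2) *\<^sub>R ?D (Suc k) x \<xi> y)
          + (c * of_real \<sigma> ^ j * (of_nat l * of_real (y \<bullet> v) ^ (l - 1)) + 0 * of_real (y \<bullet> v) ^ l) * ?D k x \<xi> y) * gexp \<sigma> p q y)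
       = A' \<sigma> x \<xi>"
      unfolding A'_def C by (intro ext) (simp add: scaleR_conv_of_real ring_distribs mult_ac del: funpow.simps)
  qed
  ultimately show ?case by blast
next
  case (add A B)
  then obtain A' B' where "amp_comb b p q v A'" "\<And>\<sigma> x \<xi>. dderiv v (A \<sigma> x \<xi>) (A' \<sigma> x \<xi>)"
    "amp_comb b p q v B'" "\<And>\<sigma> x \<xi>. dderiv v (B \<sigma> x \<xi>) (B' \<sigma> x \<xi>)" by blast
  thus ?case by (intro exI[of _ "\<lambda>\<sigma> x \<xi> y. A' \<sigma> x \<xi> y + B' \<sigma> x \<xi> y"]) (auto intro: amp_comb.add dderiv_add)
qed

text \<open>Half of the Gaussian of width at least 1/2 absorbs all powers of y, including the m
  powers coming from b; the other half remains. The exponent m in x and \<xi> is the same for every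
  A, and the constant is the same for all \<sigma> in the interval.\<close>

lemma amp_comb_le:
  "amp_comb b p q v A \<Longrightarrow> \<exists>C\<ge>0. \<forall>\<sigma>\<in>{1/2..3/2}. \<forall>x \<xi> y.
     norm (A \<sigma> x \<xi> y) \<le> C * ((1 + norm x) * (1 + norm \<xi>)) ^ m * exp (- (1/4) * (norm y)\<^sup>2)"
proof (induction rule: amp_comb.induct)
  case (base c j l k)
  obtain C where C: "C \<ge> 0" "\<And>X. norm ((partial_deriv (v, 0) ^^ k) b X) \<le> C * (1 + norm X) ^ m"
    using growth by blast
  obtain C' where C': "C' > 0" "\<And>x. x \<ge> 0 \<Longrightarrow> (1 + x) ^ (l + m) * exp (norm p * x - 1/2 * x\<^sup>2) \<le> C' * exp (- ((1/2)/2) * x\<^sup>2)"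
    using poly_gauss_bound[of "1/2" "l + m" "norm p"] by auto
  show ?case
  proof (intro exI[of _ "norm c * 2 ^ j * C * C'"] conjI ballI allI)
    fix \<sigma> :: real and x \<xi> y :: 'a assume s: "\<sigma> \<in> {1/2..3/2}"
    let ?R = "(1 + norm x) * (1 + norm \<xi>)"
    have a1: "norm (complex_of_real \<sigma> ^ j) \<le> 2 ^ j" using s unfolding norm_power by (intro power_mono) auto
    have a2: "norm (complex_of_real (y \<bullet> v) ^ l) \<le> (1 + norm y) ^ l"
      unfolding norm_power using Basis_le_norm[OF v, of y] by (intro power_mono) auto
    have "norm ((partial_deriv (v, 0) ^^ k) b ((1/2) *\<^sub>R (x + y), \<xi>)) \<le> C * (1 + norm ((1/2) *\<^sub>R (x + y), \<xi>)) ^ m" by (rule C)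
    also have "\<dots> \<le> C * (?R * (1 + norm y)) ^ m" using C(1) by (intro mult_left_mono power_mono one_plus_norm_pair_le) auto
    finally have a3: "norm ((partial_deriv (v, 0) ^^ k) b ((1/2) *\<^sub>R (x + y), \<xi>)) \<le> C * (?R * (1 + norm y)) ^ m" .
    have a4: "norm (gexp \<sigma> p q y) \<le> gauss_bd (norm p) (1/2) y" using s by (intro norm_gexp_le) auto
    have "norm (c * of_real \<sigma> ^ j * of_real (y \<bullet> v) ^ l * (partial_deriv (v, 0) ^^ k) b ((1/2) *\<^sub>R (x + y), \<xi>) * gexp \<sigma> p q y)
       \<le> norm c * 2 ^ j * (1 + norm y) ^ l * (C * (?R * (1 + norm y)) ^ m) * gauss_bd (norm p) (1/2) y"
      unfolding norm_mult by (intro mult_mono a1 a2 a3 a4 order.refl mult_nonneg_nonneg zero_le_power norm_ge_zero C(1)) auto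
    also have "\<dots> = norm c * 2 ^ j * C * ?R ^ m * ((1 + norm y) ^ (l + m) * gauss_bd (norm p) (1/2) y)"
      by (simp only: power_mult_distrib power_add mult_ac)
    also have "\<dots> \<le> norm c * 2 ^ j * C * ?R ^ m * (C' * exp (- ((1/2)/2) * (norm y)\<^sup>2))"
      using C(1) by (intro mult_left_mono C') auto
    finally show "norm (c * of_real \<sigma> ^ j * of_real (y \<bullet> v) ^ l * (partial_deriv (v, 0) ^^ k) b ((1/2) *\<^sub>R (x + y), \<xi>) * gexp \<sigma> p q y)
       \<le> norm c * 2 ^ j * C * C' * ?R ^ m * exp (- (1/4) * (norm y)\<^sup>2)"
      by (simp add: mult_ac)
  qed (use C(1) C'(1) in simp)
next
  case (add A B)
  then obtain C D where h: "C \<ge> 0" "D \<ge> 0"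
    "\<And>\<sigma> x \<xi> y. \<sigma> \<in> {1/2..3/2} \<Longrightarrow> norm (A \<sigma> x \<xi> y) \<le> C * ((1 + norm x) * (1 + norm \<xi>)) ^ m * exp (- (1/4) * (norm y)\<^sup>2)"
    "\<And>\<sigma> x \<xi> y. \<sigma> \<in> {1/2..3/2} \<Longrightarrow> norm (B \<sigma> x \<xi> y) \<le> D * ((1 + norm x) * (1 + norm \<xi>)) ^ m * exp (- (1/4) * (norm y)\<^sup>2)"
    by blast
  show ?case
  proof (intro exI[of _ "C + D"] conjI ballI allI)
    fix \<sigma> :: real and x \<xi> y :: 'a assume s: "\<sigma> \<in> {1/2..3/2}"
    show "norm (A \<sigma> x \<xi> y + B \<sigma> x \<xi> y) \<le> (C + D) * ((1 + norm x) * (1 + norm \<xi>)) ^ m * exp (- (1/4) * (norm y)\<^sup>2)"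
      using norm_triangle_le[OF add_mono[OF h(3)[OF s] h(4)[OF s]]] by (simp only: distrib_right)
  qed (use h in auto)
qed

lemma integrable_gauss_quarter: "integrable lborel (\<lambda>y::'a. exp (- (1/4) * (norm y)\<^sup>2))"
  using integrable_exp_norm[where 'a='a, of "1/4" 0 0] by simp

lemma amp_comb_integrable:
  assumes A: "amp_comb b p q v A" and s: "\<sigma> \<in> {1/2..3/2}"
  shows "integrable lborel (\<lambda>y. phase \<xi> y * A \<sigma> x \<xi> y)"
proof -
  obtain C where C: "C \<ge> 0" "\<And>y. norm (A \<sigma> x \<xi> y) \<le> C * ((1 + norm x) * (1 + norm \<xi>)) ^ m * exp (- (1/4) * (norm y)\<^sup>2)"
    using amp_comb_le[OF A] s by blast
  have [measurable]: "A \<sigma> x \<xi> \<in> borel_measurable borel"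
    using amp_comb_continuous[OF A] by (rule borel_measurable_continuous_onI)
  show ?thesis
  proof (rule Bochner_Integration.integrable_bound)
    show "integrable lborel (\<lambda>y::'a. C * ((1 + norm x) * (1 + norm \<xi>)) ^ m * exp (- (1/4) * (norm y)\<^sup>2))"
      by (intro integrable_mult_right integrable_gauss_quarter)
    have "norm (phase \<xi> y * A \<sigma> x \<xi> y) = norm (A \<sigma> x \<xi> y)" for y
      by (simp add: norm_mult)
    thus "AE y in lborel. norm (phase \<xi> y * A \<sigma> x \<xi> y) \<le> norm (C * ((1 + norm x) * (1 + norm \<xi>)) ^ m * exp (- (1/4) * (norm y)\<^sup>2))"
      using C(2) by (simp only:) (intro AE_I2, use order_trans[OF C(2) abs_ge_self] in simp)
  qed measurable
qed

lemma amp_comb_by_parts: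
  assumes A: "amp_comb b p q v A"
  shows "\<exists>A'. amp_comb b p q v A' \<and> (\<forall>\<sigma>\<in>{1/2..3/2}. \<forall>x \<xi>.
     (\<i> * of_real (\<xi> \<bullet> v)) * (\<integral>y. phase \<xi> y * A \<sigma> x \<xi> y \<partial>lborel)
       = (\<integral>y. phase \<xi> y * A' \<sigma> x \<xi> y \<partial>lborel))"
proof -
  obtain A' where A': "amp_comb b p q v A'" "\<And>\<sigma> x \<xi>. dderiv v (A \<sigma> x \<xi>) (A' \<sigma> x \<xi>)"
    using amp_comb_dderiv[OF A] by blast
  have "(\<i> * of_real (\<xi> \<bullet> v)) * (\<integral>y. phase \<xi> y * A \<sigma> x \<xi> y \<partial>lborel)
       = (\<integral>y. phase \<xi> y * A' \<sigma> x \<xi> y \<partial>lborel)" if s: "\<sigma> \<in> {1/2..3/2}" for \<sigma> x \<xi>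
  proof -
    define e where "e = (\<lambda>y. exp (- \<i> * complex_of_real (y \<bullet> \<xi>)))"
    have de: "dderiv v e (\<lambda>y. (- \<i> * of_real (\<xi> \<bullet> v)) * e y)"
      unfolding dderiv_def
    proof
      fix y
      have "((\<lambda>t. - \<i> * complex_of_real ((y + t *\<^sub>R v) \<bullet> \<xi>)) has_vector_derivative (- \<i> * of_real (\<xi> \<bullet> v))) (at 0)"
        unfolding inner_add_left inner_scaleR_left of_real_add of_real_mult
        by (auto intro!: derivative_eq_intros simp: inner_commute)
      from field_vector_diff_chain_at[OF this DERIV_exp]
      show "((\<lambda>t. e (y + t *\<^sub>R v)) has_vector_derivative (- \<i> * of_real (\<xi> \<bullet> v)) * e y) (at 0)"
        by (simp add: e_def o_def)
    qed
    have i: "integrable lborel (\<lambda>y. e y * A \<sigma> x \<xi> y)" "integrable lborel (\<lambda>y. e y * A' \<sigma> x \<xi> y)"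
      unfolding e_def using amp_comb_integrable[OF _ s] A A' by auto
    have ec: "continuous_on UNIV e" unfolding e_def by (intro continuous_intros)
    have i2: "integrable lborel (\<lambda>y. (- \<i> * of_real (\<xi> \<bullet> v)) * e y * A \<sigma> x \<xi> y)"
      using i(1) by (simp only: mult.assoc) (intro integrable_mult_right)
    have "(\<integral>y. e y * A' \<sigma> x \<xi> y + (- \<i> * of_real (\<xi> \<bullet> v)) * e y * A \<sigma> x \<xi> y \<partial>lborel) = 0"
      by (rule integral_dderiv_eq_0[OF dderiv_mult[OF de A'(2)]])
         (intro continuous_intros ec amp_comb_continuous[OF A] amp_comb_continuous[OF A'(1)] i i2 Bochner_Integration.integrable_add)+
    hence "(\<integral>y. e y * A' \<sigma> x \<xi> y \<partial>lborel) = - (\<integral>y. (- \<i> * of_real (\<xi> \<bullet> v)) * (e y * A \<sigma> x \<xi> y) \<partial>lborel)"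
      using i2 i by (simp only: mult.assoc Bochner_Integration.integral_add eq_neg_iff_add_eq_0)
    also have "\<dots> = (\<i> * of_real (\<xi> \<bullet> v)) * (\<integral>y. e y * A \<sigma> x \<xi> y \<partial>lborel)"
      by (subst integral_mult_right_zero) simp
    finally show ?thesis by (simp add: e_def)
  qed
  with A'(1) show ?thesis by blast
qed

lemma amp_comb_by_parts_n:
  assumes A: "amp_comb b p q v A"
  shows "\<exists>A'. amp_comb b p q v A' \<and> (\<forall>\<sigma>\<in>{1/2..3/2}. \<forall>x \<xi>.
     (\<i> * of_real (\<xi> \<bullet> v)) ^ n * (\<integral>y. phase \<xi> y * A \<sigma> x \<xi> y \<partial>lborel)
       = (\<integral>y. phase \<xi> y * A' \<sigma> x \<xi> y \<partial>lborel))"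
proof (induction n)
  case 0
  show ?case using A by (intro exI[of _ A]) simp
next
  case (Suc n)
  then obtain B where B: "amp_comb b p q v B"
    "\<And>\<sigma> x \<xi>. \<sigma> \<in> {1/2..3/2} \<Longrightarrow> (\<i> * of_real (\<xi> \<bullet> v)) ^ n * (\<integral>y. phase \<xi> y * A \<sigma> x \<xi> y \<partial>lborel)
       = (\<integral>y. phase \<xi> y * B \<sigma> x \<xi> y \<partial>lborel)" by blast
  obtain B' where B': "amp_comb b p q v B'"
    "\<And>\<sigma> x \<xi>. \<sigma> \<in> {1/2..3/2} \<Longrightarrow> (\<i> * of_real (\<xi> \<bullet> v)) * (\<integral>y. phase \<xi> y * B \<sigma> x \<xi> y \<partial>lborel)
       = (\<integral>y. phase \<xi> y * B' \<sigma> x \<xi> y \<partial>lborel)" using amp_comb_by_parts[OF B(1)] by blast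
  show ?case
  proof (intro exI[of _ B'] conjI ballI allI)
    fix \<sigma> :: real and x \<xi> :: 'a assume s: "\<sigma> \<in> {1/2..3/2}"
    show "(\<i> * of_real (\<xi> \<bullet> v)) ^ Suc n * (\<integral>y. phase \<xi> y * A \<sigma> x \<xi> y \<partial>lborel)
       = (\<integral>y. phase \<xi> y * B' \<sigma> x \<xi> y \<partial>lborel)"
      unfolding power_Suc mult.assoc[of "\<i> * of_real (\<xi> \<bullet> v)"] B(2)[OF s] B'(2)[OF s] ..
  qed (rule B'(1))
qed

text \<open>Each factor of \<xi>.v is produced by differentiating the phase and removed by one
  integration by parts. The power n is free while the right-hand side keeps the fixed order
  m.\<close>

lemma osc_decay_dir:
  "\<exists>C\<ge>0. \<forall>\<sigma>\<in>{1/2..3/2}. \<forall>x \<xi>. \<bar>\<xi> \<bullet> v\<bar> ^ n * norm (\<integral>y. phase \<xi> y * (b ((1/2) *\<^sub>R (x + y), \<xi>) * gexp \<sigma> p q y) \<partial>lborel)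
     \<le> C * ((1 + norm x) * (1 + norm \<xi>)) ^ m"
proof -
  define A where "A = (\<lambda>\<sigma> x \<xi> y. b ((1/2) *\<^sub>R (x + y), \<xi>) * gexp \<sigma> p q y)"
  have "amp_comb b p q v A" using amp_comb.base[of b p q v 1 0 0 0] by (simp add: A_def)
  then obtain A' where A': "amp_comb b p q v A'" "\<And>\<sigma> x \<xi>. \<sigma> \<in> {1/2..3/2} \<Longrightarrow>
     (\<i> * of_real (\<xi> \<bullet> v)) ^ n * (\<integral>y. phase \<xi> y * A \<sigma> x \<xi> y \<partial>lborel)
       = (\<integral>y. phase \<xi> y * A' \<sigma> x \<xi> y \<partial>lborel)"
    using amp_comb_by_parts_n by blast
  obtain C where C: "C \<ge> 0" "\<And>\<sigma> x \<xi> y. \<sigma> \<in> {1/2..3/2} \<Longrightarrow> norm (A' \<sigma> x \<xi> y) \<le> C * ((1 + norm x) * (1 + norm \<xi>)) ^ m * exp (- (1/4) * (norm y)\<^sup>2)"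
    using amp_comb_le[OF A'(1)] by blast
  let ?I = "integral\<^sup>L lborel (\<lambda>y::'a. exp (- (1/4) * (norm y)\<^sup>2))"
  show ?thesis
  proof (intro exI[of _ "C * ?I"] conjI ballI allI)
    show "C * ?I \<ge> 0" using C(1) by simp
    fix \<sigma> :: real and x \<xi> :: 'a assume s: "\<sigma> \<in> {1/2..3/2}"
    have "\<bar>\<xi> \<bullet> v\<bar> ^ n * norm (\<integral>y. phase \<xi> y * A \<sigma> x \<xi> y \<partial>lborel)
        = norm (\<integral>y. phase \<xi> y * A' \<sigma> x \<xi> y \<partial>lborel)"
      unfolding A'(2)[OF s, symmetric] by (simp add: norm_mult norm_power)
    also have "\<dots> \<le> (\<integral>y. norm (phase \<xi> y * A' \<sigma> x \<xi> y) \<partial>lborel)" by (rule integral_norm_bound)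
    also have "\<dots> \<le> (\<integral>y. C * ((1 + norm x) * (1 + norm \<xi>)) ^ m * exp (- (1/4) * (norm (y::'a))\<^sup>2) \<partial>lborel)"
    proof (rule Bochner_Integration.integral_mono)
      show "integrable lborel (\<lambda>y. norm (phase \<xi> y * A' \<sigma> x \<xi> y))"
        by (rule integrable_norm[OF amp_comb_integrable[OF A'(1) s]])
      show "integrable lborel (\<lambda>y::'a. C * ((1 + norm x) * (1 + norm \<xi>)) ^ m * exp (- (1/4) * (norm y)\<^sup>2))"
        by (rule integrable_mult_right[OF integrable_gauss_quarter])
      show "norm (phase \<xi> y * A' \<sigma> x \<xi> y) \<le> C * ((1 + norm x) * (1 + norm \<xi>)) ^ m * exp (- (1/4) * (norm y)\<^sup>2)" for y
        using C(2)[OF s] by (simp add: norm_mult)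
    qed
    also have "\<dots> = C * ?I * ((1 + norm x) * (1 + norm \<xi>)) ^ m" by (subst integral_mult_right_zero) (simp only: mult_ac)
    finally show "\<bar>\<xi> \<bullet> v\<bar> ^ n * norm (\<integral>y. phase \<xi> y * (b ((1/2) *\<^sub>R (x + y), \<xi>) * gexp \<sigma> p q y) \<partial>lborel)
      \<le> C * ?I * ((1 + norm x) * (1 + norm \<xi>)) ^ m" unfolding A_def .
  qed
qed

end

section \<open>Frequency decay from directional estimates\<close>

lemma fubini_product_bound:
  fixes F :: "'a::euclidean_space \<Rightarrow> 'b::euclidean_space \<Rightarrow> 'c::{banach, second_countable_topology}"
  assumes meas: "(\<lambda>z. F (fst z) (snd z)) \<in> borel_measurable borel"
    and le: "\<And>x y. norm (F x y) \<le> f x * g y"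
    and f: "integrable lborel f" and g: "integrable lborel g"
  shows "integrable lborel (\<lambda>(x, y). F x y)"
    and "(\<integral>z. (case z of (x, y) \<Rightarrow> F x y) \<partial>lborel) = (\<integral>x. (\<integral>y. F x y \<partial>lborel) \<partial>lborel)"
    and "(\<integral>z. (case z of (x, y) \<Rightarrow> F x y) \<partial>lborel) = (\<integral>y. (\<integral>x. F x y \<partial>lborel) \<partial>lborel)"
proof -
  note [measurable] = borel_measurable_integrable[OF f] borel_measurable_integrable[OF g]
  have "integrable (lborel \<Otimes>\<^sub>M lborel) (\<lambda>(x, y). f x * g y :: real)"
  proof (rule lborel_pair.Fubini_integrable)
    have "(\<lambda>x. \<integral>y. norm (case (x, y) of (x, y) \<Rightarrow> f x * g y) \<partial>lborel) = (\<lambda>x. norm (f x) * (\<integral>y. norm (g y) \<partial>lborel))"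
      by (auto simp: abs_mult)
    thus "integrable lborel (\<lambda>x. \<integral>y. norm (case (x, y) of (x, y) \<Rightarrow> f x * g y) \<partial>lborel)"
      using f by (simp only:) (intro integrable_mult_left integrable_norm)
  qed (use g in auto)
  hence fg: "integrable lborel (\<lambda>(x, y). f x * g y :: real)" by (simp add: lborel_prod)
  show 1: "integrable lborel (\<lambda>(x, y). F x y)"
  proof (rule Bochner_Integration.integrable_bound[OF fg])
    show "(\<lambda>(x, y). F x y) \<in> borel_measurable lborel" using meas by (simp add: case_prod_beta')
    have "norm (F x y) \<le> \<bar>f x * g y\<bar>" for x y using le[of x y] by linarith
    thus "AE z in lborel. norm (case z of (x, y) \<Rightarrow> F x y) \<le> norm (case z of (x, y) \<Rightarrow> f x * g y)"
      by (auto simp: case_prod_beta)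
  qed
  hence 2: "integrable (lborel \<Otimes>\<^sub>M lborel) (\<lambda>(x, y). F x y)" by (simp add: lborel_prod)
  show "(\<integral>z. (case z of (x, y) \<Rightarrow> F x y) \<partial>lborel) = (\<integral>x. (\<integral>y. F x y \<partial>lborel) \<partial>lborel)"
    using lborel_pair.integral_fst[OF 2] by (simp add: lborel_prod)
  show "(\<integral>z. (case z of (x, y) \<Rightarrow> F x y) \<partial>lborel) = (\<integral>y. (\<integral>x. F x y \<partial>lborel) \<partial>lborel)"
    using lborel_pair.integral_snd[OF 2] by (simp add: lborel_prod)
qed

text \<open>Some coordinate of \<xi> is at least |\<xi>| divided by the dimension, so pure powers of
  the coordinates control powers of the norm. This combines the estimates obtained in the separate
  directions.\<close>

lemma one_plus_norm_power_le:
  fixes \<xi> :: "'a::euclidean_space"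
  shows "(1 + norm \<xi>) ^ n \<le> 2 ^ n * (1 + real DIM('a) ^ n * (\<Sum>v\<in>Basis. \<bar>\<xi> \<bullet> v\<bar> ^ n))"
proof -
  have "(1 + norm \<xi>) ^ n \<le> 2 ^ n * (1 + norm \<xi> ^ n)"
  proof (cases "norm \<xi> \<le> 1")
    case True
    hence "(1 + norm \<xi>) ^ n \<le> 2 ^ n * 1" by (simp add: power_mono)
    also have "\<dots> \<le> 2 ^ n * (1 + norm \<xi> ^ n)" by (intro mult_left_mono) auto
    finally show ?thesis .
  next
    case False
    hence "(1 + norm \<xi>) ^ n \<le> (2 * norm \<xi>) ^ n" by (intro power_mono) auto
    also have "\<dots> \<le> 2 ^ n * (1 + norm \<xi> ^ n)" by (simp add: power_mult_distrib)
    finally show ?thesis .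
  qed
  also have "norm \<xi> ^ n \<le> real DIM('a) ^ n * (\<Sum>v\<in>Basis. \<bar>\<xi> \<bullet> v\<bar> ^ n)"
  proof -
    have "\<exists>v\<in>Basis. norm \<xi> \<le> real DIM('a) * \<bar>\<xi> \<bullet> v\<bar>"
    proof (rule ccontr)
      assume "\<not> ?thesis"
      hence "(\<Sum>v\<in>Basis. \<bar>\<xi> \<bullet> v\<bar>) < of_nat DIM('a) * (norm \<xi> / real DIM('a))"
        by (intro sum_bounded_above_strict) (auto simp: field_simps)
      thus False using norm_le_l1[of \<xi>] by simp
    qed
    then obtain v where v: "v \<in> Basis" "norm \<xi> \<le> real DIM('a) * \<bar>\<xi> \<bullet> v\<bar>" by blast
    have "norm \<xi> ^ n \<le> (real DIM('a) * \<bar>\<xi> \<bullet> v\<bar>) ^ n" using v by (intro power_mono) auto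
    also have "\<dots> = real DIM('a) ^ n * \<bar>\<xi> \<bullet> v\<bar> ^ n" by (rule power_mult_distrib)
    also have "\<dots> \<le> real DIM('a) ^ n * (\<Sum>v\<in>Basis. \<bar>\<xi> \<bullet> v\<bar> ^ n)"
      using v by (intro mult_left_mono member_le_sum) auto
    finally show ?thesis .
  qed
  finally show ?thesis by simp
qed

lemma osc_decay:
  fixes b :: "'a::euclidean_space \<times> 'a \<Rightarrow> complex"
  assumes b: "amplitude b"
  shows "\<exists>C\<ge>0. \<exists>m. \<forall>\<sigma>\<in>{1/2..3/2}. \<forall>x \<xi>.
     norm (\<integral>y. phase \<xi> y * (b ((1/2) *\<^sub>R (x + y), \<xi>) * gexp \<sigma> p q y) \<partial>lborel)
     \<le> C * (1 + norm x) ^ m * (\<Prod>v\<in>Basis. inverse (1 + (\<xi> \<bullet> v)\<^sup>2))"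
proof -
  have sm: "smooth b" using b by (simp add: amplitude_def)
  obtain m where m: "\<And>v k. v \<in> Basis \<Longrightarrow> \<exists>C\<ge>0. \<forall>X. norm ((partial_deriv v ^^ k) b X) \<le> C * (1 + norm X) ^ m"
    using amplitude_bound[OF b] by blast
  define J where "J = (\<lambda>\<sigma> x \<xi>. norm (\<integral>y. phase \<xi> y * (b ((1/2) *\<^sub>R (x + y), \<xi>) * gexp \<sigma> p q y) \<partial>lborel))"
  define R where "R = (\<lambda>x \<xi>. ((1 + norm (x::'a)) * (1 + norm (\<xi>::'a))) ^ m)"
  have dir: "\<exists>C\<ge>0. \<forall>\<sigma>\<in>{1/2..3/2}. \<forall>x \<xi>. \<bar>\<xi> \<bullet> v\<bar> ^ n * J \<sigma> x \<xi> \<le> C * R x \<xi>" if v: "v \<in> Basis" for v n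
  proof -
    have "(v, 0) \<in> (Basis :: ('a \<times> 'a) set)" using v by (simp add: Basis_prod_def)
    thus ?thesis unfolding J_def R_def by (intro osc_decay_dir[OF sm v m])
  qed
  \<comment> \<open>m powers compensate the growth in \<xi>; the remaining 2 DIM powers dominate the
    product of the factors 1 + (\<xi>.v)^2.\<close>
  define n where "n = m + 2 * DIM('a)"
  obtain v0 :: 'a where v0: "v0 \<in> Basis" using nonempty_Basis by blast
  obtain C0 where C0: "C0 \<ge> 0" "\<And>\<sigma> x \<xi>. \<sigma> \<in> {1/2..3/2} \<Longrightarrow> J \<sigma> x \<xi> \<le> C0 * R x \<xi>"
    using dir[OF v0, of 0] by auto
  have "\<forall>v\<in>Basis. \<exists>C\<ge>0. \<forall>\<sigma>\<in>{1/2..3/2}. \<forall>x \<xi>. \<bar>\<xi> \<bullet> v\<bar> ^ n * J \<sigma> x \<xi> \<le> C * R x \<xi>" using dir by blast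
  then obtain D where D: "\<And>v. v \<in> Basis \<Longrightarrow> D v \<ge> 0"
    "\<And>v \<sigma> x \<xi>. v \<in> Basis \<Longrightarrow> \<sigma> \<in> {1/2..3/2} \<Longrightarrow> \<bar>\<xi> \<bullet> v\<bar> ^ n * J \<sigma> x \<xi> \<le> D v * R x \<xi>" by metis
  define C where "C = 2 ^ n * (C0 + real DIM('a) ^ n * (\<Sum>v\<in>Basis. D v))"
  have C: "C \<ge> 0" unfolding C_def using C0(1) D(1) by (intro mult_nonneg_nonneg add_nonneg_nonneg sum_nonneg) auto
  have "\<exists>C\<ge>0. \<exists>m. \<forall>\<sigma>\<in>{1/2..3/2}. \<forall>x \<xi>. J \<sigma> x \<xi> \<le> C * (1 + norm x) ^ m * (\<Prod>v\<in>Basis. inverse (1 + (\<xi> \<bullet> v)\<^sup>2))"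
  proof (intro exI[of _ C] exI[of _ m] conjI C ballI allI)
    fix \<sigma> :: real and x \<xi> :: 'a assume s: "\<sigma> \<in> {1/2..3/2}"
    have J0: "J \<sigma> x \<xi> \<ge> 0" by (simp add: J_def)
    have "(1 + norm \<xi>) ^ n * J \<sigma> x \<xi> \<le> 2 ^ n * (1 + real DIM('a) ^ n * (\<Sum>v\<in>Basis. \<bar>\<xi> \<bullet> v\<bar> ^ n)) * J \<sigma> x \<xi>"
      using J0 by (intro mult_right_mono one_plus_norm_power_le)
    also have "\<dots> = 2 ^ n * (J \<sigma> x \<xi> + real DIM('a) ^ n * (\<Sum>v\<in>Basis. \<bar>\<xi> \<bullet> v\<bar> ^ n * J \<sigma> x \<xi>))"
      unfolding sum_distrib_right[symmetric] by (simp add: algebra_simps)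
    also have "\<dots> \<le> 2 ^ n * (C0 * R x \<xi> + real DIM('a) ^ n * (\<Sum>v\<in>Basis. D v * R x \<xi>))"
      using s by (intro mult_left_mono add_mono sum_mono C0 D) auto
    also have "\<dots> = C * R x \<xi>" unfolding C_def sum_distrib_right[symmetric] by (simp add: algebra_simps)
    finally have "(1 + norm \<xi>) ^ (2 * DIM('a)) * J \<sigma> x \<xi> * (1 + norm \<xi>) ^ m \<le> C * (1 + norm x) ^ m * (1 + norm \<xi>) ^ m"
      by (simp add: R_def n_def power_add power_mult_distrib mult_ac)
    hence 1: "(1 + norm \<xi>) ^ (2 * DIM('a)) * J \<sigma> x \<xi> \<le> C * (1 + norm x) ^ m"
      by (subst (asm) mult_le_cancel_right_pos) (auto intro!: zero_less_power add_pos_nonneg)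
    have "(\<Prod>v\<in>Basis. 1 + (\<xi> \<bullet> v)\<^sup>2) \<le> (\<Prod>v\<in>(Basis::'a set). (1 + norm \<xi>)\<^sup>2)"
    proof (intro prod_mono conjI)
      fix v :: 'a assume v: "v \<in> Basis"
      have "(\<xi> \<bullet> v)\<^sup>2 \<le> (norm \<xi>)\<^sup>2" using power_mono[OF Basis_le_norm[OF v, of \<xi>], of 2] by simp
      thus "1 + (\<xi> \<bullet> v)\<^sup>2 \<le> (1 + norm \<xi>)\<^sup>2" by (simp add: power2_sum add_increasing2)
    qed (auto intro: add_nonneg_nonneg)
    also have "\<dots> = (1 + norm \<xi>) ^ (2 * DIM('a))" by (simp add: power_mult)
    finally have "(\<Prod>v\<in>Basis. 1 + (\<xi> \<bullet> v)\<^sup>2) * J \<sigma> x \<xi> \<le> C * (1 + norm x) ^ m"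
      using J0 1 by (meson mult_right_mono order_trans)
    moreover have "(\<Prod>v\<in>Basis. 1 + (\<xi> \<bullet> v)\<^sup>2) > 0" by (intro prod_pos) (auto intro: add_pos_nonneg)
    moreover have "(\<Prod>v\<in>Basis. inverse (1 + (\<xi> \<bullet> v)\<^sup>2)) = inverse (\<Prod>v\<in>Basis. 1 + (\<xi> \<bullet> v)\<^sup>2)"
      by (rule prod_inversef[unfolded o_def])
    ultimately show "J \<sigma> x \<xi> \<le> C * (1 + norm x) ^ m * (\<Prod>v\<in>Basis. inverse (1 + (\<xi> \<bullet> v)\<^sup>2))"
      by (simp add: field_simps)
  qed
  thus ?thesis unfolding J_def .
qed

section \<open>The symbol tested against Gaussians\<close>

lemma measurable_fst_snd_borel [measurable]:
  fixes f :: "'s \<Rightarrow> 'a::second_countable_topology \<times> 'b::second_countable_topology"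
  assumes "f \<in> borel_measurable M"
  shows "(\<lambda>x. fst (f x)) \<in> borel_measurable M" "(\<lambda>x. snd (f x)) \<in> borel_measurable M"
proof -
  have fs: "(fst :: 'a \<times> 'b \<Rightarrow> 'a) \<in> borel_measurable borel" "(snd :: 'a \<times> 'b \<Rightarrow> 'b) \<in> borel_measurable borel"
    by (auto intro!: borel_measurable_continuous_onI continuous_intros)
  show "(\<lambda>x. fst (f x)) \<in> borel_measurable M" "(\<lambda>x. snd (f x)) \<in> borel_measurable M"
    by (rule measurable_compose[OF assms fs(1)], rule measurable_compose[OF assms fs(2)])
qed

section \<open>Gaussian cut-off and regularized integrals\<close>

definition osc_amp :: "('a::euclidean_space \<times> 'a \<Rightarrow> complex) \<Rightarrow> ('a \<Rightarrow> complex) \<Rightarrow> 'a \<Rightarrow> 'a \<Rightarrow> 'a \<Rightarrow> complex" where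
  "osc_amp b f x y \<xi> = exp (\<i> * of_real ((x - y) \<bullet> \<xi>)) * b ((1/2) *\<^sub>R (x + y), \<xi>) * f y"

text \<open>One of the two factors of the admissible cut-off exp (- |.|^2) evaluated at the
  \<epsilon>-multiple of (y, \<xi>). The factor in y merges with the test Gaussian and the factor in
  \<xi> is bounded by one.\<close>

definition cutoff :: "real \<Rightarrow> 'a::euclidean_space \<Rightarrow> complex" where
  "cutoff \<epsilon> x = of_real (exp (- (\<epsilon>\<^sup>2 * (x \<bullet> x))))"

lemma cutoff_gexp: "gexp 1 0 0 (\<epsilon> *\<^sub>R (y, \<xi>)) = cutoff \<epsilon> y * cutoff \<epsilon> \<xi>"
  unfolding gexp_def cutoff_def of_real_mult[symmetric] exp_add[symmetric]
  by (simp add: Complex_eq power2_eq_square exp_of_real[symmetric] algebra_simps)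

lemma norm_cutoff_le: "norm (cutoff \<epsilon> x) \<le> 1"
  by (simp add: cutoff_def)

lemma measurable_osc_amp [measurable]:
  assumes [measurable]: "b \<in> borel_measurable borel" "f \<in> borel_measurable borel"
    "g \<in> borel_measurable M" "h \<in> borel_measurable M" "k \<in> borel_measurable M"
  shows "(\<lambda>z. osc_amp b f (g z) (h z) (k z)) \<in> borel_measurable M"
  unfolding osc_amp_def by measurable

lemma measurable_cutoff [measurable]:
  "f \<in> borel_measurable M \<Longrightarrow> (\<lambda>z. cutoff \<epsilon> (f z)) \<in> borel_measurable M"
  unfolding cutoff_def by measurable

lemma cutoff_integrable_poly:
  assumes "\<epsilon> > 0"
  shows "integrable lborel (\<lambda>\<xi>::'a::euclidean_space. (1 + norm \<xi>) ^ m * norm (cutoff \<epsilon> \<xi>))"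
proof -
  have "integrable lborel (\<lambda>\<xi>::'a. (1 + norm \<xi>) ^ m * gauss_bd 0 (\<epsilon>\<^sup>2) \<xi>)"
    using assms by (intro integrable_exp_norm) simp
  thus ?thesis by (simp add: cutoff_def power2_norm_eq_inner)
qed

lemma mehler_1: "mehler 1 p q y = exp (- (csq p q / 4)) * gexp (1/2) p q y"
  by (simp add: mehler_def)

lemma gexp_cutoff: "cutoff \<epsilon> y * gexp s p q y = gexp (s + \<epsilon>\<^sup>2) p q y"
  unfolding cutoff_def gexp_def exp_of_real[symmetric] exp_add[symmetric]
  by (rule arg_cong[where f=exp]) (simp add: complex_eq_iff algebra_simps)

definition regularized_osc :: "('a::euclidean_space \<times> 'a \<Rightarrow> complex) \<Rightarrow> 'a \<Rightarrow> 'a \<Rightarrow> real \<Rightarrow> 'a \<Rightarrow> complex" where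
  "regularized_osc b p q \<epsilon> x = (\<integral>z. gexp 1 0 0 (\<epsilon> *\<^sub>R z) * (case z of (y, \<xi>) \<Rightarrow> osc_amp b (mehler 1 p q) x y \<xi>) \<partial>lborel)"

lemma one_plus_mult: "(1 + a) * (1 + b) = 1 + a + b + a * (b::real)"
  by (simp add: algebra_simps)

lemma amplitude_growth:
  fixes b :: "'a::euclidean_space \<times> 'a \<Rightarrow> complex"
  assumes "amplitude b"
  shows "\<exists>C\<ge>0. \<exists>m. \<forall>x \<xi>. norm (b (x, \<xi>)) \<le> C * (1 + norm x) ^ m * (1 + norm \<xi>) ^ m"
proof -
  obtain v :: "'a \<times> 'a" where v: "v \<in> Basis" using nonempty_Basis by blast
  obtain m where "\<forall>v\<in>Basis. \<forall>k. \<exists>C\<ge>0. \<forall>X. norm ((partial_deriv v ^^ k) b X) \<le> C * (1 + norm X) ^ m"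
    using amplitude_bound[OF assms] by blast
  with v have "\<exists>C\<ge>0. \<forall>X. norm ((partial_deriv v ^^ 0) b X) \<le> C * (1 + norm X) ^ m" by blast
  then obtain C where C: "C \<ge> 0" "\<And>X. norm (b X) \<le> C * (1 + norm X) ^ m" by auto
  have "norm (b (x, \<xi>)) \<le> C * (1 + norm x) ^ m * (1 + norm \<xi>) ^ m" for x \<xi>
  proof -
    have "1 + norm (x, \<xi>) \<le> (1 + norm x) * (1 + norm \<xi>)"
      using norm_Pair_le[of x \<xi>] mult_nonneg_nonneg[OF norm_ge_zero[of x] norm_ge_zero[of \<xi>]]
      unfolding one_plus_mult by linarith
    hence "(1 + norm (x, \<xi>)) ^ m \<le> ((1 + norm x) * (1 + norm \<xi>)) ^ m" by (intro power_mono) auto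
    thus ?thesis using order_trans[OF C(2)[of "(x, \<xi>)"] mult_left_mono[OF _ C(1)]] by (simp add: power_mult_distrib mult.assoc)
  qed
  thus ?thesis using C(1) by blast
qed

context
  fixes b :: "'a::euclidean_space \<times> 'a \<Rightarrow> complex"
  assumes b: "amplitude b"
begin

lemma b_continuous: "continuous_on UNIV b"
proof -
  obtain v :: "'a \<times> 'a" where v: "v \<in> Basis" using nonempty_Basis by blast
  show ?thesis using b smooth_funpow(2)[OF _ v, of b UNIV 0] by (simp add: amplitude_def)
qed

lemma b_measurable [measurable]: "b \<in> borel_measurable borel"
  using b_continuous by (rule borel_measurable_continuous_onI)

lemma osc_amp_le:
  "\<exists>C\<ge>0. \<exists>m. \<forall>x y \<xi>. norm (osc_amp b (mehler 1 p q) x y \<xi>)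
     \<le> C * (1 + norm x) ^ m * (1 + norm \<xi>) ^ m * ((1 + norm y) ^ m * gauss_bd (norm p) (1/2) y)"
proof -
  obtain C m where C: "C \<ge> 0" "\<And>x \<xi>. norm (b (x, \<xi>)) \<le> C * (1 + norm x) ^ m * (1 + norm \<xi>) ^ m"
    using amplitude_growth[OF b] by blast
  let ?E = "exp ((norm q)\<^sup>2/4)"
  show ?thesis
  proof (intro exI[of _ "C * ?E"] exI[of _ m] conjI allI)
    fix x y \<xi> :: 'a
    have "1 + norm ((1/2) *\<^sub>R (x + y)) \<le> (1 + norm x) * (1 + norm y)"
      using norm_triangle_ineq[of x y] norm_ge_zero[of x] norm_ge_zero[of y] mult_nonneg_nonneg[OF norm_ge_zero[of x] norm_ge_zero[of y]]
      unfolding norm_scaleR one_plus_mult by linarith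
    hence "(1 + norm ((1/2) *\<^sub>R (x + y))) ^ m \<le> ((1 + norm x) * (1 + norm y)) ^ m" by (intro power_mono) auto
    hence "C * (1 + norm ((1/2) *\<^sub>R (x + y))) ^ m * (1 + norm \<xi>) ^ m \<le> C * ((1 + norm x) * (1 + norm y)) ^ m * (1 + norm \<xi>) ^ m"
      using C(1) by (intro mult_right_mono mult_left_mono) auto
    with C(2) have "norm (b ((1/2) *\<^sub>R (x + y), \<xi>)) \<le> C * ((1 + norm x) * (1 + norm y)) ^ m * (1 + norm \<xi>) ^ m"
      by (rule order_trans)
    moreover have "norm (mehler 1 p q y) \<le> ?E * gauss_bd (norm p) (1/2) y" by (rule norm_mehler_le) auto
    ultimately have "norm (b ((1/2) *\<^sub>R (x + y), \<xi>)) * norm (mehler 1 p q y)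
       \<le> (C * ((1 + norm x) * (1 + norm y)) ^ m * (1 + norm \<xi>) ^ m) * (?E * gauss_bd (norm p) (1/2) y)"
      using C(1) by (intro mult_mono) auto
    thus "norm (osc_amp b (mehler 1 p q) x y \<xi>)
     \<le> C * ?E * (1 + norm x) ^ m * (1 + norm \<xi>) ^ m * ((1 + norm y) ^ m * gauss_bd (norm p) (1/2) y)"
      by (simp add: osc_amp_def norm_mult power_mult_distrib mult_ac)
  qed (use C(1) in simp)
qed

lemma regularized_osc_iterated:
  assumes e: "\<epsilon> > 0"
  shows "regularized_osc b p q \<epsilon> x = (\<integral>\<xi>. (\<integral>y. cutoff \<epsilon> y * cutoff \<epsilon> \<xi> * osc_amp b (mehler 1 p q) x y \<xi> \<partial>lborel) \<partial>lborel)"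
proof -
  obtain C m where C: "C \<ge> 0" "\<And>x y \<xi>. norm (osc_amp b (mehler 1 p q) x y \<xi>)
     \<le> C * (1 + norm x) ^ m * (1 + norm \<xi>) ^ m * ((1 + norm y) ^ m * gauss_bd (norm p) (1/2) y)"
    using osc_amp_le by blast
  let ?F = "\<lambda>y \<xi>. cutoff \<epsilon> y * cutoff \<epsilon> \<xi> * osc_amp b (mehler 1 p q) x y \<xi>"
  have "regularized_osc b p q \<epsilon> x = (\<integral>z. (case z of (y, \<xi>) \<Rightarrow> ?F y \<xi>) \<partial>lborel)"
    unfolding regularized_osc_def by (intro Bochner_Integration.integral_cong refl) (auto simp: cutoff_gexp simp del: scaleR_Pair)
  also have "\<dots> = (\<integral>\<xi>. (\<integral>y. ?F y \<xi> \<partial>lborel) \<partial>lborel)"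
  proof (rule fubini_product_bound(3))
    show "(\<lambda>z. ?F (fst z) (snd z)) \<in> borel_measurable borel" by measurable
    fix y \<xi> :: 'a
    have "norm (?F y \<xi>) \<le> 1 * norm (cutoff \<epsilon> \<xi>) * (C * (1 + norm x) ^ m * (1 + norm \<xi>) ^ m * ((1 + norm y) ^ m * gauss_bd (norm p) (1/2) y))"
      unfolding norm_mult by (intro mult_mono norm_cutoff_le C(2) order.refl) auto
    thus "norm (?F y \<xi>) \<le> (C * (1 + norm x) ^ m * ((1 + norm y) ^ m * gauss_bd (norm p) (1/2) y))
         * ((1 + norm \<xi>) ^ m * norm (cutoff \<epsilon> \<xi>))" by (simp only: mult_ac mult_1)
  next
    show "integrable lborel (\<lambda>y::'a. C * (1 + norm x) ^ m * ((1 + norm y) ^ m * gauss_bd (norm p) (1/2) y))"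
      by (intro integrable_mult_right integrable_exp_norm) simp
    show "integrable lborel (\<lambda>\<xi>::'a. (1 + norm \<xi>) ^ m * norm (cutoff \<epsilon> \<xi>))" using e by (rule cutoff_integrable_poly)
  qed
  finally show ?thesis .
qed

lemma regularized_osc_measurable: "regularized_osc b p q \<epsilon> \<in> borel_measurable borel"
  unfolding regularized_osc_def case_prod_beta by measurable

text \<open>Integrating in y first makes \<open>osc_decay\<close> available with \<sigma> = 1/2 +
  \<epsilon>^2, which lies in the allowed interval for \<epsilon> \<le> 1. The decay in \<xi> so
  gained does not depend on \<epsilon>, and the cut-off in \<xi> is estimated by one.\<close>

lemma regularized_osc_le:
  "\<exists>C\<ge>0. \<exists>m. \<forall>\<epsilon>. 0 < \<epsilon> \<longrightarrow> \<epsilon> \<le> 1 \<longrightarrow> (\<forall>x. norm (regularized_osc b p q \<epsilon> x) \<le> C * (1 + norm x) ^ m)"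
proof -
  obtain C m where C: "C \<ge> 0" "\<And>\<sigma> x \<xi>. \<sigma> \<in> {1/2..3/2} \<Longrightarrow>
     norm (\<integral>y. phase \<xi> y * (b ((1/2) *\<^sub>R (x + y), \<xi>) * gexp \<sigma> p q y) \<partial>lborel)
     \<le> C * (1 + norm x) ^ m * (\<Prod>v\<in>Basis. inverse (1 + (\<xi> \<bullet> v)\<^sup>2))"
    using osc_decay[OF b] by blast
  let ?P = "\<lambda>\<xi>::'a. \<Prod>v\<in>Basis. inverse (1 + (\<xi> \<bullet> v)\<^sup>2)"
  let ?e = "exp (- (csq p q / 4))"
  define I where "I = integral\<^sup>L lborel ?P"
  have I0: "I \<ge> 0" unfolding I_def by (intro integral_nonneg_AE AE_I2 prod_nonneg) auto
  show ?thesis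
  proof (intro exI[of _ "norm ?e * C * I"] exI[of _ m] conjI allI impI)
    fix \<epsilon> :: real and x :: 'a assume e: "0 < \<epsilon>" "\<epsilon> \<le> 1"
    define G where "G = (\<lambda>\<xi>. \<integral>y. cutoff \<epsilon> y * cutoff \<epsilon> \<xi> * osc_amp b (mehler 1 p q) x y \<xi> \<partial>lborel)"
    have G: "norm (G \<xi>) \<le> norm ?e * (C * (1 + norm x) ^ m * ?P \<xi>)" for \<xi>
    proof -
      have s: "1/2 + \<epsilon>\<^sup>2 \<in> {1/2..3/2}" using e by (simp add: power_le_one)
      have "cutoff \<epsilon> y * cutoff \<epsilon> \<xi> * osc_amp b (mehler 1 p q) x y \<xi>
        = (cutoff \<epsilon> \<xi> * ?e * exp (\<i> * of_real (x \<bullet> \<xi>))) * (phase \<xi> y * (b ((1/2) *\<^sub>R (x + y), \<xi>) * gexp (1/2 + \<epsilon>\<^sup>2) p q y))" for y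
        unfolding osc_amp_def mehler_1 gexp_cutoff[symmetric] inner_diff_left of_real_diff right_diff_distrib exp_diff
        by (simp add: exp_minus field_simps)
      hence "G \<xi> = (cutoff \<epsilon> \<xi> * ?e * exp (\<i> * of_real (x \<bullet> \<xi>))) * (\<integral>y. phase \<xi> y * (b ((1/2) *\<^sub>R (x + y), \<xi>) * gexp (1/2 + \<epsilon>\<^sup>2) p q y) \<partial>lborel)"
        unfolding G_def by (simp only: integral_mult_right_zero)
      also have "norm \<dots> \<le> (1 * norm ?e * 1) * (C * (1 + norm x) ^ m * ?P \<xi>)"
        unfolding norm_mult[of "cutoff \<epsilon> \<xi> * ?e * exp (\<i> * of_real (x \<bullet> \<xi>))"] norm_mult[of "cutoff \<epsilon> \<xi> * ?e"] norm_mult[of "cutoff \<epsilon> \<xi>"]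
        by (intro mult_mono norm_cutoff_le C(2)[OF s] order.refl) auto
      finally show ?thesis by simp
    qed
    have P: "integrable lborel (\<lambda>\<xi>. norm ?e * (C * (1 + norm x) ^ m * ?P \<xi>))"
      by (intro integrable_mult_right integrable_inverse_prod)
    have Gm: "G \<in> borel_measurable borel" unfolding G_def by measurable
    have Gi: "integrable lborel G"
      by (rule Bochner_Integration.integrable_bound[OF P]) (use Gm order_trans[OF G abs_ge_self] in auto)
    have "norm (regularized_osc b p q \<epsilon> x) = norm (\<integral>\<xi>. G \<xi> \<partial>lborel)" unfolding regularized_osc_iterated[OF e(1)] G_def ..
    also have "\<dots> \<le> (\<integral>\<xi>. norm (G \<xi>) \<partial>lborel)" by (rule integral_norm_bound)
    also have "\<dots> \<le> (\<integral>\<xi>. norm ?e * (C * (1 + norm x) ^ m * ?P \<xi>) \<partial>lborel)"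
      by (rule Bochner_Integration.integral_mono[OF integrable_norm[OF Gi] P G])
    also have "\<dots> = norm ?e * C * I * (1 + norm x) ^ m"
      unfolding I_def by (simp only: integral_mult_right_zero mult_ac)
    finally show "norm (regularized_osc b p q \<epsilon> x) \<le> norm ?e * C * I * (1 + norm x) ^ m" .
  qed (use C(1) I0 in simp)
qed

end

lemma integrable_prod_mult:
  fixes f :: "'a::euclidean_space \<Rightarrow> real" and g :: "'b::euclidean_space \<Rightarrow> real"
  assumes f: "integrable lborel f" and g: "integrable lborel g" and "\<And>x. 0 \<le> f x" "\<And>x. 0 \<le> g x"
  shows "integrable lborel (\<lambda>(x, y). f x * g y)"
proof (rule fubini_product_bound(1)[OF _ _ f g])
  show "(\<lambda>z. f (fst z) * g (snd z)) \<in> borel_measurable borel"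
  proof (intro borel_measurable_times)
    show "(\<lambda>z::'a \<times> 'b. f (fst z)) \<in> borel_measurable borel"
      using borel_measurable_integrable[OF f] by (intro measurable_compose[of fst borel borel f]) (measurable, simp)
    show "(\<lambda>z::'a \<times> 'b. g (snd z)) \<in> borel_measurable borel"
      using borel_measurable_integrable[OF g] by (intro measurable_compose[of snd borel borel g]) (measurable, simp)
  qed
qed (use assms in simp)

text \<open>
  The regularized cross-Wigner function of the two test Gaussians times \<open>b\<close>, obtained by substituting
  \<open>x = 2 z - y\<close> and integrating over \<open>y\<close>.
\<close>

definition wigner :: "('a::euclidean_space \<times> 'a \<Rightarrow> complex) \<Rightarrow> 'a \<Rightarrow> 'a \<Rightarrow> real \<Rightarrow> 'a \<Rightarrow> 'a \<Rightarrow> complex" where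
  "wigner b p q \<epsilon> z \<xi> = b (z, \<xi>) * (exp (- (csq p q / 4)) * of_real (sqrt (pi / (1 + \<epsilon>\<^sup>2)) ^ DIM('a))) *
     exp (Complex (- 2 * (p \<bullet> z) - 2 * (z \<bullet> z) - \<epsilon>\<^sup>2 * (\<xi> \<bullet> \<xi>) + ((p + z) \<bullet> (p + z) - \<xi> \<bullet> \<xi>) / (1 + \<epsilon>\<^sup>2))
        (2 * (q \<bullet> z) + 2 * (z \<bullet> \<xi>) - 2 * ((p + z) \<bullet> \<xi>) / (1 + \<epsilon>\<^sup>2)))"

text \<open>With the midpoint z fixed, b is constant in y and all other factors are Gaussian. Their
  product has width 1 + \<epsilon>^2, real linear term 2 (p + z) and frequency - 2 \<xi>.\<close>

lemma wigner_integral: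
  "(\<integral>y. gexp (1/2) (- p) q (- y + 2 *\<^sub>R z) * (cutoff \<epsilon> y * cutoff \<epsilon> \<xi> * osc_amp b (mehler 1 p q) (- y + 2 *\<^sub>R z) y \<xi>) \<partial>lborel)
     = wigner b p q \<epsilon> z \<xi>"
proof -
  define e1 where "e1 = exp (- (csq p q / 4))"
  define s where "s = 1 + \<epsilon>\<^sup>2"
  have s: "s > 0" by (simp add: s_def add_pos_nonneg)
  define c where "c = exp (Complex (- 2 * (p \<bullet> z) - 2 * (z \<bullet> z) - \<epsilon>\<^sup>2 * (\<xi> \<bullet> \<xi>)) (2 * (q \<bullet> z) + 2 * (z \<bullet> \<xi>)))"
  have eq: "gexp (1/2) (- p) q (- y + 2 *\<^sub>R z) * (cutoff \<epsilon> y * cutoff \<epsilon> \<xi> * osc_amp b (mehler 1 p q) (- y + 2 *\<^sub>R z) y \<xi>)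
     = (b (z, \<xi>) * e1 * c) * gexp s (2 *\<^sub>R (p + z)) (- 2 *\<^sub>R \<xi>) y" for y
  proof -
    have "gexp (1/2) (- p) q (- y + 2 *\<^sub>R z) * (cutoff \<epsilon> y * cutoff \<epsilon> \<xi> * (exp (\<i> * of_real ((- y + 2 *\<^sub>R z - y) \<bullet> \<xi>)) * gexp (1/2) p q y))
      = c * gexp s (2 *\<^sub>R (p + z)) (- 2 *\<^sub>R \<xi>) y"
      unfolding gexp_def cutoff_def c_def exp_of_real[symmetric] exp_add[symmetric] s_def
      by (rule arg_cong[where f=exp])
         (simp add: complex_eq_iff inner_diff_left inner_diff_right inner_add_left inner_add_right inner_commute field_simps)
    moreover have "(1/2) *\<^sub>R (- y + 2 *\<^sub>R z + y) = z" by simp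
    ultimately show ?thesis
      unfolding osc_amp_def mehler_1 e1_def[symmetric] by (simp add: mult_ac)
  qed
  have "(\<integral>y. gexp (1/2) (- p) q (- y + 2 *\<^sub>R z) * (cutoff \<epsilon> y * cutoff \<epsilon> \<xi> * osc_amp b (mehler 1 p q) (- y + 2 *\<^sub>R z) y \<xi>) \<partial>lborel)
     = (b (z, \<xi>) * e1 * c) * (of_real (sqrt (pi / s) ^ DIM('a)) *
        exp (Complex ((2 *\<^sub>R (p + z) \<bullet> 2 *\<^sub>R (p + z) - (- 2 *\<^sub>R \<xi>) \<bullet> (- 2 *\<^sub>R \<xi>)) / (4 * s)) ((2 *\<^sub>R (p + z) \<bullet> (- 2 *\<^sub>R \<xi>)) / (2 * s))))"
    unfolding eq by (simp only: integral_mult_right_zero gauss_integral(2)[OF s])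
  also have "\<dots> = b (z, \<xi>) * (e1 * of_real (sqrt (pi / s) ^ DIM('a))) *
     (c * exp (Complex (((p + z) \<bullet> (p + z) - \<xi> \<bullet> \<xi>) / s) (- 2 * ((p + z) \<bullet> \<xi>) / s)))"
    using s by (simp add: mult_ac inner_diff_left diff_divide_distrib)
  also have "c * exp (Complex (((p + z) \<bullet> (p + z) - \<xi> \<bullet> \<xi>) / s) (- 2 * ((p + z) \<bullet> \<xi>) / s))
    = exp (Complex (- 2 * (p \<bullet> z) - 2 * (z \<bullet> z) - \<epsilon>\<^sup>2 * (\<xi> \<bullet> \<xi>) + ((p + z) \<bullet> (p + z) - \<xi> \<bullet> \<xi>) / s)
        (2 * (q \<bullet> z) + 2 * (z \<bullet> \<xi>) - 2 * ((p + z) \<bullet> \<xi>) / s))"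
    unfolding c_def exp_add[symmetric] by (rule arg_cong[where f=exp]) (simp add: complex_eq_iff)
  finally show ?thesis unfolding wigner_def e1_def s_def .
qed

context
  fixes b :: "'a::euclidean_space \<times> 'a \<Rightarrow> complex"
  assumes b: "amplitude b"
begin

lemma [measurable]: "b \<in> borel_measurable borel"
  by (rule b_measurable[OF b])

text \<open>The worst case of the real exponent is |p|^2 - |z|^2 - |\<xi>|^2 / 2, as the width s = 1
  + \<epsilon>^2 lies between 1 and 2. Uniformity down to \<epsilon> = 0 provides the majorant for
  the limit.\<close>

lemma wigner_le:
  "\<exists>C\<ge>0. \<exists>m. \<forall>\<epsilon>. 0 \<le> \<epsilon> \<longrightarrow> \<epsilon> \<le> 1 \<longrightarrow> (\<forall>z \<xi>. norm (wigner b p q \<epsilon> z \<xi>)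
     \<le> (C * ((1 + norm z) ^ m * gauss_bd 0 1 z)) * ((1 + norm \<xi>) ^ m * gauss_bd 0 (1/2) \<xi>))"
proof -
  obtain C m where C: "C \<ge> 0" "\<And>x \<xi>. norm (b (x, \<xi>)) \<le> C * (1 + norm x) ^ m * (1 + norm \<xi>) ^ m"
    using amplitude_growth[OF b] by blast
  let ?e1 = "exp (- (csq p q / 4))"
  define B where "B = norm ?e1 * sqrt pi ^ DIM('a)"
  show ?thesis
  proof (intro exI[of _ "C * B * exp (p \<bullet> p)"] exI[of _ m] conjI allI impI)
    show "C * B * exp (p \<bullet> p) \<ge> 0" using C(1) by (simp add: B_def)
    fix \<epsilon> :: real and z \<xi> :: 'a assume e: "0 \<le> \<epsilon>" "\<epsilon> \<le> 1"
    define s where "s = 1 + \<epsilon>\<^sup>2"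
    have s: "1 \<le> s" "s \<le> 2" using e by (auto simp: s_def power_le_one)
    have "sqrt (pi / s) \<le> sqrt pi" using s by (simp add: divide_le_eq)
    hence "sqrt (pi / s) ^ DIM('a) \<le> sqrt pi ^ DIM('a)" using s by (intro power_mono) auto
    hence c1: "norm (?e1 * of_real (sqrt (pi / s) ^ DIM('a))) \<le> B"
      unfolding B_def norm_mult norm_of_real using s by (intro mult_left_mono) auto
    have "((p + z) \<bullet> (p + z)) / s \<le> (p + z) \<bullet> (p + z)" using divide_left_mono[of 1 s "(p + z) \<bullet> (p + z)"] s by simp
    moreover have "\<xi> \<bullet> \<xi> / s \<ge> (\<xi> \<bullet> \<xi>) / 2" using s by (intro divide_left_mono) auto
    moreover have "\<epsilon>\<^sup>2 * (\<xi> \<bullet> \<xi>) \<ge> 0" by simp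
    ultimately have re: "- 2 * (p \<bullet> z) - 2 * (z \<bullet> z) - \<epsilon>\<^sup>2 * (\<xi> \<bullet> \<xi>) + ((p + z) \<bullet> (p + z) - \<xi> \<bullet> \<xi>) / s
      \<le> p \<bullet> p + (0 * norm z - 1 * (norm z)\<^sup>2) + (0 * norm \<xi> - 1/2 * (norm \<xi>)\<^sup>2)"
    proof -
      assume "((p + z) \<bullet> (p + z)) / s \<le> (p + z) \<bullet> (p + z)" "(\<xi> \<bullet> \<xi>) / 2 \<le> \<xi> \<bullet> \<xi> / s" "0 \<le> \<epsilon>\<^sup>2 * (\<xi> \<bullet> \<xi>)"
      moreover have "(p + z) \<bullet> (p + z) = p \<bullet> p + 2 * (p \<bullet> z) + z \<bullet> z"
        by (simp add: inner_add_left inner_add_right inner_commute)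
      ultimately show ?thesis unfolding diff_divide_distrib power2_norm_eq_inner by linarith
    qed
    have "norm (wigner b p q \<epsilon> z \<xi>) \<le> (C * (1 + norm z) ^ m * (1 + norm \<xi>) ^ m) * B *
        exp (p \<bullet> p + (0 * norm z - 1 * (norm z)\<^sup>2) + (0 * norm \<xi> - 1/2 * (norm \<xi>)\<^sup>2))"
      unfolding wigner_def s_def[symmetric] norm_mult[of "_ * _" "exp _"] norm_mult[of "b (z, \<xi>)"] norm_exp_eq_Re complex.sel
      using re C by (intro mult_mono c1) (auto simp: B_def)
    thus "norm (wigner b p q \<epsilon> z \<xi>)
     \<le> (C * B * exp (p \<bullet> p) * ((1 + norm z) ^ m * gauss_bd 0 1 z)) * ((1 + norm \<xi>) ^ m * gauss_bd 0 (1/2) \<xi>)"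
      by (simp only: exp_add mult_ac)
  qed
qed

lemma wigner_measurable [measurable]:
  assumes [measurable]: "f \<in> borel_measurable M" "g \<in> borel_measurable M"
  shows "(\<lambda>x. wigner b p q \<epsilon> (f x) (g x)) \<in> borel_measurable M"
  unfolding wigner_def Complex_eq by measurable

lemma wigner_iterated:
  assumes e: "0 < \<epsilon>" "\<epsilon> \<le> 1"
  shows "integrable lborel (\<lambda>(z, \<xi>). wigner b p q \<epsilon> z \<xi>)"
    and "(\<integral>w. (case w of (z, \<xi>) \<Rightarrow> wigner b p q \<epsilon> z \<xi>) \<partial>lborel) = (\<integral>z. (\<integral>\<xi>. wigner b p q \<epsilon> z \<xi> \<partial>lborel) \<partial>lborel)"
proof -
  obtain C m where C: "C \<ge> 0" "\<And>z \<xi>. norm (wigner b p q \<epsilon> z \<xi>)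
     \<le> (C * ((1 + norm z) ^ m * gauss_bd 0 1 z)) * ((1 + norm \<xi>) ^ m * gauss_bd 0 (1/2) \<xi>)"
    using wigner_le e by (meson less_imp_le)
  have m: "(\<lambda>w. wigner b p q \<epsilon> (fst w) (snd w)) \<in> borel_measurable borel" by measurable
  have i1: "integrable lborel (\<lambda>z::'a. C * ((1 + norm z) ^ m * gauss_bd 0 1 z))"
    by (intro integrable_mult_right integrable_exp_norm) simp
  have i2: "integrable lborel (\<lambda>\<xi>::'a. (1 + norm \<xi>) ^ m * gauss_bd 0 (1/2) \<xi>)"
    by (intro integrable_exp_norm) simp
  show "integrable lborel (\<lambda>(z, \<xi>). wigner b p q \<epsilon> z \<xi>)"
    and "(\<integral>w. (case w of (z, \<xi>) \<Rightarrow> wigner b p q \<epsilon> z \<xi>) \<partial>lborel) = (\<integral>z. (\<integral>\<xi>. wigner b p q \<epsilon> z \<xi> \<partial>lborel) \<partial>lborel)"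
    by (rule fubini_product_bound[OF m C(2) i1 i2])+
qed

text \<open>All exchanges of integrals take place while \<epsilon> > 0, because the majorants used
  are integrable in \<xi> thanks to the cut-off.\<close>

lemma pairing_reg:
  assumes e: "0 < \<epsilon>" "\<epsilon> \<le> 1"
  shows "(\<integral>x. gexp (1/2) (- p) q x * regularized_osc b p q \<epsilon> x \<partial>lborel)
    = 2 ^ DIM('a) * (\<integral>w. (case w of (z, \<xi>) \<Rightarrow> wigner b p q \<epsilon> z \<xi>) \<partial>lborel)"
proof -
  define T where "T = (\<lambda>x y \<xi>. gexp (1/2) (- p) q x * (cutoff \<epsilon> y * cutoff \<epsilon> \<xi> * osc_amp b (mehler 1 p q) x y \<xi>))"
  have T_meas [measurable]: "(\<lambda>z. T (f z) (g z) (k z)) \<in> borel_measurable M"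
    if [measurable]: "f \<in> borel_measurable M" "g \<in> borel_measurable M" "k \<in> borel_measurable M" for f g k and M :: "'s measure"
    unfolding T_def by measurable
  obtain C m where C: "C \<ge> 0" "\<And>x y \<xi>. norm (osc_amp b (mehler 1 p q) x y \<xi>)
     \<le> C * (1 + norm x) ^ m * (1 + norm \<xi>) ^ m * ((1 + norm y) ^ m * gauss_bd (norm p) (1/2) y)"
    using osc_amp_le[OF b] by blast
  have ci: "integrable lborel (\<lambda>\<xi>::'a. (1 + norm \<xi>) ^ m * norm (cutoff \<epsilon> \<xi>))" for m
    using e by (intro cutoff_integrable_poly)
  have "(\<integral>x. gexp (1/2) (- p) q x * regularized_osc b p q \<epsilon> x \<partial>lborel) = (\<integral>x. (\<integral>w. T x (fst w) (snd w) \<partial>lborel) \<partial>lborel)"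
  proof (rule Bochner_Integration.integral_cong[OF refl])
    fix x
    have cg: "gexp 1 0 0 (\<epsilon> *\<^sub>R w) = cutoff \<epsilon> (fst w) * cutoff \<epsilon> (snd w)" for w :: "'a \<times> 'a"
      using cutoff_gexp[of \<epsilon> "fst w" "snd w"] by (simp only: prod.collapse)
    have "regularized_osc b p q \<epsilon> x = (\<integral>w. cutoff \<epsilon> (fst w) * cutoff \<epsilon> (snd w) * osc_amp b (mehler 1 p q) x (fst w) (snd w) \<partial>lborel)"
      unfolding regularized_osc_def case_prod_beta cg ..
    thus "gexp (1/2) (- p) q x * regularized_osc b p q \<epsilon> x = (\<integral>w. T x (fst w) (snd w) \<partial>lborel)"
      unfolding T_def by (simp only: integral_mult_right_zero)
  qed
  also have "\<dots> = (\<integral>w. (\<integral>x. T x (fst w) (snd w) \<partial>lborel) \<partial>lborel)"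
  proof -
    define f where "f = (\<lambda>x::'a. C * ((1 + norm x) ^ m * gauss_bd (norm (-p)) (1/2) x))"
    define g where "g = (\<lambda>(y::'a, \<xi>::'a). ((1 + norm y) ^ m * gauss_bd (norm p) (1/2) y) * ((1 + norm \<xi>) ^ m * norm (cutoff \<epsilon> \<xi>)))"
    have meas: "(\<lambda>z. T (fst z) (fst (snd z)) (snd (snd z))) \<in> borel_measurable borel" by measurable
    have le: "norm (T x (fst w) (snd w)) \<le> f x * g w" for x w
    proof -
      obtain y \<xi> where w: "w = (y, \<xi>)" by (cases w)
      have "norm (T x y \<xi>) \<le> gauss_bd (norm (-p)) (1/2) x * (1 * norm (cutoff \<epsilon> \<xi>) *
          (C * (1 + norm x) ^ m * (1 + norm \<xi>) ^ m * ((1 + norm y) ^ m * gauss_bd (norm p) (1/2) y)))"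
        unfolding T_def norm_mult by (intro mult_mono norm_gexp_le norm_cutoff_le C(2) order.refl) auto
      thus ?thesis unfolding w f_def g_def by (simp add: mult_ac)
    qed
    have f: "integrable lborel f" unfolding f_def by (intro integrable_mult_right integrable_exp_norm) simp
    have g: "integrable lborel g" unfolding g_def
      by (intro integrable_prod_mult ci integrable_exp_norm) auto
    show ?thesis using fubini_product_bound(2,3)[OF meas le f g] by simp
  qed
  also have "\<dots> = (\<integral>w. 2 ^ DIM('a) * (\<integral>z. T (- fst w + 2 *\<^sub>R z) (fst w) (snd w) \<partial>lborel) \<partial>lborel)"
    by (rule Bochner_Integration.integral_cong[OF refl], subst lborel_integral_affine[where c=2 and t="- fst _"])
       (auto simp: scaleR_conv_of_real)
  also have "\<dots> = 2 ^ DIM('a) * (\<integral>w. (\<integral>z. T (- fst w + 2 *\<^sub>R z) (fst w) (snd w) \<partial>lborel) \<partial>lborel)"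
    by (rule integral_mult_right_zero)
  also have "(\<integral>w. (\<integral>z. T (- fst w + 2 *\<^sub>R z) (fst w) (snd w) \<partial>lborel) \<partial>lborel)
    = (\<integral>w. (case w of (z, \<xi>) \<Rightarrow> wigner b p q \<epsilon> z \<xi>) \<partial>lborel)"
  proof -
    obtain C m where C: "C \<ge> 0" "\<And>x \<xi>. norm (b (x, \<xi>)) \<le> C * (1 + norm x) ^ m * (1 + norm \<xi>) ^ m"
      using amplitude_growth[OF b] by blast
    let ?E = "exp ((norm q)\<^sup>2/4)"
    define f where "f = (\<lambda>z::'a. C * ?E * ((1 + norm z) ^ m * gauss_bd (2 * norm p) (1/2) z))"
    define g1 where "g1 = (\<lambda>y::'a. (1 + norm y) ^ 0 * gauss_bd (2 * norm p) (1/3) y)"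
    define g2 where "g2 = (\<lambda>\<xi>::'a. (1 + norm \<xi>) ^ m * norm (cutoff \<epsilon> \<xi>))"
    have f: "integrable lborel f" unfolding f_def by (intro integrable_mult_right integrable_exp_norm) simp
    have g1: "integrable lborel g1" unfolding g1_def by (intro integrable_exp_norm) simp
    have g2: "integrable lborel g2" unfolding g2_def by (rule ci)
    have nn: "f z \<ge> 0" "g1 y \<ge> 0" "g2 \<xi> \<ge> 0" for z y \<xi> using C(1) by (auto simp: f_def g1_def g2_def)
    have g: "integrable lborel (\<lambda>(y, \<xi>). g1 y * g2 \<xi>)" by (intro integrable_prod_mult g1 g2 nn)
    have le: "norm (T (- y + 2 *\<^sub>R z) y \<xi>) \<le> f z * (g1 y * g2 \<xi>)" for y z \<xi>
    proof -
      \<comment> \<open>The square of 3 z - 2 y distributes the mixed term so that a negative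
        multiple of |z|^2 and of |y|^2 survives; both are required for a product majorant in the
        variables z and y.\<close>
      have q2: "- 2 * (z \<bullet> z) + 2 * (z \<bullet> y) - y \<bullet> y \<le> - (1/2) * (z \<bullet> z) - (1/3) * (y \<bullet> y)"
      proof -
        have "0 \<le> ((3 *\<^sub>R z - 2 *\<^sub>R y) \<bullet> (3 *\<^sub>R z - 2 *\<^sub>R y)) / 6" by simp
        also have "\<dots> = (3/2) * (z \<bullet> z) - 2 * (z \<bullet> y) + (2/3) * (y \<bullet> y)"
          by (simp add: inner_diff_left inner_diff_right inner_commute field_simps)
        finally show ?thesis by simp
      qed
      have "- (p \<bullet> z) \<le> norm p * norm z" "p \<bullet> y \<le> norm p * norm y"
        using norm_cauchy_schwarz[of "-p" z] norm_cauchy_schwarz[of p y] by auto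
      hence "(- p) \<bullet> (- y + 2 *\<^sub>R z) - 1/2 * ((- y + 2 *\<^sub>R z) \<bullet> (- y + 2 *\<^sub>R z)) + (norm p * norm y - 1/2 * (norm y)\<^sup>2)
         \<le> (2 * norm p * norm z - 1/2 * (norm z)\<^sup>2) + (2 * norm p * norm y - 1/3 * (norm y)\<^sup>2)"
        using q2 by (simp add: power2_norm_eq_inner inner_diff_left inner_diff_right inner_commute algebra_simps)
      hence "norm (gexp (1/2) (- p) q (- y + 2 *\<^sub>R z)) * gauss_bd (norm p) (1/2) y
        \<le> gauss_bd (2 * norm p) (1/2) z * gauss_bd (2 * norm p) (1/3) y"
        unfolding norm_gexp exp_add[symmetric] by simp
      moreover have "norm (mehler 1 p q y) \<le> ?E * gauss_bd (norm p) (1/2) y" by (rule norm_mehler_le) auto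
      ultimately have 1: "norm (gexp (1/2) (- p) q (- y + 2 *\<^sub>R z)) * norm (mehler 1 p q y)
         \<le> ?E * (gauss_bd (2 * norm p) (1/2) z * gauss_bd (2 * norm p) (1/3) y)"
        by (smt (verit, ccfv_SIG) exp_ge_zero mult.left_commute mult_left_mono norm_ge_zero)
      have "norm (T (- y + 2 *\<^sub>R z) y \<xi>) = norm (cutoff \<epsilon> y) * norm (cutoff \<epsilon> \<xi>) * norm (b (z, \<xi>)) *
         (norm (gexp (1/2) (- p) q (- y + 2 *\<^sub>R z)) * norm (mehler 1 p q y))"
        by (simp add: T_def osc_amp_def norm_mult mult_ac)
      also have "\<dots> \<le> 1 * norm (cutoff \<epsilon> \<xi>) * (C * (1 + norm z) ^ m * (1 + norm \<xi>) ^ m) *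
         (?E * (gauss_bd (2 * norm p) (1/2) z * gauss_bd (2 * norm p) (1/3) y))"
        using C(1) by (intro mult_mono norm_cutoff_le C(2) 1 order.refl) auto
      also have "\<dots> = f z * (g1 y * g2 \<xi>)" by (simp add: f_def g1_def g2_def mult_ac)
      finally show ?thesis .
    qed
    have le': "norm (T (- fst w + 2 *\<^sub>R z) (fst w) (snd w)) \<le> f z * (case w of (y, \<xi>) \<Rightarrow> g1 y * g2 \<xi>)" for z w
      using le by (cases w) simp
    have meas: "(\<lambda>u. T (- fst (snd u) + 2 *\<^sub>R fst u) (fst (snd u)) (snd (snd u))) \<in> borel_measurable borel" by measurable
    have "(\<integral>w. (\<integral>z. T (- fst w + 2 *\<^sub>R z) (fst w) (snd w) \<partial>lborel) \<partial>lborel) = (\<integral>z. (\<integral>w. T (- fst w + 2 *\<^sub>R z) (fst w) (snd w) \<partial>lborel) \<partial>lborel)"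
      using fubini_product_bound(2,3)[OF meas le' f g] by simp
    also have "\<dots> = (\<integral>z. (\<integral>\<xi>. wigner b p q \<epsilon> z \<xi> \<partial>lborel) \<partial>lborel)"
    proof (rule Bochner_Integration.integral_cong[OF refl])
      fix z
      \<comment> \<open>For fixed z the integral over (y, \<xi>) is now iterated with y inside,
        which is the order evaluated by \<open>wigner_integral\<close>.\<close>
      have m2: "(\<lambda>w. T (- fst w + 2 *\<^sub>R z) (fst w) (snd w)) \<in> borel_measurable borel" by measurable
      have le2: "norm (T (- y + 2 *\<^sub>R z) y \<xi>) \<le> (f z * g1 y) * g2 \<xi>" for y \<xi> using le by (simp add: mult.assoc)
      have "(\<integral>w. T (- fst w + 2 *\<^sub>R z) (fst w) (snd w) \<partial>lborel) = (\<integral>\<xi>. (\<integral>y. T (- y + 2 *\<^sub>R z) y \<xi> \<partial>lborel) \<partial>lborel)"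
        using fubini_product_bound(3)[OF m2 le2 integrable_mult_right[OF g1] g2] by (simp add: case_prod_beta)
      also have "\<dots> = (\<integral>\<xi>. wigner b p q \<epsilon> z \<xi> \<partial>lborel)"
        unfolding T_def wigner_integral ..
      finally show "(\<integral>w. T (- fst w + 2 *\<^sub>R z) (fst w) (snd w) \<partial>lborel) = (\<integral>\<xi>. wigner b p q \<epsilon> z \<xi> \<partial>lborel)" .
    qed
    also have "\<dots> = (\<integral>w. (case w of (z, \<xi>) \<Rightarrow> wigner b p q \<epsilon> z \<xi>) \<partial>lborel)" by (rule wigner_iterated(2)[OF e, symmetric])
    finally show ?thesis .
  qed
  finally show ?thesis .
qed

text \<open>The sign of p in the second Gaussian is chosen for this: the real linear terms - 2 p.z
  and 2 p.z cancel, and so do the mixed terms z.\<xi>. What is left is the standard Gaussian on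
  phase space with frequency (2 q, - 2 p).\<close>

lemma wigner_0: "wigner b p q 0 z \<xi> = (exp (- (csq p q / 4)) * of_real (sqrt pi ^ DIM('a) * exp (p \<bullet> p))) * (b (z, \<xi>) * gexp 1 0 (2 *\<^sub>R q, - 2 *\<^sub>R p) (z, \<xi>))"
proof -
  have "exp (Complex (- 2 * (p \<bullet> z) - 2 * (z \<bullet> z) + ((p + z) \<bullet> (p + z) - \<xi> \<bullet> \<xi>)) (2 * (q \<bullet> z) + 2 * (z \<bullet> \<xi>) - 2 * ((p + z) \<bullet> \<xi>)))
     = of_real (exp (p \<bullet> p)) * gexp 1 0 (2 *\<^sub>R q, - 2 *\<^sub>R p) (z, \<xi>)"
    unfolding gexp_def exp_of_real[symmetric] exp_add[symmetric]
    by (rule arg_cong[where f=exp]) (simp add: complex_eq_iff inner_add_left inner_add_right inner_commute)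
  thus ?thesis by (simp add: wigner_def mult_ac)
qed

text \<open>Dominated convergence on both sides of \<open>pairing_reg\<close>. In x the polynomial
  bound is integrable against the second Gaussian; on phase space the bound of
  \<open>wigner_le\<close> is Gaussian in both variables.\<close>

lemma pairing_limit:
  assumes H: "AE x in lborel. has_oscillatory_integral (\<lambda>(y, \<xi>). osc_amp b (mehler 1 p q) x y \<xi>) (of_real ((2 * pi) ^ DIM('a)) * mehler_solution p q x)"
  shows "of_real ((2 * pi) ^ DIM('a)) * (\<integral>x. gexp (1/2) (- p) q x * mehler_solution p q x \<partial>lborel)
    = 2 ^ DIM('a) * ((exp (- (csq p q / 4)) * of_real (sqrt pi ^ DIM('a) * exp (p \<bullet> p))) * (\<integral>X. b X * gexp 1 0 (2 *\<^sub>R q, - 2 *\<^sub>R p) X \<partial>lborel))"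
proof -
  \<comment> \<open>A sequence tending to 0 from the right, since dominated convergence is applied
    along sequences.\<close>
  define \<epsilon> where "\<epsilon> = (\<lambda>n. inverse (real (Suc n)))"
  have e: "0 < \<epsilon> n" "\<epsilon> n \<le> 1" for n by (auto simp: \<epsilon>_def inverse_le_1_iff)
  have e0: "\<epsilon> \<longlonglongrightarrow> 0" unfolding \<epsilon>_def by (rule LIMSEQ_inverse_real_of_nat)
  have er: "filterlim \<epsilon> (at_right 0) sequentially"
    using e0 e(1) by (intro tendsto_imp_filterlim_at_right) auto
  let ?h = "gexp (1/2) (- p) q" and ?I = "\<lambda>x. of_real ((2 * pi) ^ DIM('a)) * mehler_solution p q x"
  obtain C m where C: "C \<ge> 0" "\<And>n x. norm (regularized_osc b p q (\<epsilon> n) x) \<le> C * (1 + norm x) ^ m"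
    using regularized_osc_le[OF b] e by metis
  have [measurable]: "regularized_osc b p q \<epsilon> \<in> borel_measurable borel" for \<epsilon> by (rule regularized_osc_measurable[OF b])
  have lim1: "(\<lambda>n. \<integral>x. ?h x * regularized_osc b p q (\<epsilon> n) x \<partial>lborel) \<longlonglongrightarrow> (\<integral>x. ?h x * ?I x \<partial>lborel)"
  proof (rule integral_dominated_convergence)
    show "integrable lborel (\<lambda>x. C * ((1 + norm x) ^ m * gauss_bd (norm (-p)) (1/2) x))"
      by (intro integrable_mult_right integrable_exp_norm) simp
    show "AE x in lborel. norm (?h x * regularized_osc b p q (\<epsilon> n) x) \<le> C * ((1 + norm x) ^ m * gauss_bd (norm (-p)) (1/2) x)" for n
    proof (rule AE_I2)
      fix x
      have "norm (?h x * regularized_osc b p q (\<epsilon> n) x) \<le> gauss_bd (norm (-p)) (1/2) x * (C * (1 + norm x) ^ m)"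
        unfolding norm_mult by (intro mult_mono norm_gexp_le C(2) order.refl) auto
      thus "norm (?h x * regularized_osc b p q (\<epsilon> n) x) \<le> C * ((1 + norm x) ^ m * gauss_bd (norm (-p)) (1/2) x)"
        by (simp only: mult_ac)
    qed
    show "AE x in lborel. (\<lambda>n. ?h x * regularized_osc b p q (\<epsilon> n) x) \<longlonglongrightarrow> ?h x * ?I x"
      using H
    proof eventually_elim
      case (elim x)
      have g0: "schwartz (gexp 1 0 0 :: 'a \<times> 'a \<Rightarrow> complex)" "gexp 1 0 0 (0 :: 'a \<times> 'a) = 1"
        using schwartz_gexp[of 1 1 0 "0 :: 'a \<times> 'a"] by (simp_all only: mult_1, simp add: gexp_def Complex_eq)
      have "((\<lambda>\<epsilon>. regularized_osc b p q \<epsilon> x) \<longlongrightarrow> ?I x) (at_right 0)"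
        using elim g0 unfolding has_oscillatory_integral_def regularized_osc_def by blast
      from filterlim_compose[OF this er] show ?case by (intro tendsto_mult tendsto_const)
    qed
  qed measurable
  obtain C' m' where C': "C' \<ge> 0" "\<And>n z \<xi>. norm (wigner b p q (\<epsilon> n) z \<xi>)
     \<le> (C' * ((1 + norm z) ^ m' * gauss_bd 0 1 z)) * ((1 + norm \<xi>) ^ m' * gauss_bd 0 (1/2) \<xi>)"
    using wigner_le e by (metis less_imp_le)
  have lim2: "(\<lambda>n. \<integral>w. (case w of (z, \<xi>) \<Rightarrow> wigner b p q (\<epsilon> n) z \<xi>) \<partial>lborel) \<longlonglongrightarrow> (\<integral>w. (case w of (z, \<xi>) \<Rightarrow> wigner b p q 0 z \<xi>) \<partial>lborel)"
  proof (rule integral_dominated_convergence)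
    show "integrable lborel (\<lambda>(z::'a, \<xi>::'a). (C' * ((1 + norm z) ^ m' * gauss_bd 0 1 z)) * ((1 + norm \<xi>) ^ m' * gauss_bd 0 (1/2) \<xi>))"
      using C'(1) by (intro integrable_prod_mult integrable_mult_right integrable_exp_norm) auto
    show "AE w in lborel. norm (case w of (z, \<xi>) \<Rightarrow> wigner b p q (\<epsilon> n) z \<xi>) \<le>
       (case w of (z, \<xi>) \<Rightarrow> (C' * ((1 + norm z) ^ m' * gauss_bd 0 1 z)) * ((1 + norm \<xi>) ^ m' * gauss_bd 0 (1/2) \<xi>))" for n
      using C'(2) by (intro AE_I2) (simp only: case_prod_beta)
    show "AE w in lborel. (\<lambda>n. case w of (z, \<xi>) \<Rightarrow> wigner b p q (\<epsilon> n) z \<xi>) \<longlonglongrightarrow> (case w of (z, \<xi>) \<Rightarrow> wigner b p q 0 z \<xi>)"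
    proof (rule AE_I2)
      fix w :: "'a \<times> 'a"
      have "1 + r\<^sup>2 \<noteq> 0" for r :: real by (metis add_pos_nonneg less_numeral_extra(1) less_irrefl zero_le_power2)
      hence "continuous_on UNIV (\<lambda>\<epsilon>. wigner b p q \<epsilon> (fst w) (snd w))"
        unfolding wigner_def Complex_eq by (intro continuous_intros) auto
      hence "isCont (\<lambda>\<epsilon>. wigner b p q \<epsilon> (fst w) (snd w)) 0" by (simp add: continuous_on_eq_continuous_at)
      from isCont_tendsto_compose[OF this e0]
      show "(\<lambda>n. case w of (z, \<xi>) \<Rightarrow> wigner b p q (\<epsilon> n) z \<xi>) \<longlonglongrightarrow> (case w of (z, \<xi>) \<Rightarrow> wigner b p q 0 z \<xi>)"
        by (simp add: case_prod_beta)
    qed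
  qed (simp_all add: case_prod_beta, measurable)
  have "(\<lambda>n. \<integral>x. ?h x * regularized_osc b p q (\<epsilon> n) x \<partial>lborel) \<longlonglongrightarrow> 2 ^ DIM('a) * (\<integral>w. (case w of (z, \<xi>) \<Rightarrow> wigner b p q 0 z \<xi>) \<partial>lborel)"
    unfolding pairing_reg[OF e] by (intro tendsto_mult tendsto_const lim2)
  from LIMSEQ_unique[OF lim1 this]
  have "(\<integral>x. ?h x * ?I x \<partial>lborel) = 2 ^ DIM('a) * (\<integral>w. (case w of (z, \<xi>) \<Rightarrow> wigner b p q 0 z \<xi>) \<partial>lborel)" .
  moreover have "(\<integral>x. ?h x * ?I x \<partial>lborel) = of_real ((2 * pi) ^ DIM('a)) * (\<integral>x. ?h x * mehler_solution p q x \<partial>lborel)"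
    by (subst integral_mult_right_zero[symmetric]) (simp only: mult_ac)
  moreover have "(\<integral>w. (case w of (z, \<xi>) \<Rightarrow> wigner b p q 0 z \<xi>) \<partial>lborel) =
      (exp (- (csq p q / 4)) * of_real (sqrt pi ^ DIM('a) * exp (p \<bullet> p))) * (\<integral>X. b X * gexp 1 0 (2 *\<^sub>R q, - 2 *\<^sub>R p) X \<partial>lborel)"
    unfolding wigner_0 by (subst integral_mult_right_zero[symmetric]) (simp only: case_prod_unfold prod.collapse)
  ultimately show ?thesis by simp
qed

end

section \<open>Identification of the symbol\<close>

lemma gexp_mult: "gexp s p q x * gexp s' p' q' x = gexp (s + s') (p + p') (q + q') x"
  unfolding gexp_def exp_add[symmetric]
  by (rule arg_cong[where f=exp]) (simp add: complex_eq_iff inner_add_left algebra_simps)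

text \<open>Integrating the vanishing transform against exp (- \<delta> |k|^2 - i x0.k) in k gives,
  by Fubini, the Gaussian average of v = D exp (- |x|^2) around x0. All these averages are zero;
  shrinking the width and using that v is bounded and continuous yields v x0 = 0.\<close>

lemma fourier_gauss_unique:
  fixes D :: "'a::euclidean_space \<Rightarrow> complex"
  assumes c: "continuous_on UNIV D" and D: "\<And>x. norm (D x) \<le> C * (1 + norm x) ^ m"
    and zero: "\<And>k. (\<integral>x. D x * gexp 1 0 k x \<partial>lborel) = 0"
  shows "D x0 = 0"
proof -
  have D_meas [measurable]: "D \<in> borel_measurable borel" using c by (rule borel_measurable_continuous_onI)
  have C0: "C \<ge> 0" using order_trans[OF norm_ge_zero D[of 0]] by simp
  define v where "v = (\<lambda>x. D x * gexp 1 0 0 x)"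
  obtain B where B: "B > 0" "\<And>x::real. x \<ge> 0 \<Longrightarrow> (1 + x) ^ m * exp (0 * x - 1 * x\<^sup>2) \<le> B * exp (- (1/2) * x\<^sup>2)"
    using poly_gauss_bound[of 1 m 0] by auto
  have vb: "norm (v x) \<le> C * B" for x
  proof -
    have "norm (v x) \<le> (C * (1 + norm x) ^ m) * gauss_bd 0 1 x"
      unfolding v_def norm_mult using C0 by (intro mult_mono D norm_gexp_le) auto
    also have "\<dots> = C * ((1 + norm x) ^ m * gauss_bd 0 1 x)" by (simp only: mult.assoc)
    also have "\<dots> \<le> C * (B * exp (- (1/2) * (norm x)\<^sup>2))" using C0 by (intro mult_left_mono B) auto
    also have "\<dots> \<le> C * (B * 1)" using C0 B(1) by (intro mult_left_mono) auto
    finally show ?thesis by simp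
  qed
  have v_meas [measurable]: "v \<in> borel_measurable borel" unfolding v_def by measurable
  have key: "(\<integral>y. v (x0 + r *\<^sub>R y) * of_real (exp (- (y \<bullet> y))) \<partial>lborel) = 0" if r: "r > 0" for r :: real
  proof -
    \<comment> \<open>Chosen so that after x = x0 + r y the averaging kernel is exp (- |y|^2),
      independent of r.\<close>
    define \<delta> where "\<delta> = r\<^sup>2 / 4"
    have \<delta>: "\<delta> > 0" using r by (simp add: \<delta>_def)
    let ?F = "\<lambda>x k. D x * gexp 1 0 k x * gexp \<delta> 0 (- x0) k"
    have meas: "(\<lambda>z. ?F (fst z) (snd z)) \<in> borel_measurable borel"
      by measurable
    have le: "norm (?F x k) \<le> (C * ((1 + norm x) ^ m * gauss_bd 0 1 x)) * ((1 + norm k) ^ 0 * gauss_bd 0 \<delta> k)" for x k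
    proof -
      have "norm (?F x k) \<le> (C * (1 + norm x) ^ m) * gauss_bd 0 1 x * gauss_bd 0 \<delta> k"
        unfolding norm_mult using C0 by (intro mult_mono D norm_gexp_le) auto
      thus ?thesis by (simp add: mult.assoc)
    qed
    have i1: "integrable lborel (\<lambda>x::'a. C * ((1 + norm x) ^ m * gauss_bd 0 1 x))"
      by (intro integrable_mult_right integrable_exp_norm) simp
    have i2: "integrable lborel (\<lambda>k::'a. (1 + norm k) ^ 0 * gauss_bd 0 \<delta> k)"
      by (intro integrable_exp_norm \<delta>)
    have "(\<integral>x. (\<integral>k. ?F x k \<partial>lborel) \<partial>lborel) = (\<integral>k. (\<integral>x. ?F x k \<partial>lborel) \<partial>lborel)"
      using fubini_product_bound(2,3)[OF meas le i1 i2] by simp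
    also have "\<dots> = 0" by (simp add: zero)
    also have "(\<lambda>x. \<integral>k. ?F x k \<partial>lborel) = (\<lambda>x. of_real (sqrt (pi/\<delta>) ^ DIM('a)) * (v x * of_real (exp (- ((x - x0) \<bullet> (x - x0)) / (4 * \<delta>)))))"
    proof
      fix x
      have "?F x k = v x * gexp \<delta> 0 (x - x0) k" for k
      proof -
        have "gexp 1 0 k x = gexp 1 0 0 x * gexp 0 0 x k"
          unfolding gexp_def exp_add[symmetric]
          by (rule arg_cong[where f=exp]) (simp add: complex_eq_iff inner_commute)
        moreover have "gexp 0 0 x k * gexp \<delta> 0 (- x0) k = gexp \<delta> 0 (x - x0) k" by (simp add: gexp_mult)
        ultimately show ?thesis by (simp add: v_def mult.assoc)
      qed
      hence "(\<integral>k. ?F x k \<partial>lborel) = v x * (\<integral>k. gexp \<delta> 0 (x - x0) k \<partial>lborel)"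
        by (simp only: integral_mult_right_zero)
      thus "(\<integral>k. ?F x k \<partial>lborel) = of_real (sqrt (pi/\<delta>) ^ DIM('a)) * (v x * of_real (exp (- ((x - x0) \<bullet> (x - x0)) / (4 * \<delta>))))"
        by (simp add: gauss_char(2)[OF \<delta>])
    qed
    finally have "of_real (sqrt (pi/\<delta>) ^ DIM('a)) * (\<integral>x. v x * of_real (exp (- ((x - x0) \<bullet> (x - x0)) / (4 * \<delta>))) \<partial>lborel) = 0"
      by (simp only: integral_mult_right_zero)
    hence "(\<integral>x. v x * of_real (exp (- ((x - x0) \<bullet> (x - x0)) / (4 * \<delta>))) \<partial>lborel) = 0"
      using \<delta> by simp
    hence "(\<integral>y. v (x0 + r *\<^sub>R y) * of_real (exp (- ((r *\<^sub>R y) \<bullet> (r *\<^sub>R y)) / (4 * \<delta>))) \<partial>lborel) = 0"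
      using r by (subst (asm) lborel_integral_affine[where c=r and t=x0]) auto
    moreover have "- ((r *\<^sub>R y) \<bullet> (r *\<^sub>R y)) / (4 * \<delta>) = - (y \<bullet> y)" for y :: 'a
      using r by (simp add: \<delta>_def power2_eq_square)
    ultimately show ?thesis by simp
  qed
  define r where "r = (\<lambda>n. inverse (real (Suc n)))"
  have r: "r n > 0" for n by (simp add: r_def)
  have r0: "r \<longlonglongrightarrow> 0" unfolding r_def by (rule LIMSEQ_inverse_real_of_nat)
  have lim: "(\<lambda>n. \<integral>y. v (x0 + r n *\<^sub>R y) * of_real (exp (- (y \<bullet> y))) \<partial>lborel) \<longlonglongrightarrow> (\<integral>y. v x0 * of_real (exp (- ((y::'a) \<bullet> y))) \<partial>lborel)"
  proof (rule integral_dominated_convergence)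
    show "integrable lborel (\<lambda>y::'a. (C * B) * ((1 + norm y) ^ 0 * gauss_bd 0 1 y))"
      by (intro integrable_mult_right integrable_exp_norm) simp
    show "AE y in lborel. norm (v (x0 + r n *\<^sub>R y) * of_real (exp (- (y \<bullet> y)))) \<le> (C * B) * ((1 + norm y) ^ 0 * gauss_bd 0 1 y)" for n
      using vb by (intro AE_I2) (simp add: norm_mult power2_norm_eq_inner)
    have vc: "isCont v x0"
      using c unfolding v_def by (auto simp: continuous_on_eq_continuous_at intro!: continuous_intros continuous_on_interior[OF continuous_gexp, of UNIV])
    show "AE y in lborel. (\<lambda>n. v (x0 + r n *\<^sub>R y) * of_real (exp (- (y \<bullet> y)))) \<longlonglongrightarrow> v x0 * of_real (exp (- (y \<bullet> y)))"
    proof (intro AE_I2 tendsto_mult tendsto_const)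
      fix y
      have "(\<lambda>n. x0 + r n *\<^sub>R y) \<longlonglongrightarrow> x0 + 0 *\<^sub>R y" by (intro tendsto_intros r0)
      thus "(\<lambda>n. v (x0 + r n *\<^sub>R y)) \<longlonglongrightarrow> v x0" using isCont_tendsto_compose[OF vc] by simp
    qed
  qed measurable
  have "(\<integral>y. v x0 * of_real (exp (- ((y::'a) \<bullet> y))) \<partial>lborel) = 0"
    using lim unfolding key[OF r] by (simp only: LIMSEQ_const_iff)
  moreover have "complex_of_real (exp (- (y \<bullet> y))) = gexp 1 0 0 y" for y :: 'a
    by (simp add: gexp_def Complex_eq exp_of_real[symmetric])
  ultimately have "v x0 * (\<integral>y. gexp 1 0 0 (y::'a) \<partial>lborel) = 0"
    by (simp only: integral_mult_right_zero)
  hence "v x0 = 0" by (simp add: gauss_char(2))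
  thus ?thesis by (simp add: v_def gexp_def)
qed

section \<open>Derivatives of the predicted symbol\<close>

lemma abs_exp_minus_linear_le:
  fixes x :: real
  assumes "\<bar>x\<bar> \<le> 1"
  shows "\<bar>exp x - 1 - x\<bar> \<le> x\<^sup>2"
proof -
  have "exp x \<le> 1 + x + x\<^sup>2"
  proof (cases "x \<ge> 0")
    case True thus ?thesis using exp_bound[of x] assms by simp
  next
    case False
    have "1 \<le> (1 - x) * (1 + x + x\<^sup>2)"
    proof -
      have "(1 - x) * (1 + x + x\<^sup>2) = 1 + (-x) ^ 3" by (simp add: algebra_simps power2_eq_square power3_eq_cube)
      thus ?thesis using False by simp
    qed
    also have "\<dots> \<le> exp (- x) * (1 + x + x\<^sup>2)"
    proof (rule mult_right_mono)
      show "1 - x \<le> exp (- x)" using exp_ge_add_one_self[of "-x"] by simp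
      show "0 \<le> 1 + x + x\<^sup>2" using assms zero_le_power2[of x] by (simp add: abs_le_iff)
    qed
    finally have "exp x * 1 \<le> exp x * (exp (- x) * (1 + x + x\<^sup>2))" by (intro mult_left_mono) auto
    thus ?thesis by (simp add: mult.assoc[symmetric] exp_minus)
  qed
  thus ?thesis using exp_ge_add_one_self[of x] zero_le_power2[of x] unfolding abs_le_iff by linarith
qed

text \<open>Laplace transform of the weight and, up to the sign (-1)^k, its k-th derivative. For k =
  0 and \<rho> = |X|^2 it is the predicted symbol.\<close>

definition laplace_weight :: "nat \<Rightarrow> nat \<Rightarrow> real \<Rightarrow> real" where
  "laplace_weight d k \<rho> = (\<integral>s. s ^ k * exp (- (\<rho> * s)) \<partial>symbol_measure d)"

lemma laplace_weight_integrable: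
  assumes d: "d \<ge> 1"
  shows "integrable (symbol_measure d) (\<lambda>s. s ^ k * exp (- (\<rho> * s)))"
proof -
  interpret finite_measure "symbol_measure d" by (rule finite_symbol_measure[OF d])
  show ?thesis
  proof (rule integrable_const_bound)
    show "AE s in symbol_measure d. norm (s ^ k * exp (- (\<rho> * s))) \<le> exp \<bar>\<rho>\<bar>"
      using AE_symbol_measure
    proof eventually_elim
      case (elim s)
      have "- (\<rho> * s) \<le> \<bar>\<rho>\<bar> * 1" using elim by (intro order_trans[OF abs_ge_minus_self]) (auto simp: abs_mult mult_left_le)
      hence "s ^ k * exp (- (\<rho> * s)) \<le> 1 * exp \<bar>\<rho>\<bar>" using elim by (intro mult_mono) (auto simp: power_le_one)
      thus ?case using elim by simp
    qed
  qed measurable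
qed

lemma laplace_weight_deriv:
  assumes d: "d \<ge> 1"
  shows "(laplace_weight d k has_real_derivative - laplace_weight d (Suc k) \<rho>) (at \<rho>)"
proof -
  interpret finite_measure "symbol_measure d" by (rule finite_symbol_measure[OF d])
  let ?M = "exp \<bar>\<rho>\<bar> * measure (symbol_measure d) UNIV"
  \<comment> \<open>The second-order error of the exponential is at most (h s)^2 \<le> h^2 uniformly
    in s, so the difference quotient converges with an error linear in h.\<close>
  have est: "\<bar>(laplace_weight d k (\<rho> + h) - laplace_weight d k \<rho>) / h - (- laplace_weight d (Suc k) \<rho>)\<bar> \<le> ?M * \<bar>h\<bar>" if h: "h \<noteq> 0" "\<bar>h\<bar> \<le> 1" for h
  proof -
    let ?g = "\<lambda>s. s ^ k * exp (- ((\<rho> + h) * s)) - s ^ k * exp (- (\<rho> * s)) + h * (s ^ Suc k * exp (- (\<rho> * s)))"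
    have int: "integrable (symbol_measure d) ?g" by (intro Bochner_Integration.integrable_add Bochner_Integration.integrable_diff integrable_mult_right laplace_weight_integrable d)
    have gb: "AE s in symbol_measure d. norm (?g s) \<le> exp \<bar>\<rho>\<bar> * h\<^sup>2"
      using AE_symbol_measure
    proof eventually_elim
      case (elim s)
      have "?g s = s ^ k * exp (- (\<rho> * s)) * (exp (- (h * s)) - 1 - (- (h * s)))"
      proof -
        have "exp (- ((\<rho> + h) * s)) = exp (- (\<rho> * s)) * exp (- (h * s))" by (simp add: exp_add[symmetric] algebra_simps)
        thus ?thesis by (simp add: algebra_simps)
      qed
      hence "norm (?g s) = s ^ k * exp (- (\<rho> * s)) * \<bar>exp (- (h * s)) - 1 - (- (h * s))\<bar>"
        using elim by (simp add: abs_mult)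
      also have "\<dots> \<le> exp \<bar>\<rho>\<bar> * h\<^sup>2"
      proof (rule mult_mono)
        have "- (\<rho> * s) \<le> \<bar>\<rho>\<bar> * 1" using elim by (intro order_trans[OF abs_ge_minus_self]) (auto simp: abs_mult mult_left_le)
        hence "s ^ k * exp (- (\<rho> * s)) \<le> 1 * exp \<bar>\<rho>\<bar>" using elim by (intro mult_mono) (auto simp: power_le_one)
        thus "s ^ k * exp (- (\<rho> * s)) \<le> exp \<bar>\<rho>\<bar>" by simp
        have hs: "\<bar>h * s\<bar> \<le> \<bar>h\<bar>" using elim by (simp add: abs_mult mult_left_le)
        have "\<bar>exp (- (h * s)) - 1 - (- (h * s))\<bar> \<le> (- (h * s))\<^sup>2"
          using hs h by (intro abs_exp_minus_linear_le) simp
        also have "\<dots> \<le> h\<^sup>2" using hs by (simp add: abs_le_square_iff)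
        finally show "\<bar>exp (- (h * s)) - 1 - (- (h * s))\<bar> \<le> h\<^sup>2" .
      qed auto
      finally show ?case .
    qed
    have "laplace_weight d k (\<rho> + h) - laplace_weight d k \<rho> + h * laplace_weight d (Suc k) \<rho> = (\<integral>s. ?g s \<partial>symbol_measure d)"
      unfolding laplace_weight_def using laplace_weight_integrable[OF d]
      by (simp add: Bochner_Integration.integral_add Bochner_Integration.integral_diff Bochner_Integration.integrable_diff del: power_Suc)
    hence "\<bar>laplace_weight d k (\<rho> + h) - laplace_weight d k \<rho> + h * laplace_weight d (Suc k) \<rho>\<bar> \<le> (\<integral>s. norm (?g s) \<partial>symbol_measure d)"
      using integral_norm_bound[of "symbol_measure d" ?g] by (simp only: real_norm_def)
    moreover have "(\<integral>s. norm (?g s) \<partial>symbol_measure d) \<le> (\<integral>s. exp \<bar>\<rho>\<bar> * h\<^sup>2 \<partial>symbol_measure d)"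
      by (rule integral_mono_AE[OF integrable_norm[OF int] integrable_const gb])
    moreover have "(\<integral>s. exp \<bar>\<rho>\<bar> * h\<^sup>2 \<partial>symbol_measure d) = ?M * \<bar>h\<bar> * \<bar>h\<bar>" by (simp add: power2_eq_square)
    ultimately have "\<bar>laplace_weight d k (\<rho> + h) - laplace_weight d k \<rho> + h * laplace_weight d (Suc k) \<rho>\<bar> \<le> ?M * \<bar>h\<bar> * \<bar>h\<bar>" by linarith
    hence "\<bar>laplace_weight d k (\<rho> + h) - laplace_weight d k \<rho> + h * laplace_weight d (Suc k) \<rho>\<bar> / \<bar>h\<bar> \<le> ?M * \<bar>h\<bar>"
      using h by (simp add: divide_le_eq)
    moreover have "\<bar>(laplace_weight d k (\<rho> + h) - laplace_weight d k \<rho>) / h - (- laplace_weight d (Suc k) \<rho>)\<bar> = \<bar>laplace_weight d k (\<rho> + h) - laplace_weight d k \<rho> + h * laplace_weight d (Suc k) \<rho>\<bar> / \<bar>h\<bar>"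
      unfolding abs_divide[symmetric] using h by (simp add: add_divide_distrib)
    ultimately show ?thesis by simp
  qed
  have "((\<lambda>h. (laplace_weight d k (\<rho> + h) - laplace_weight d k \<rho>) / h - (- laplace_weight d (Suc k) \<rho>)) \<longlongrightarrow> 0) (at 0)"
  proof (rule Lim_null_comparison)
    have "eventually (\<lambda>h::real. \<bar>h\<bar> \<le> 1) (at 0)"
      by (rule eventually_at_filter[THEN iffD2], rule eventually_mono[OF eventually_nhds_ball[of 1 0]]) (auto simp: dist_real_def)
    moreover have "eventually (\<lambda>h::real. h \<noteq> 0) (at 0)" by (simp add: eventually_at_filter)
    ultimately show "eventually (\<lambda>h. norm ((laplace_weight d k (\<rho> + h) - laplace_weight d k \<rho>) / h - (- laplace_weight d (Suc k) \<rho>)) \<le> ?M * \<bar>h\<bar>) (at 0)"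
      by eventually_elim (use est in simp)
    have "((\<lambda>h. ?M * \<bar>h\<bar>) \<longlongrightarrow> ?M * \<bar>0\<bar>) (at 0)" by (intro tendsto_intros)
    thus "((\<lambda>h. ?M * \<bar>h\<bar>) \<longlongrightarrow> 0) (at 0)" by simp
  qed
  thus ?thesis unfolding DERIV_def by (rule LIM_zero_cancel)
qed

lemma laplace_weight_bound:
  assumes d: "d \<ge> 1" and \<rho>: "\<rho> \<ge> 0"
  shows "\<bar>laplace_weight d 0 \<rho>\<bar> \<le> measure (symbol_measure d) UNIV"
proof -
  interpret finite_measure "symbol_measure d" by (rule finite_symbol_measure[OF d])
  have "norm (laplace_weight d 0 \<rho>) \<le> (\<integral>s. norm (s ^ 0 * exp (- (\<rho> * s))) \<partial>symbol_measure d)" unfolding laplace_weight_def by (rule integral_norm_bound)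
  also have "\<dots> \<le> (\<integral>s. 1 \<partial>symbol_measure d)"
  proof (intro integral_mono_AE integrable_norm laplace_weight_integrable d integrable_const)
    show "AE s in symbol_measure d. norm (s ^ 0 * exp (- (\<rho> * s))) \<le> 1"
      using AE_symbol_measure by eventually_elim (use \<rho> in simp)
  qed
  finally show ?thesis by simp
qed

text \<open>The product of the two Gaussians has linear data (t - 1) p and (1 + t) q with t = tau s.
  Together with the factor exp (- t^2 z.z / 4) the terms in t^2 cancel, and t enters only through
  exp (- t (|p|^2 + |q|^2) / 2).\<close>

lemma mehler_solution_pairing:
  fixes p q :: "'a::euclidean_space"
  shows "(\<integral>x. gexp (1/2) (- p) q x * mehler_solution p q x \<partial>lborel)
    = of_real (sqrt pi ^ DIM('a)) * exp (Complex ((p \<bullet> p - q \<bullet> q) / 4) (- (p \<bullet> q) / 2)) *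
      of_real (\<integral>s. 1 / (1 + s) ^ DIM('a) * exp (- (tau s * (p \<bullet> p + q \<bullet> q) / 2)) \<partial>symbol_measure DIM('a))"
proof -
  let ?d = "DIM('a)"
  interpret finite_measure "symbol_measure ?d" by (rule finite_symbol_measure) simp
  interpret P: pair_sigma_finite "symbol_measure ?d" "lborel :: 'a measure" ..
  let ?h = "gexp (1/2) (- p) q"
  let ?E = "exp ((norm q)\<^sup>2/4)"
  define c where "c = (\<lambda>s. complex_of_real (1 / (1 + s) ^ ?d))"
  have [measurable]: "c \<in> borel_measurable borel" unfolding c_def by measurable
  have I: "integrable (symbol_measure ?d \<Otimes>\<^sub>M lborel) (\<lambda>(s, x). ?h x * (c s * mehler (tau s) p q x))"
  proof (rule integrable_finite_pair[OF finite_symbol_measure])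
    show "AE s in symbol_measure ?d. \<forall>x. norm (case (s, x) of (s, x) \<Rightarrow> ?h x * (c s * mehler (tau s) p q x))
        \<le> ?E * ((1 + norm x) ^ 0 * gauss_bd (2 * norm p) 1 x)"
      using AE_symbol_measure
    proof (eventually_elim, intro allI)
      fix s :: real and x :: 'a assume s: "0 < s \<and> s < 1"
      have "norm (?h x * (c s * mehler (tau s) p q x)) \<le> gauss_bd (norm p) (1/2) x * (?E * gauss_bd (norm p) (1/2) x)"
        unfolding norm_mult[of "?h x"] c_def using s by (intro mult_mono mehler_solution_integrand_le norm_gexp_le) auto
      also have "\<dots> = ?E * ((1 + norm x) ^ 0 * gauss_bd (2 * norm p) 1 x)"
        by (simp add: exp_add[symmetric] algebra_simps)
      finally show "norm (case (s, x) of (s, x) \<Rightarrow> ?h x * (c s * mehler (tau s) p q x)) \<le> ?E * ((1 + norm x) ^ 0 * gauss_bd (2 * norm p) 1 x)"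
        by simp
    qed
    show "integrable lborel (\<lambda>x::'a. ?E * ((1 + norm x) ^ 0 * gauss_bd (2 * norm p) 1 x))"
      by (intro integrable_mult_right integrable_exp_norm) simp
  qed (simp, measurable)
  have "(\<integral>x. ?h x * mehler_solution p q x \<partial>lborel) = (\<integral>x. (\<integral>s. ?h x * (c s * mehler (tau s) p q x) \<partial>symbol_measure ?d) \<partial>lborel)"
    unfolding mehler_solution_def c_def by (simp only: integral_mult_right_zero)
  also have "\<dots> = (\<integral>s. (\<integral>x. ?h x * (c s * mehler (tau s) p q x) \<partial>lborel) \<partial>symbol_measure ?d)"
    by (rule P.Fubini_integral[OF I])
  also have "\<dots> = (\<integral>s. of_real (sqrt pi ^ ?d) * exp (Complex ((p \<bullet> p - q \<bullet> q) / 4) (- (p \<bullet> q) / 2)) *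
      of_real (1 / (1 + s) ^ ?d * exp (- (tau s * (p \<bullet> p + q \<bullet> q) / 2))) \<partial>symbol_measure ?d)"
  proof (rule Bochner_Integration.integral_cong[OF refl])
    fix s :: real
    let ?t = "tau s" and ?e = "exp (- of_real ((tau s)\<^sup>2/4) * csq p q)"
    have "?h x * (c s * mehler ?t p q x) = (c s * ?e) * gexp 1 ((?t - 1) *\<^sub>R p) ((1 + ?t) *\<^sub>R q) x" for x
    proof -
      have "?h x * gexp (1/2) (?t *\<^sub>R p) (?t *\<^sub>R q) x = gexp 1 ((?t - 1) *\<^sub>R p) ((1 + ?t) *\<^sub>R q) x"
        unfolding gexp_mult by (simp add: scaleR_diff_left scaleR_add_left)
      thus ?thesis by (simp add: mehler_def mult_ac)
    qed
    hence "(\<integral>x. ?h x * (c s * mehler ?t p q x) \<partial>lborel) = (c s * ?e) * (of_real (sqrt (pi/1) ^ ?d) *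
       exp (Complex ((((?t - 1) *\<^sub>R p) \<bullet> ((?t - 1) *\<^sub>R p) - ((1 + ?t) *\<^sub>R q) \<bullet> ((1 + ?t) *\<^sub>R q)) / (4 * 1)) ((((?t - 1) *\<^sub>R p) \<bullet> ((1 + ?t) *\<^sub>R q)) / (2 * 1))))"
      by (simp only: integral_mult_right_zero gauss_integral(2)[OF zero_less_one])
    also have "\<dots> = of_real (sqrt pi ^ ?d) * c s * (?e * exp (Complex ((((?t - 1) *\<^sub>R p) \<bullet> ((?t - 1) *\<^sub>R p) - ((1 + ?t) *\<^sub>R q) \<bullet> ((1 + ?t) *\<^sub>R q)) / (4 * 1)) ((((?t - 1) *\<^sub>R p) \<bullet> ((1 + ?t) *\<^sub>R q)) / (2 * 1))))"
      by (simp only: div_by_1 mult_ac)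
    also have "?e * exp (Complex ((((?t - 1) *\<^sub>R p) \<bullet> ((?t - 1) *\<^sub>R p) - ((1 + ?t) *\<^sub>R q) \<bullet> ((1 + ?t) *\<^sub>R q)) / (4 * 1)) ((((?t - 1) *\<^sub>R p) \<bullet> ((1 + ?t) *\<^sub>R q)) / (2 * 1)))
       = exp (Complex ((p \<bullet> p - q \<bullet> q) / 4) (- (p \<bullet> q) / 2)) * of_real (exp (- (?t * (p \<bullet> p + q \<bullet> q) / 2)))"
      unfolding exp_of_real[symmetric] exp_add[symmetric] inner_scaleR_left inner_scaleR_right
      by (rule arg_cong[where f=exp]) (simp add: complex_eq_iff csq_def field_simps power2_eq_square)
    finally show "(\<integral>x. ?h x * (c s * mehler ?t p q x) \<partial>lborel) = of_real (sqrt pi ^ ?d) * exp (Complex ((p \<bullet> p - q \<bullet> q) / 4) (- (p \<bullet> q) / 2)) *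
      of_real (1 / (1 + s) ^ ?d * exp (- (tau s * (p \<bullet> p + q \<bullet> q) / 2)))"
      by (simp only: c_def of_real_mult mult_ac)
  qed
  also have "\<dots> = of_real (sqrt pi ^ ?d) * exp (Complex ((p \<bullet> p - q \<bullet> q) / 4) (- (p \<bullet> q) / 2)) *
      of_real (\<integral>s. 1 / (1 + s) ^ ?d * exp (- (tau s * (p \<bullet> p + q \<bullet> q) / 2)) \<partial>symbol_measure ?d)"
    by (simp only: integral_mult_right_zero integral_complex_of_real)
  finally show ?thesis .
qed

text \<open>For fixed s the integrand is a Gaussian of width 1 + s on phase space, whose dimension 2
  DIM turns the square root in \<open>gauss_char\<close> into a full power.\<close>

lemma laplace_weight_pairing:
  fixes k :: "'a::euclidean_space \<times> 'a"
  shows "(\<integral>X. of_real (laplace_weight DIM('a) 0 (X \<bullet> X)) * gexp 1 0 k X \<partial>lborel)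
    = of_real (pi ^ DIM('a) * (\<integral>s. 1 / (1 + s) ^ DIM('a) * exp (- (k \<bullet> k) / (4 * (1 + s))) \<partial>symbol_measure DIM('a)))"
proof -
  let ?d = "DIM('a)"
  interpret finite_measure "symbol_measure ?d" by (rule finite_symbol_measure) simp
  interpret P: pair_sigma_finite "symbol_measure ?d" "lborel :: ('a \<times> 'a) measure" ..
  let ?f = "\<lambda>s X. of_real (exp (- ((X \<bullet> X) * s))) * gexp 1 0 k X"
  have I: "integrable (symbol_measure ?d \<Otimes>\<^sub>M lborel) (\<lambda>(s, X). ?f s X)"
  proof (rule integrable_finite_pair[OF finite_symbol_measure])
    show "AE s in symbol_measure ?d. \<forall>X. norm (case (s, X) of (s, X) \<Rightarrow> ?f s X) \<le> norm (gexp 1 0 k X)"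
      using AE_symbol_measure by eventually_elim (auto simp: norm_mult intro!: mult_left_le_one_le)
    show "integrable lborel (\<lambda>X. norm (gexp 1 0 k X))" by (intro integrable_norm gauss_char) simp
  qed (simp, measurable)
  have "(\<integral>X. of_real (laplace_weight ?d 0 (X \<bullet> X)) * gexp 1 0 k X \<partial>lborel) = (\<integral>X. (\<integral>s. ?f s X \<partial>symbol_measure ?d) \<partial>lborel)"
    unfolding laplace_weight_def power_0 mult_1 by (simp only: integral_mult_left_zero integral_complex_of_real)
  also have "\<dots> = (\<integral>s. (\<integral>X. ?f s X \<partial>lborel) \<partial>symbol_measure ?d)"
    by (rule P.Fubini_integral[OF I])
  also have "\<dots> = (\<integral>s. of_real (pi ^ ?d * (1 / (1 + s) ^ ?d * exp (- (k \<bullet> k) / (4 * (1 + s))))) \<partial>symbol_measure ?d)"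
  proof (rule integral_cong_AE)
    show "AE s in symbol_measure ?d. (\<integral>X. ?f s X \<partial>lborel) = of_real (pi ^ ?d * (1 / (1 + s) ^ ?d * exp (- (k \<bullet> k) / (4 * (1 + s)))))"
      using AE_symbol_measure
    proof eventually_elim
      case (elim s)
      have "?f s X = gexp (1 + s) 0 k X" for X
        unfolding gexp_def exp_of_real[symmetric] exp_add[symmetric]
        by (rule arg_cong[where f=exp]) (simp add: complex_eq_iff algebra_simps)
      hence "(\<integral>X. ?f s X \<partial>lborel) = of_real (sqrt (pi / (1 + s)) ^ DIM('a \<times> 'a) * exp (- (k \<bullet> k) / (4 * (1 + s))))"
        using gauss_char(2)[of "1 + s" k] elim by (simp only: add_pos_pos zero_less_one simp_thms)
      also have "sqrt (pi / (1 + s)) ^ DIM('a \<times> 'a) = pi ^ ?d * (1 / (1 + s) ^ ?d)"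
        using elim by (simp add: mult_2[symmetric] power_mult power_divide)
      finally show ?case by (simp only: mult.assoc)
    qed
  qed (use P.borel_measurable_lebesgue_integral in \<open>measurable\<close>)
  also have "\<dots> = of_real (pi ^ ?d * (\<integral>s. 1 / (1 + s) ^ ?d * exp (- (k \<bullet> k) / (4 * (1 + s))) \<partial>symbol_measure ?d))"
    by (simp only: integral_complex_of_real integral_mult_right_zero)
  finally show ?thesis .
qed

lemma symbol_unique:
  fixes b :: "'a::euclidean_space \<times> 'a \<Rightarrow> complex"
  assumes b: "amplitude b"
    and H: "\<And>p q. AE x in lborel. has_oscillatory_integral (\<lambda>(y, \<xi>). osc_amp b (mehler 1 p q) x y \<xi>) (of_real ((2 * pi) ^ DIM('a)) * mehler_solution p q x)"
  shows "b X = of_real (laplace_weight DIM('a) 0 (X \<bullet> X))"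
proof -
  let ?d = "DIM('a)"
  define B where "B = (\<lambda>X::'a \<times> 'a. complex_of_real (laplace_weight ?d 0 (X \<bullet> X)))"
  have d1: "?d \<ge> 1" by simp
  have Bc: "continuous_on UNIV B"
  proof -
    have "continuous_on UNIV (laplace_weight ?d 0)" using laplace_weight_deriv[OF d1] by (intro DERIV_continuous_on) auto
    moreover have "continuous_on UNIV (\<lambda>X::'a \<times> 'a. X \<bullet> X)" by (intro continuous_intros)
    ultimately have "continuous_on UNIV (\<lambda>X::'a \<times> 'a. laplace_weight ?d 0 (X \<bullet> X))"
      by (rule continuous_on_compose2) simp
    thus ?thesis unfolding B_def by (rule continuous_on_of_real)
  qed
  have Bb: "norm (B X) \<le> measure (symbol_measure ?d) UNIV" for X
    using laplace_weight_bound[OF d1, of "X \<bullet> X"] by (simp add: B_def)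
  obtain C m where C: "C \<ge> 0" "\<And>x \<xi>. norm (b (x, \<xi>)) \<le> C * (1 + norm x) ^ m * (1 + norm \<xi>) ^ m"
    using amplitude_growth[OF b] by blast
  have bb: "norm (b X) \<le> C * (1 + norm X) ^ (2 * m)" for X
  proof -
    obtain x \<xi> where X: "X = (x, \<xi>)" by (cases X)
    have "norm x \<le> norm X" "norm \<xi> \<le> norm X" unfolding X by (rule norm_fst_le, rule norm_snd_le)
    hence "C * (1 + norm x) ^ m * (1 + norm \<xi>) ^ m \<le> C * (1 + norm X) ^ m * (1 + norm X) ^ m"
      using C(1) by (intro mult_mono power_mono) auto
    thus ?thesis using C(2)[of x \<xi>] by (simp add: X mult_2 power_add mult.assoc)
  qed
  let ?M = "measure (symbol_measure ?d) UNIV"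
  have D: "norm (b X - B X) \<le> (C + ?M) * (1 + norm X) ^ (2 * m)" for X
  proof -
    have "?M * 1 \<le> ?M * (1 + norm X) ^ (2 * m)" by (intro mult_left_mono one_le_power) auto
    thus ?thesis using norm_triangle_ineq4[of "b X" "B X"] bb[of X] Bb[of X] by (simp add: distrib_right)
  qed
  have bi: "integrable lborel (\<lambda>X. gexp 1 0 k X * b X)" "integrable lborel (\<lambda>X. gexp 1 0 k X * B X)" for k
    by (rule integrable_gexp_poly[OF _ b_continuous[OF b] bb], simp)
       (rule integrable_gexp_poly[OF _ Bc, of _ ?M 0], use Bb in auto)
  have eq: "(\<integral>X. b X * gexp 1 0 k X \<partial>lborel) = (\<integral>X. B X * gexp 1 0 k X \<partial>lborel)" for k
  proof -
    \<comment> \<open>Inverts the map from (p, q) to the frequency (2 q, - 2 p).\<close>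
    define q where "q = (1/2) *\<^sub>R fst k"
    define p where "p = (- 1/2) *\<^sub>R snd k"
    have k: "k = (2 *\<^sub>R q, - 2 *\<^sub>R p)" by (simp add: q_def p_def)
    let ?P = "p \<bullet> p" and ?Q = "q \<bullet> q"
    let ?L = "\<integral>s. 1 / (1 + s) ^ ?d * exp (- (tau s * (?P + ?Q) / 2)) \<partial>symbol_measure ?d"
    have kk: "k \<bullet> k = 4 * (?P + ?Q)" by (simp add: k algebra_simps)
    have "(\<integral>s. 1 / (1 + s) ^ ?d * exp (- (k \<bullet> k) / (4 * (1 + s))) \<partial>symbol_measure ?d)
       = (\<integral>s. exp (- ((?P + ?Q) / 2)) * (1 / (1 + s) ^ ?d * exp (- (tau s * (?P + ?Q) / 2))) \<partial>symbol_measure ?d)"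
    proof (rule integral_cong_AE)
      show "AE s in symbol_measure ?d. 1 / (1 + s) ^ ?d * exp (- (k \<bullet> k) / (4 * (1 + s))) =
          exp (- ((?P + ?Q) / 2)) * (1 / (1 + s) ^ ?d * exp (- (tau s * (?P + ?Q) / 2)))"
        using AE_symbol_measure
      proof eventually_elim
        case (elim s)
        \<comment> \<open>Uses 1 / (1 + s) = (1 + tau s) / 2 and |k|^2 = 4 (|p|^2 + |q|^2); this
          matches the two s-integrals up to a factor independent of s.\<close>
        have "- (k \<bullet> k) / (4 * (1 + s)) = - ((?P + ?Q) / 2) + - (tau s * (?P + ?Q) / 2)"
          using elim unfolding kk tau_def by (simp add: field_simps)
        thus ?case by (simp only: exp_add mult_ac)
      qed
    qed measurable
    hence BL: "(\<integral>X. B X * gexp 1 0 k X \<partial>lborel) = of_real (pi ^ ?d * (exp (- ((?P + ?Q) / 2)) * ?L))"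
      unfolding B_def laplace_weight_pairing by (simp only: integral_mult_right_zero)
    have id: "exp (Complex ((?P - ?Q) / 4) (- (p \<bullet> q) / 2)) = exp (- (csq p q / 4)) * of_real (exp ?P) * of_real (exp (- ((?P + ?Q) / 2)))"
      unfolding exp_of_real[symmetric] exp_add[symmetric]
      by (rule arg_cong[where f=exp]) (simp add: complex_eq_iff csq_def field_simps)
    define Z where "Z = exp (- (csq p q / 4)) * complex_of_real (exp ?P)"
    have Z0: "Z \<noteq> 0" by (simp add: Z_def)
    have "2 ^ ?d * ((Z * of_real (sqrt pi ^ ?d)) * (\<integral>X. b X * gexp 1 0 k X \<partial>lborel))
       = of_real ((2 * pi) ^ ?d) * (of_real (sqrt pi ^ ?d) * (Z * of_real (exp (- ((?P + ?Q) / 2)))) * of_real ?L)"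
      using pairing_limit[OF b H, of p q] unfolding mehler_solution_pairing id k[symmetric] Z_def by (simp add: mult_ac)
    hence "(2 ^ ?d * Z * of_real (sqrt pi ^ ?d)) * (\<integral>X. b X * gexp 1 0 k X \<partial>lborel)
       = (2 ^ ?d * Z * of_real (sqrt pi ^ ?d)) * of_real (pi ^ ?d * (exp (- ((?P + ?Q) / 2)) * ?L))"
      by (simp add: power_mult_distrib mult_ac)
    moreover have "2 ^ ?d * Z * of_real (sqrt pi ^ ?d) \<noteq> 0" using Z0 by simp
    ultimately show ?thesis unfolding BL mult_cancel_left by blast
  qed
  have "b X - B X = 0"
  proof (rule fourier_gauss_unique[OF _ D])
    show "continuous_on UNIV (\<lambda>X. b X - B X)" by (intro continuous_intros b_continuous[OF b] Bc)
    fix k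
    have "(\<integral>X. (b X - B X) * gexp 1 0 k X \<partial>lborel) = (\<integral>X. gexp 1 0 k X * b X \<partial>lborel) - (\<integral>X. gexp 1 0 k X * B X \<partial>lborel)"
      by (subst Bochner_Integration.integral_diff[OF bi, symmetric]) (simp add: algebra_simps)
    thus "(\<integral>X. (b X - B X) * gexp 1 0 k X \<partial>lborel) = 0" using eq[of k] by (simp add: mult.commute)
  qed
  thus ?thesis by (simp add: B_def)
qed

section \<open>Asymptotic expansion\<close>

lemma power_exp_integral:
  fixes \<rho> :: real
  assumes \<rho>: "\<rho> > 0"
  shows "has_bochner_integral lborel (\<lambda>s. indicator {0..} s * (s ^ n * exp (- (\<rho> * s)))) (fact n / \<rho> ^ Suc n)"
proof -
  \<comment> \<open>The integrand is the Erlang density up to its normalizing constant, so total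
    mass one evaluates the integral.\<close>
  interpret prob_space "density lborel (erlang_density n \<rho>)" by (rule prob_space_erlang_density[OF \<rho>])
  have "(\<integral>\<^sup>+s. ennreal (erlang_density n \<rho> s) \<partial>lborel) = 1"
    using emeasure_space_1 by (simp add: emeasure_density)
  hence "has_bochner_integral lborel (erlang_density n \<rho>) 1"
    using \<rho> by (intro has_bochner_integral_nn_integral) (auto simp: erlang_density_nonneg)
  hence "has_bochner_integral lborel (\<lambda>s. (fact n / \<rho> ^ Suc n) * erlang_density n \<rho> s) ((fact n / \<rho> ^ Suc n) * 1)"
    by (rule has_bochner_integral_mult_right)
  moreover have "(fact n / \<rho> ^ Suc n) * erlang_density n \<rho> s = indicator {0..} s * (s ^ n * exp (- (\<rho> * s)))" for s
    using \<rho> by (simp add: erlang_density_def indicator_def)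
  ultimately show ?thesis by simp
qed

lemma exp_neg_le_power:
  fixes x :: real
  assumes "x > 0"
  shows "exp (- x) \<le> fact m / x ^ m"
proof -
  have "(\<Sum>n\<in>{m}. x ^ n /\<^sub>R fact n) \<le> (\<Sum>n. x ^ n /\<^sub>R fact n)"
    using assms by (intro sum_le_suminf summable_exp_generic) auto
  hence "x ^ m / fact m \<le> exp x" by (simp add: exp_def divide_inverse mult.commute)
  thus ?thesis using assms by (simp add: exp_minus field_simps)
qed

text \<open>Taylor coefficients of (1 - z)^(d/2 - 1) at z = 0, to be used with z = s^2.\<close>

definition weight_coeff :: "nat \<Rightarrow> nat \<Rightarrow> real" where
  "weight_coeff d j = (-1) ^ j * ((real d / 2 - 1) gchoose j)"

text \<open>For s \<le> 1/2 the variable z = s^2 is at most 1/4, well inside the unit disc: the tail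
  is z^N times a series dominated by its absolutely convergent value at 1/4.\<close>

lemma binomial_remainder:
  "\<exists>C\<ge>0. \<forall>s. 0 \<le> s \<longrightarrow> s \<le> 1/2 \<longrightarrow> \<bar>(1 - s\<^sup>2) powr (real d / 2 - 1) - (\<Sum>j<N. weight_coeff d j * s ^ (2 * j))\<bar> \<le> C * s ^ (2 * N)"
proof -
  have sums: "(\<lambda>n. weight_coeff d n * z ^ n) sums (1 - z) powr (real d / 2 - 1)" if "\<bar>z\<bar> < 1" for z
    using gen_binomial_real[of "-z" "real d / 2 - 1"] that
    by (simp add: weight_coeff_def power_minus[of z] mult_ac)
  have "summable (\<lambda>n. norm (weight_coeff d n * (1/4) ^ n))"
    using sums_summable[OF sums[of "1/2"]] by (rule powser_insidea[of _ "1/2"]) auto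
  hence "summable (\<lambda>n. norm (weight_coeff d (n + N) * (1/4) ^ (n + N)))" by (rule summable_ignore_initial_segment)
  hence "summable (\<lambda>n. 4 ^ N * norm (weight_coeff d (n + N) * (1/4) ^ (n + N)))" by (rule summable_mult)
  moreover have "4 ^ N * norm (weight_coeff d (n + N) * (1/4) ^ (n + N)) = \<bar>weight_coeff d (n + N)\<bar> * (1/4) ^ n" for n
    by (simp add: abs_mult power_add power_divide)
  ultimately have sm: "summable (\<lambda>n. \<bar>weight_coeff d (n + N)\<bar> * (1/4) ^ n)" by (simp only:)
  define C where "C = (\<Sum>n. \<bar>weight_coeff d (n + N)\<bar> * (1/4) ^ n)"
  show ?thesis
  proof (intro exI[of _ C] conjI allI impI)
    show "C \<ge> 0" unfolding C_def by (intro suminf_nonneg sm) auto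
    fix s :: real assume s: "0 \<le> s" "s \<le> 1/2"
    define z where "z = s\<^sup>2"
    have z: "0 \<le> z" "z \<le> 1/4" using s power_mono[of s "1/2" 2] by (auto simp: z_def power_divide)
    have su: "summable (\<lambda>n. weight_coeff d n * z ^ n)" using sums_summable[OF sums[of z]] z by simp
    have "(1 - z) powr (real d / 2 - 1) = (\<Sum>n. weight_coeff d n * z ^ n)" using sums_unique[OF sums[of z]] z by simp
    also have "\<dots> = (\<Sum>n. weight_coeff d (n + N) * z ^ (n + N)) + (\<Sum>j<N. weight_coeff d j * z ^ j)"
      by (rule suminf_split_initial_segment[OF su])
    finally have "(1 - z) powr (real d / 2 - 1) - (\<Sum>j<N. weight_coeff d j * z ^ j) = (\<Sum>n. weight_coeff d (n + N) * z ^ (n + N))" by simp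
    moreover have "norm (\<Sum>n. weight_coeff d (n + N) * z ^ (n + N)) \<le> (\<Sum>n. z ^ N * (\<bar>weight_coeff d (n + N)\<bar> * (1/4) ^ n))"
    proof (rule norm_suminf_le[OF _ summable_mult[OF sm]])
      fix n
      have "norm (weight_coeff d (n + N) * z ^ (n + N)) = z ^ N * (\<bar>weight_coeff d (n + N)\<bar> * z ^ n)"
        using z by (simp add: abs_mult power_add)
      also have "\<dots> \<le> z ^ N * (\<bar>weight_coeff d (n + N)\<bar> * (1/4) ^ n)" using z by (intro mult_left_mono power_mono) auto
      finally show "norm (weight_coeff d (n + N) * z ^ (n + N)) \<le> z ^ N * (\<bar>weight_coeff d (n + N)\<bar> * (1/4) ^ n)" .
    qed
    moreover have "(\<Sum>n. z ^ N * (\<bar>weight_coeff d (n + N)\<bar> * (1/4) ^ n)) = z ^ N * C"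
      unfolding C_def by (rule suminf_mult[OF sm])
    ultimately have "\<bar>(1 - z) powr (real d / 2 - 1) - (\<Sum>j<N. weight_coeff d j * z ^ j)\<bar> \<le> C * z ^ N"
      by (simp add: mult.commute)
    thus "\<bar>(1 - s\<^sup>2) powr (real d / 2 - 1) - (\<Sum>j<N. weight_coeff d j * s ^ (2 * j))\<bar> \<le> C * s ^ (2 * N)"
      by (simp add: z_def power_mult)
  qed
qed

text \<open>The subtracted terms are the half-line integrals of s^(2 j + k) exp (- \<rho> s). The
  index k counts derivatives up to sign, so the whole family is closed under
  differentiation.\<close>

definition watson_remainder :: "nat \<Rightarrow> nat \<Rightarrow> nat \<Rightarrow> real \<Rightarrow> real" where
  "watson_remainder d N k \<rho> = laplace_weight d k \<rho> - (\<Sum>j<N. weight_coeff d j * (fact (2 * j + k) / \<rho> ^ Suc (2 * j + k)))"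

lemma watson_remainder_deriv:
  assumes d: "d \<ge> 1" and \<rho>: "\<rho> > 0"
  shows "(watson_remainder d N k has_real_derivative - watson_remainder d N (Suc k) \<rho>) (at \<rho>)"
proof -
  have 1: "((\<lambda>\<rho>. fact n / \<rho> ^ Suc n) has_real_derivative - (fact (Suc n) / \<rho> ^ Suc (Suc n))) (at \<rho>)" for n
  proof -
    have "((\<lambda>\<rho>. fact n * inverse (\<rho> ^ Suc n)) has_real_derivative fact n * (- (inverse (\<rho> ^ Suc n) * (real (Suc n) * \<rho> ^ n) * inverse (\<rho> ^ Suc n)))) (at \<rho>)"
      using \<rho> DERIV_power[OF DERIV_ident, of "Suc n" \<rho> UNIV]
      by (intro DERIV_cmult DERIV_inverse') (auto simp del: power_Suc)
    moreover have "fact n * (- (inverse (\<rho> ^ Suc n) * (real (Suc n) * \<rho> ^ n) * inverse (\<rho> ^ Suc n))) = - (fact (Suc n) / \<rho> ^ Suc (Suc n))"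
      using \<rho> by (simp add: field_simps)
    ultimately show ?thesis by (simp only: divide_inverse)
  qed
  have "((\<lambda>\<rho>. laplace_weight d k \<rho> - (\<Sum>j<N. weight_coeff d j * (fact (2 * j + k) / \<rho> ^ Suc (2 * j + k)))) has_real_derivative
     - laplace_weight d (Suc k) \<rho> - (\<Sum>j<N. weight_coeff d j * - (fact (Suc (2 * j + k)) / \<rho> ^ Suc (Suc (2 * j + k))))) (at \<rho>)"
    by (intro DERIV_diff laplace_weight_deriv d DERIV_sum DERIV_cmult 1)
  thus ?thesis unfolding watson_remainder_def[abs_def] by (simp add: sum_negf)
qed

text \<open>On s \<le> 1/2 the Taylor remainder of the weight gives the expected power. On s > 1/2
  no cancellation is used: the weight contributes at most a multiple of exp (- \<rho> / 2), and each
  Taylor term is dominated by the power s^(2 N). Every step is valid for all \<rho> > 0, hence also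
  near the origin.\<close>

lemma watson_remainder_bound:
  assumes d: "d \<ge> 1"
  shows "\<exists>C\<ge>0. \<forall>\<rho>>0. \<bar>watson_remainder d N k \<rho>\<bar> \<le> C / \<rho> ^ Suc (2 * N + k)"
proof -
  interpret finite_measure "symbol_measure d" by (rule finite_symbol_measure[OF d])
  obtain C1 where C1: "C1 \<ge> 0" "\<And>s. 0 \<le> s \<Longrightarrow> s \<le> 1/2 \<Longrightarrow>
      \<bar>(1 - s\<^sup>2) powr (real d / 2 - 1) - (\<Sum>j<N. weight_coeff d j * s ^ (2 * j))\<bar> \<le> C1 * s ^ (2 * N)"
    using binomial_remainder by blast
  define C2 where "C2 = (\<Sum>j<N. \<bar>weight_coeff d j\<bar> * 4 ^ N)"
  have C2: "C2 \<ge> 0" unfolding C2_def by (intro sum_nonneg) auto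
  let ?n = "2 * N + k"
  define W where "W = measure (symbol_measure d) UNIV"
  define C where "C = (C1 + C2) * fact ?n + W * (4 ^ N * (fact (Suc ?n) * 2 ^ Suc ?n))"
  have W: "W \<ge> 0" by (simp add: W_def)
  have C: "C \<ge> 0" unfolding C_def using C1(1) C2 W by simp
  show ?thesis
  proof (intro exI[of _ C] conjI C allI impI)
    fix \<rho> :: real assume \<rho>: "\<rho> > 0"
    define K where "K = (\<lambda>s. s ^ k * exp (- (\<rho> * s)))"
    define G where "G = (\<lambda>s. symbol_weight d s * K s - (\<Sum>j<N. weight_coeff d j * (indicator {0..} s * (s ^ (2 * j + k) * exp (- (\<rho> * s))))))"
    have int_w: "integrable lborel (\<lambda>s. symbol_weight d s * K s)"
      using laplace_weight_integrable[OF d, of k \<rho>] by (subst (asm) integral_symbol_measure(2)) (simp_all add: K_def)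
    have lapK: "laplace_weight d k \<rho> = (\<integral>s. symbol_weight d s * K s \<partial>lborel)"
      unfolding laplace_weight_def by (subst integral_symbol_measure(1)) (simp_all add: K_def)
    have int_p: "integrable lborel (\<lambda>s. indicator {0..} s * (s ^ n * exp (- (\<rho> * s))))"
      "(\<integral>s. indicator {0..} s * (s ^ n * exp (- (\<rho> * s))) \<partial>lborel) = fact n / \<rho> ^ Suc n" for n
      using power_exp_integral[OF \<rho>, of n] by (auto simp: has_bochner_integral_iff)
    have int_G: "integrable lborel G"
      unfolding G_def by (intro Bochner_Integration.integrable_diff int_w Bochner_Integration.integrable_sum integrable_mult_right int_p)
    have lG: "watson_remainder d N k \<rho> = (\<integral>s. G s \<partial>lborel)"
      unfolding watson_remainder_def G_def lapK int_p(2)[symmetric] integral_mult_right_zero[symmetric]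
      by (subst Bochner_Integration.integral_sum[symmetric], intro integrable_mult_right int_p,
          rule Bochner_Integration.integral_diff[symmetric],
          intro int_w, intro Bochner_Integration.integrable_sum integrable_mult_right int_p)
    have wi: "integrable lborel (\<lambda>s. symbol_weight d s * (4 ^ N * exp (- (\<rho> / 2))))"
      using integrable_const[of "4 ^ N * exp (- (\<rho> / 2))"] by (subst (asm) integral_symbol_measure(2)) auto
    have "\<bar>watson_remainder d N k \<rho>\<bar> \<le> (\<integral>s. norm (G s) \<partial>lborel)" using integral_norm_bound[of lborel G] lG by simp
    also have "\<dots> \<le> (\<integral>s. (C1 + C2) * (indicator {0..} s * (s ^ ?n * exp (- (\<rho> * s)))) + symbol_weight d s * (4 ^ N * exp (- (\<rho> / 2))) \<partial>lborel)"
    proof (rule integral_mono_AE[OF integrable_norm[OF int_G]])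
      show "integrable lborel (\<lambda>s. (C1 + C2) * (indicator {0..} s * (s ^ ?n * exp (- (\<rho> * s)))) + symbol_weight d s * (4 ^ N * exp (- (\<rho> / 2))))"
        by (intro Bochner_Integration.integrable_add integrable_mult_right int_p wi)
      \<comment> \<open>The point s = 0 is left out because the Taylor terms live on the closed
        half-line while the weight vanishes there; it is a null set.\<close>
      have "norm (G s) \<le> (C1 + C2) * (indicator {0..} s * (s ^ ?n * exp (- (\<rho> * s)))) + symbol_weight d s * (4 ^ N * exp (- (\<rho> / 2)))"
        if s0: "s \<noteq> 0" for s
      proof -
        have w0: "symbol_weight d s \<ge> 0" by (rule symbol_weight_nonneg)
        consider "s < 0" | "0 < s" "s \<le> 1/2" | "s > 1/2" using s0 by linarith
        thus ?thesis
        proof cases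
          case 1
          thus ?thesis by (simp add: G_def symbol_weight_def)
        next
          case 2
          have K0: "K s \<ge> 0" using 2 by (simp add: K_def)
          have "G s = K s * ((1 - s\<^sup>2) powr (real d / 2 - 1) - (\<Sum>j<N. weight_coeff d j * s ^ (2 * j)))"
            using 2 by (simp add: G_def K_def symbol_weight_def power_add sum_distrib_left algebra_simps)
          hence "norm (G s) = K s * \<bar>(1 - s\<^sup>2) powr (real d / 2 - 1) - (\<Sum>j<N. weight_coeff d j * s ^ (2 * j))\<bar>"
            using K0 by (simp add: abs_mult)
          also have "\<dots> \<le> K s * (C1 * s ^ (2 * N))" using 2 K0 by (intro mult_left_mono C1) auto
          also have "\<dots> = C1 * (s ^ ?n * exp (- (\<rho> * s)))" by (simp add: K_def power_add mult_ac)
          also have "\<dots> \<le> (C1 + C2) * (s ^ ?n * exp (- (\<rho> * s)))" using 2 C2 by (intro mult_right_mono) auto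
          finally show ?thesis using 2 w0 by (simp add: add_increasing2)
        next
          case 3
          have K0: "K s \<ge> 0" using 3 by (simp add: K_def)
          have a: "symbol_weight d s * K s \<le> symbol_weight d s * (4 ^ N * exp (- (\<rho> / 2)))"
          proof (cases "s < 1")
            case True
            have "s ^ k \<le> 1" using 3 True by (simp add: power_le_one)
            moreover have "exp (- (\<rho> * s)) \<le> exp (- (\<rho> / 2))" using 3 \<rho> by simp
            ultimately have "K s \<le> 1 * exp (- (\<rho> / 2))" unfolding K_def using 3 by (intro mult_mono) auto
            also have "\<dots> \<le> 4 ^ N * exp (- (\<rho> / 2))" by (intro mult_right_mono) auto
            finally show ?thesis using w0 by (intro mult_left_mono) auto
          next
            case False
            thus ?thesis by (simp add: symbol_weight_def)
          qed
          have b: "\<bar>\<Sum>j<N. weight_coeff d j * (indicator {0..} s * (s ^ (2 * j + k) * exp (- (\<rho> * s))))\<bar> \<le> C2 * (s ^ ?n * exp (- (\<rho> * s)))"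
          proof -
            have "\<bar>\<Sum>j<N. weight_coeff d j * (indicator {0..} s * (s ^ (2 * j + k) * exp (- (\<rho> * s))))\<bar>
               \<le> (\<Sum>j<N. \<bar>weight_coeff d j\<bar> * 4 ^ N * (s ^ ?n * exp (- (\<rho> * s))))"
            proof (rule order_trans[OF sum_abs sum_mono])
              fix j assume j: "j \<in> {..<N}"
              \<comment> \<open>As 2 s > 1, lower powers are bounded by the top one: s^(2 j) \<le>
                4^(N - j) s^(2 N). This is the origin of 4^N in \<open>C2\<close>.\<close>
              have "1 \<le> (2 * s) ^ (2 * (N - j))" using 3 by (intro one_le_power) auto
              also have "\<dots> = 4 ^ (N - j) * s ^ (2 * (N - j))" by (simp add: power_mult_distrib power_mult)
              also have "\<dots> \<le> 4 ^ N * s ^ (2 * (N - j))" using 3 by (intro mult_right_mono power_increasing) auto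
              finally have "s ^ (2 * j) * 1 \<le> s ^ (2 * j) * (4 ^ N * s ^ (2 * (N - j)))" using 3 by (intro mult_left_mono) auto
              also have "\<dots> = 4 ^ N * s ^ (2 * N)" using j by (simp add: power_add[symmetric] mult.left_commute distrib_left[symmetric])
              finally have "s ^ (2 * j) \<le> 4 ^ N * s ^ (2 * N)" by simp
              hence "\<bar>weight_coeff d j\<bar> * (s ^ (2 * j) * (s ^ k * exp (- (\<rho> * s)))) \<le> \<bar>weight_coeff d j\<bar> * ((4 ^ N * s ^ (2 * N)) * (s ^ k * exp (- (\<rho> * s))))"
                using 3 by (intro mult_left_mono mult_right_mono) auto
              thus "\<bar>weight_coeff d j * (indicator {0..} s * (s ^ (2 * j + k) * exp (- (\<rho> * s))))\<bar> \<le> \<bar>weight_coeff d j\<bar> * 4 ^ N * (s ^ ?n * exp (- (\<rho> * s)))"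
                using 3 by (simp add: abs_mult power_add mult_ac)
            qed
            thus ?thesis unfolding C2_def sum_distrib_right .
          qed
          have "norm (G s) \<le> symbol_weight d s * K s + C2 * (s ^ ?n * exp (- (\<rho> * s)))"
            unfolding G_def real_norm_def using w0 K0
            by (intro order_trans[OF abs_triangle_ineq4] add_mono b) (simp add: abs_mult)
          also have "\<dots> \<le> symbol_weight d s * (4 ^ N * exp (- (\<rho> / 2))) + (C1 + C2) * (s ^ ?n * exp (- (\<rho> * s)))"
            using 3 C1(1) by (intro add_mono a mult_right_mono) auto
          finally show ?thesis using 3 by (simp add: add.commute)
        qed
      qed
      thus "AE s in lborel. norm (G s) \<le> (C1 + C2) * (indicator {0..} s * (s ^ ?n * exp (- (\<rho> * s)))) + symbol_weight d s * (4 ^ N * exp (- (\<rho> / 2)))"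
        using AE_lborel_singleton[of 0] by (auto elim!: eventually_mono)
    qed
    also have "\<dots> = (C1 + C2) * (fact ?n / \<rho> ^ Suc ?n) + W * (4 ^ N * exp (- (\<rho> / 2)))"
    proof -
      have "(\<integral>s. symbol_weight d s * (4 ^ N * exp (- (\<rho> / 2))) \<partial>lborel) = (\<integral>s. 4 ^ N * exp (- (\<rho> / 2)) \<partial>symbol_measure d)"
        by (subst integral_symbol_measure(1)) auto
      also have "\<dots> = W * (4 ^ N * exp (- (\<rho> / 2)))" by (simp add: W_def)
      finally show ?thesis
        by (subst Bochner_Integration.integral_add[OF integrable_mult_right[OF int_p(1)] wi])
           (simp only: integral_mult_right_zero int_p(2))
    qed
    \<comment> \<open>One term of the exponential series, of degree \<open>Suc ?n\<close>, converts
      the exponential into exactly the power of \<rho> wanted, for large and small \<rho>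
      alike.\<close>
    also have "\<dots> \<le> (C1 + C2) * (fact ?n / \<rho> ^ Suc ?n) + W * (4 ^ N * (fact (Suc ?n) / (\<rho> / 2) ^ Suc ?n))"
      using W exp_neg_le_power[of "\<rho> / 2" "Suc ?n"] \<rho> by (intro add_left_mono mult_left_mono) auto
    also have "\<dots> = C / \<rho> ^ Suc ?n"
      unfolding C_def power_divide by (simp add: add_divide_distrib del: power_Suc fact_Suc)
    finally show "\<bar>watson_remainder d N k \<rho>\<bar> \<le> C / \<rho> ^ Suc ?n" .
  qed
qed

text \<open>
  Index \<open>n\<close> counts derivatives: if \<open>r k\<close> is the \<open>k\<close>-th derivative, up to sign, of a function of \<open>|X|\<^sup>2\<close>, multiplying by a
  coordinate gains one order of homogeneity.
\<close>

inductive radial :: "(nat \<Rightarrow> real \<Rightarrow> real) \<Rightarrow> nat \<Rightarrow> ('a::euclidean_space \<Rightarrow> complex) \<Rightarrow> bool" for r where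
  radial_base: "radial r (2 * k) (\<lambda>X. of_real (r k (X \<bullet> X)))"
| radial_inner: "radial r (Suc n) f \<Longrightarrow> radial r n (\<lambda>X. of_real (X \<bullet> u) * f X)"
| radial_scale: "radial r n f \<Longrightarrow> radial r n (\<lambda>X. c * f X)"
| radial_add: "radial r n f \<Longrightarrow> radial r n g \<Longrightarrow> radial r n (\<lambda>X. f X + g X)"

text \<open>The derivative of r k (|X|^2) along v is - 2 (X.v) r (k + 1) (|X|^2). Its index is 2 (k
  + 1) - 1 = 2 k + 1, so every derivative raises the index by one; the other cases follow from
  linearity and the product rule.\<close>

lemma radial_deriv:
  assumes r: "\<And>k \<rho>. \<rho> > 0 \<Longrightarrow> (r k has_real_derivative - r (Suc k) \<rho>) (at \<rho>)"
  shows "radial r n f \<Longrightarrow> \<exists>f'. radial r (Suc n) f' \<and>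
    (\<forall>X. X \<noteq> 0 \<longrightarrow> ((\<lambda>t. f (X + t *\<^sub>R v)) has_vector_derivative f' X) (at 0))"
proof (induction rule: radial.induct)
  case (radial_base k)
  let ?f' = "\<lambda>X. of_real (X \<bullet> v) * ((- 2) * of_real (r (Suc k) (X \<bullet> X)))"
  have "radial r (2 * k + 1) ?f'"
    using radial.radial_base[of r "Suc k"] by (intro radial_inner radial_scale) simp
  moreover have "((\<lambda>t. complex_of_real (r k ((X + t *\<^sub>R v) \<bullet> (X + t *\<^sub>R v)))) has_vector_derivative ?f' X) (at 0)" if X: "X \<noteq> 0" for X
  proof -
    have 1: "((\<lambda>t. (X + t *\<^sub>R v) \<bullet> (X + t *\<^sub>R v)) has_real_derivative 2 * (X \<bullet> v)) (at 0)"
    proof -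
      have "(X + t *\<^sub>R v) \<bullet> (X + t *\<^sub>R v) = X \<bullet> X + 2 * (X \<bullet> v) * t + (v \<bullet> v) * t\<^sup>2" for t
        by (simp add: inner_add_left inner_add_right inner_commute power2_eq_square)
      moreover have "((\<lambda>t. X \<bullet> X + 2 * (X \<bullet> v) * t + (v \<bullet> v) * t\<^sup>2) has_real_derivative 2 * (X \<bullet> v)) (at 0)"
        by (auto intro!: derivative_eq_intros)
      ultimately show ?thesis by simp
    qed
    have "(r k has_real_derivative - r (Suc k) (X \<bullet> X)) (at ((X + 0 *\<^sub>R v) \<bullet> (X + 0 *\<^sub>R v)))"
      using r[of "X \<bullet> X" k] X by simp
    from DERIV_chain2[OF this 1]
    have "((\<lambda>t. r k ((X + t *\<^sub>R v) \<bullet> (X + t *\<^sub>R v))) has_real_derivative (- r (Suc k) (X \<bullet> X)) * (2 * (X \<bullet> v))) (at 0)" .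
    hence "((\<lambda>t. complex_of_real (r k ((X + t *\<^sub>R v) \<bullet> (X + t *\<^sub>R v)))) has_vector_derivative of_real ((- r (Suc k) (X \<bullet> X)) * (2 * (X \<bullet> v)))) (at 0)"
      by (intro has_vector_derivative_of_real) (simp add: has_real_derivative_iff_has_vector_derivative)
    thus ?thesis by (simp add: mult_ac)
  qed
  ultimately show ?case by (intro exI[of _ ?f']) simp
next
  case (radial_inner n f u)
  then obtain f' where f': "radial r (Suc (Suc n)) f'" "\<And>X. X \<noteq> 0 \<Longrightarrow> ((\<lambda>t. f (X + t *\<^sub>R v)) has_vector_derivative f' X) (at 0)"
    by blast
  let ?g = "\<lambda>X. of_real (X \<bullet> u) * f' X + of_real (v \<bullet> u) * f X"
  have "radial r (Suc n) ?g" by (intro radial.radial_add radial.radial_inner radial.radial_scale f' radial_inner)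
  moreover have "((\<lambda>t. of_real ((X + t *\<^sub>R v) \<bullet> u) * f (X + t *\<^sub>R v)) has_vector_derivative ?g X) (at 0)" if X: "X \<noteq> 0" for X
  proof -
    have "((\<lambda>t. complex_of_real ((X + t *\<^sub>R v) \<bullet> u)) has_vector_derivative of_real (v \<bullet> u)) (at 0)"
      by (auto intro!: derivative_eq_intros simp: inner_add_left)
    from has_vector_derivative_mult[OF this f'(2)[OF X]] show ?thesis by simp
  qed
  ultimately show ?case by blast
next
  case (radial_scale n f c)
  then obtain f' where f': "radial r (Suc n) f'" "\<And>X. X \<noteq> 0 \<Longrightarrow> ((\<lambda>t. f (X + t *\<^sub>R v)) has_vector_derivative f' X) (at 0)"
    by blast
  show ?case using f' by (intro exI[of _ "\<lambda>X. c * f' X"]) (auto intro: radial.radial_scale has_vector_derivative_mult_right)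
next
  case (radial_add n f g)
  then obtain f' g' where "radial r (Suc n) f'" "\<And>X. X \<noteq> 0 \<Longrightarrow> ((\<lambda>t. f (X + t *\<^sub>R v)) has_vector_derivative f' X) (at 0)"
    "radial r (Suc n) g'" "\<And>X. X \<noteq> 0 \<Longrightarrow> ((\<lambda>t. g (X + t *\<^sub>R v)) has_vector_derivative g' X) (at 0)"
    by blast
  thus ?case by (intro exI[of _ "\<lambda>X. f' X + g' X"]) (auto intro: radial.radial_add has_vector_derivative_add)
qed

text \<open>The function g is fixed before F, which makes the final constant independent of the
  symbol. Agreement away from the origin suffices because the derivatives are local and the
  complement of 0 is open.\<close>

lemma radial_partial_derivs:
  assumes r: "\<And>k \<rho>. \<rho> > 0 \<Longrightarrow> (r k has_real_derivative - r (Suc k) \<rho>) (at \<rho>)"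
    and f: "radial r n f"
  shows "\<exists>g. radial r (n + length vs) g \<and>
    (\<forall>F. (\<forall>X. X \<noteq> 0 \<longrightarrow> F X = f X) \<longrightarrow> (\<forall>X. X \<noteq> 0 \<longrightarrow> foldr partial_deriv vs F X = g X))"
proof (induction vs)
  case Nil
  show ?case using f by (intro exI[of _ f]) auto
next
  case (Cons v vs)
  then obtain g where g: "radial r (n + length vs) g"
    "\<And>F X. (\<And>X. X \<noteq> 0 \<Longrightarrow> F X = f X) \<Longrightarrow> X \<noteq> 0 \<Longrightarrow> foldr partial_deriv vs F X = g X" by blast
  obtain g' where g': "radial r (Suc (n + length vs)) g'"
    "\<And>X. X \<noteq> 0 \<Longrightarrow> ((\<lambda>t. g (X + t *\<^sub>R v)) has_vector_derivative g' X) (at 0)"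
    using radial_deriv[OF r g(1)] by blast
  have "foldr partial_deriv (v # vs) F X = g' X" if F: "\<And>X. X \<noteq> 0 \<Longrightarrow> F X = f X" and X: "X \<noteq> 0" for F X
  proof -
    \<comment> \<open>The line through X may meet the origin, so the comparison is restricted to an
      open set of parameters around 0.\<close>
    let ?S = "{t. X + t *\<^sub>R v \<noteq> 0}"
    have "open ?S" by (intro open_Collect_neq continuous_intros)
    moreover have "0 \<in> ?S" using X by simp
    moreover have "g (X + t *\<^sub>R v) = foldr partial_deriv vs F (X + t *\<^sub>R v)" if "t \<in> ?S" for t
      using g(2)[OF F] that by simp
    ultimately have "((\<lambda>t. foldr partial_deriv vs F (X + t *\<^sub>R v)) has_vector_derivative g' X) (at 0)"
      by (rule has_vector_derivative_transform_within_open[OF g'(2)[OF X]])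
    thus ?thesis by (simp add: partial_deriv_def vector_derivative_at)
  qed
  thus ?case using g'(1) by (intro exI[of _ g']) auto
qed

text \<open>With \<rho> = |X|^2 the k-th bound reads |X|^(-2 - 4 N - 2 k), which is index 2 k;
  multiplying by a coordinate costs one power of |X| and lowers the index by one.\<close>

lemma radial_bound:
  assumes r: "\<And>k. \<exists>C\<ge>0. \<forall>\<rho>>0. \<bar>r k \<rho>\<bar> \<le> C / \<rho> ^ Suc (2 * N + k)"
  shows "radial r n f \<Longrightarrow> \<exists>C\<ge>0. \<forall>X. X \<noteq> 0 \<longrightarrow> norm (f X) \<le> C * norm X powi (- 2 - 4 * int N - int n)"
proof (induction rule: radial.induct)
  case (radial_base k)
  obtain C where C: "C \<ge> 0" "\<And>\<rho>. \<rho> > 0 \<Longrightarrow> \<bar>r k \<rho>\<bar> \<le> C / \<rho> ^ Suc (2 * N + k)" using r by blast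
  have "norm (complex_of_real (r k (X \<bullet> X))) \<le> C * norm X powi (- 2 - 4 * int N - int (2 * k))" if X: "X \<noteq> 0" for X :: 'a
  proof -
    have "(X \<bullet> X) ^ Suc (2 * N + k) = norm X powi (2 * int (Suc (2 * N + k)))"
      unfolding power2_norm_eq_inner[symmetric] power_mult[symmetric] by (simp flip: power_int_of_nat)
    hence "C / (X \<bullet> X) ^ Suc (2 * N + k) = C * norm X powi (- (2 * int (Suc (2 * N + k))))"
      by (simp only: power_int_minus divide_inverse)
    also have "- (2 * int (Suc (2 * N + k))) = - 2 - 4 * int N - int (2 * k)" by simp
    finally show ?thesis using C(2)[of "X \<bullet> X"] X by simp
  qed
  thus ?case using C(1) by blast
next
  case (radial_inner n f u)
  then obtain C where C: "C \<ge> 0" "\<And>X. X \<noteq> 0 \<Longrightarrow> norm (f X) \<le> C * norm X powi (- 2 - 4 * int N - int (Suc n))" by blast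
  have "norm (of_real (X \<bullet> u) * f X) \<le> (norm u * C) * norm X powi (- 2 - 4 * int N - int n)" if X: "X \<noteq> 0" for X
  proof -
    have "norm (of_real (X \<bullet> u) * f X) \<le> (norm X * norm u) * (C * norm X powi (- 2 - 4 * int N - int (Suc n)))"
      unfolding norm_mult norm_of_real by (intro mult_mono C Cauchy_Schwarz_ineq2 X) auto
    also have "\<dots> = (norm u * C) * (norm X powi 1 * norm X powi (- 2 - 4 * int N - int (Suc n)))" by (simp add: mult_ac)
    also have "norm X powi 1 * norm X powi (- 2 - 4 * int N - int (Suc n)) = norm X powi (- 2 - 4 * int N - int n)"
    proof -
      have "- 2 - 4 * int N - int n = 1 + (- 2 - 4 * int N - int (Suc n))" by simp
      thus ?thesis using X by (simp only: power_int_add simp_thms norm_eq_zero)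
    qed
    finally show ?thesis .
  qed
  thus ?case using C(1) by (intro exI[of _ "norm u * C"]) auto
next
  case (radial_scale n f c)
  then obtain C where C: "C \<ge> 0" "\<And>X. X \<noteq> 0 \<Longrightarrow> norm (f X) \<le> C * norm X powi (- 2 - 4 * int N - int n)" by blast
  thus ?case by (intro exI[of _ "norm c * C"]) (auto simp: norm_mult mult.assoc intro!: mult_left_mono)
next
  case (radial_add n f g)
  then obtain C D where "C \<ge> 0" "D \<ge> 0" "\<And>X. X \<noteq> 0 \<Longrightarrow> norm (f X) \<le> C * norm X powi (- 2 - 4 * int N - int n)"
    "\<And>X. X \<noteq> 0 \<Longrightarrow> norm (g X) \<le> D * norm X powi (- 2 - 4 * int N - int n)" by blast
  thus ?case by (intro exI[of _ "C + D"]) (auto simp: distrib_right intro!: norm_triangle_le add_mono)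
qed

section \<open>Coefficients of the expansion\<close>

lemma fact_double: "fact (2 * j) = real (odd_double_fact j) * 2 ^ j * fact j"
proof (induction j)
  case (Suc j)
  have "odd_double_fact (Suc j) = odd_double_fact j * (2 * j + 1)"
    by (simp add: odd_double_fact_def)
  moreover have "(fact (2 * Suc j) :: real) = (2 * real j + 2) * ((2 * real j + 1) * fact (2 * j))"
    by (simp add: algebra_simps)
  ultimately show ?case using Suc by (simp add: algebra_simps)
qed (simp add: odd_double_fact_def)

text \<open>The factor j! of \<open>fact_double\<close> cancels the denominator of the generalized
  binomial coefficient, and 2^j turns the factors d/2 - l, with l = i + 1, into d - 2 l.\<close>

lemma weight_coeff_fact: "weight_coeff d j * fact (2 * j) = (-1) ^ j * real (odd_double_fact j) * (\<Prod>l=1..j. real d - 2 * real l)"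
proof -
  have "(real d / 2 - 1) gchoose j = (\<Prod>i=0..<j. real d / 2 - 1 - real i) / fact j"
    by (rule gbinomial_prod_rev)
  also have "(\<Prod>i=0..<j. real d / 2 - 1 - real i) = (\<Prod>l=1..j. (real d - 2 * real l) / 2)"
    by (rule prod.reindex_bij_witness[of _ "\<lambda>l. l - 1" Suc]) (auto simp: field_simps)
  also have "\<dots> = (\<Prod>l=1..j. real d - 2 * real l) / 2 ^ j" by (simp add: prod_dividef)
  finally show ?thesis unfolding weight_coeff_def fact_double by simp
qed

text \<open>Identifies each term of the expansion with a subtracted term of
  \<open>watson_remainder\<close> for k = 0, since 2 + 4 j = 2 (2 j + 1). At the origin both sides
  are 0 by the conventions for division and negative powers.\<close>

lemma expansion_term_eq:
  fixes X :: "(real ^ 'd) \<times> (real ^ 'd)"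
  shows "expansion_term j X = weight_coeff CARD('d) j * (fact (2 * j) / (X \<bullet> X) ^ Suc (2 * j))"
proof -
  have "(X \<bullet> X) ^ Suc (2 * j) = norm X powi (2 * int (Suc (2 * j)))"
    unfolding power2_norm_eq_inner[symmetric] power_mult[symmetric] by (simp flip: power_int_of_nat)
  moreover have "- 2 - 4 * int j = - (2 * int (Suc (2 * j)))" by simp
  ultimately have "norm X powi (- 2 - 4 * int j) = inverse ((X \<bullet> X) ^ Suc (2 * j))"
    by (simp only: power_int_minus)
  thus ?thesis unfolding expansion_term_def weight_coeff_fact[symmetric] by (simp add: divide_inverse)
qed

text \<open>Transfers the identification to the given definition: the normalizing factor of the
  quantization formula is moved to the side of the solution, almost everywhere in x.\<close>

lemma weyl_symbol_eq:
  fixes b :: "(real ^ 'd) \<times> (real ^ 'd) \<Rightarrow> complex"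
  assumes b: "is_weyl_symbol (harmonic_oscillator_L2\<inverse>\<inverse>) b"
  shows "b X = of_real (laplace_weight CARD('d) 0 (X \<bullet> X))"
proof -
  have "amplitude b" using b by (simp add: is_weyl_symbol_def)
  moreover have "AE x in lborel. has_oscillatory_integral (\<lambda>(y, \<xi>). osc_amp b (mehler 1 p q) x y \<xi>)
      (of_real ((2 * pi) ^ DIM(real ^ 'd)) * mehler_solution p q x)" for p q
    using weyl_symbol_mehler_solution[OF b, of p q]
  proof eventually_elim
    case (elim x)
    then obtain I where I: "has_oscillatory_integral (\<lambda>(y, \<xi>). osc_amp b (mehler 1 p q) x y \<xi>) I"
      "mehler_solution p q x = of_real ((2 * pi) powi (- int CARD('d))) * I"
      unfolding has_weyl_value_def osc_amp_def by blast
    have "I = of_real ((2 * pi) ^ DIM(real ^ 'd)) * mehler_solution p q x"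
    proof -
      have "(2 * pi) ^ DIM(real ^ 'd) * (2 * pi) powi (- int CARD('d)) = 1"
        by (simp add: power_int_minus field_simps)
      thus ?thesis unfolding I(2) mult.assoc[symmetric] of_real_mult[symmetric] by simp
    qed
    thus ?case using I(1) by simp
  qed
  ultimately have "b X = of_real (laplace_weight DIM(real ^ 'd) 0 (X \<bullet> X))" by (rule symbol_unique)
  thus ?thesis by simp
qed

theorem theorem4p8:
  fixes N :: nat
    and \<alpha> :: "(real ^ 'd) \<times> (real ^ 'd) \<Rightarrow> nat"
  assumes "N \<ge> 1"
  shows "\<exists>C>0. \<forall>b :: (real ^ 'd) \<times> (real ^ 'd) \<Rightarrow> complex.
           is_weyl_symbol (harmonic_oscillator_L2\<inverse>\<inverse>) b \<longrightarrow>
           (\<forall>X. X \<noteq> 0 \<longrightarrow>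
             norm (multi_deriv \<alpha> (\<lambda>Y. b Y - of_real (\<Sum>j<N. expansion_term j Y)) X)
               \<le> C * norm X powi (-2 - 4 * int N - int (multi_order \<alpha>)))"
proof -
  have d: "CARD('d) \<ge> 1" by (simp add: Suc_leI)
  let ?r = "watson_remainder CARD('d) N"
  have r: "\<And>k \<rho>. \<rho> > 0 \<Longrightarrow> (?r k has_real_derivative - ?r (Suc k) \<rho>) (at \<rho>)" by (rule watson_remainder_deriv[OF d])
  obtain vs where vs: "length vs = multi_order \<alpha>"
    "\<And>f :: (real ^ 'd) \<times> (real ^ 'd) \<Rightarrow> complex. multi_deriv \<alpha> f = foldr partial_deriv vs f"
    using multi_deriv_list[of \<alpha>] by blast
  have "radial ?r 0 (\<lambda>X :: (real ^ 'd) \<times> (real ^ 'd). of_real (?r 0 (X \<bullet> X)))" using radial_base[of ?r 0] by simp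
  from radial_partial_derivs[OF r this, of vs]
  obtain g where g: "radial ?r (length vs) g" "\<And>F X. (\<And>X :: (real ^ 'd) \<times> (real ^ 'd). X \<noteq> 0 \<Longrightarrow> F X = of_real (?r 0 (X \<bullet> X))) \<Longrightarrow> X \<noteq> 0 \<Longrightarrow>
      foldr partial_deriv vs F X = g X" by auto
  obtain C where C: "C \<ge> 0" "\<And>X. X \<noteq> 0 \<Longrightarrow> norm (g X) \<le> C * norm X powi (- 2 - 4 * int N - int (length vs))"
    using radial_bound[OF watson_remainder_bound[OF d] g(1)] by blast
  show ?thesis
  \<comment> \<open>\<open>C\<close> comes from \<open>g\<close> alone and is thus available before
    b; adding one makes it strictly positive.\<close>
  proof (intro exI[of _ "C + 1"] conjI allI impI)
    fix b :: "(real ^ 'd) \<times> (real ^ 'd) \<Rightarrow> complex" and X :: "(real ^ 'd) \<times> (real ^ 'd)"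
    assume b: "is_weyl_symbol (harmonic_oscillator_L2\<inverse>\<inverse>) b" and X: "X \<noteq> 0"
    have "multi_deriv \<alpha> (\<lambda>Y. b Y - of_real (\<Sum>j<N. expansion_term j Y)) X = g X"
      unfolding vs(2) by (rule g(2)[OF _ X]) (simp add: weyl_symbol_eq[OF b] expansion_term_eq watson_remainder_def)
    hence "norm (multi_deriv \<alpha> (\<lambda>Y. b Y - of_real (\<Sum>j<N. expansion_term j Y)) X) \<le> C * norm X powi (- 2 - 4 * int N - int (multi_order \<alpha>))"
      using C(2)[OF X] vs(1) by simp
    also have "\<dots> \<le> (C + 1) * norm X powi (- 2 - 4 * int N - int (multi_order \<alpha>))" by (intro mult_right_mono) auto
    finally show "norm (multi_deriv \<alpha> (\<lambda>Y. b Y - of_real (\<Sum>j<N. expansion_term j Y)) X)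
               \<le> (C + 1) * norm X powi (-2 - 4 * int N - int (multi_order \<alpha>))" .
  qed (use C(1) in simp)
qed

end
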